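(* Let $k\ge2$, $d=k(k+1)/2$, $r=r_k$, let $\nu=\nu_0+\nu_1+\nu_2$ be the Kusuoka measure on $SG_k$, $R_i=d\nu_i/d\nu$, and for $j=0,\dots,d-1$ let $Q_j=\sum_{i=0}^2S^j_iR_i$, where $S^j_i$ is the sum of column $i$ of the matrix $M_j$ defined below. If $u\in\operatorname{dom}\Delta_\nu$, then for each $j$ the function $u\circ F_j$ satisfies $$\Delta_\nu(u\circ F_j)=r\,Q_j\,(\Delta_\nu u)\circ F_j\qquad\nu\text{-almost everywhere},$$ in the weak sense that $\mathcal E(u\circ F_j,v)=-\int_K r\,Q_j\,(\Delta_\nu u)\circ F_j\,v\,d\nu$ for all $v\in\operatorname{dom}_0\mathcal E$.
   Context: Let $q_0,q_1,q_2$ be the vertices of a unit equilateral triangle $T\subset\mathbb R^2$. Fix $k\ge2$ and $d=k(k+1)/2$. Let $F_n(x)=x/k+b_n$, $n=0,\dots,d-1$, be the similitudes mapping $T$ onto the $d$ triangles of side $1/k$ with the same orientation as $T$ in the subdivision of $T$ into $k^2$ triangles. $SG_k$ is $K=\bigcup_nF_n(K)$. Notation: $F_w=F_{w_1}\circ\cdots\circ F_{w_m}$, $V_0=\{q_0,q_1,q_2\}$, $V_m=\bigcup_{|w|=m}F_w(V_0)$. The graph $\Gamma_m$ has $x\sim_my$ iff $x\ne y$ and $x,y\in F_w(V_0)$ for some $|w|=m$. Energy: $\mathcal E_m(u)=r^{-m}\sum_{x\sim_my}(u(x)-u(y))^2$, where $r=r_k$ is the unique $r>0$ with $\min\{\mathcal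 E_1(\tilde u):\tilde u|_{V_0}=u\}=\mathcal E_0(u)$ for all $u$ on $V_0$. Then $\mathcal E(u)=\lim_m\mathcal E_m(u|_{V_m})$, $\operatorname{dom}\mathcal E=\{u\in C(K):\mathcal E(u)<\infty\}$, $\operatorname{dom}_0\mathcal E$ consists of those vanishing on $V_0$, and $\mathcal E(u,v)$ is the bilinear form. A function $h$ is harmonic if $\mathcal E_m(h|_{V_m})=\mathcal E_0(h|_{V_0})$ for all $m$. $h_i$ is harmonic with $h_i(q_j)=\delta_{ij}$. Energy measures: $\nu_u(F_wK)=r^{-|w|}\mathcal E(u\circ F_w)$, and $\nu_i=\nu_{h_i}$. Laplacian: $u\in\operatorname{dom}\Delta_\nu$ with $\Delta_\nu u=f$ ($f$ continuous) iff $u\in\operatorname{dom}\mathcal E$ and $\mathcal E(u,v)=-\int_Kfv\,d\nu$ for all $v\in\operatorname{dom}_0\mathcal E$. $p^j_{ni}$ is the probability that the simple random walk on $\Gamma_1$ started at $F_n(q_i)$ hits $q_j$ before the other two points of $V_0$. The matrix $M_n=[\mu^n_{ji}]$ has entries $\mu^n_{j0}=\frac1r((p^j_{n0})^2-p^j_{n0}p^j_{n1}-p^j_{n0}p^j_{n2}+p^j_{n1}p^j_{n2})$, $\mu^n_{j1}=\frac1r((p^j_{n1})^2-p^j_{n0}p^j_{n1}+p^j_{n0}p^j_{n2}-p^j_{n1}p^j_{n2})$, $\mu^n_{j2}=\frac1r((p^j_{n2})^2+p^j_{n0}p^j_{n1}-p^j_{n0}p^j_{n2}-p^j_{n1}p^j_{n2})$.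 *)

theory Defs
  imports "HOL-Analysis.Analysis"
begin

definition omega :: complex where "omega = cis (pi / 3)"

definition q :: "nat \<Rightarrow> complex" where
  "q i = (if i = 0 then 0 else if i = 1 then 1 else omega)"

definition V0 :: "complex set" where "V0 = {q 0, q 1, q 2}"

definition d :: "nat \<Rightarrow> nat" where "d k = k * (k + 1) div 2"

text \<open>Enumeration of the d upward triangles of side 1/k: the triangle with lower-left
  vertex (a + b*omega)/k, where a + b \<le> k - 1.\<close>
definition cell_list :: "nat \<Rightarrow> (nat \<times> nat) list" where
  "cell_list k = concat (map (\<lambda>a. map (\<lambda>b. (a, b)) [0..<k - a]) [0..<k])"

definition bvec :: "nat \<Rightarrow> nat \<Rightarrow> complex" where
  "bvec k n = (case cell_list k ! n of (a, b) \<Rightarrow> (of_nat a + of_nat b * omega) / of_nat k)"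

definition F :: "nat \<Rightarrow> nat \<Rightarrow> complex \<Rightarrow> complex" where
  "F k n x = x / of_nat k + bvec k n"

definition words :: "nat \<Rightarrow> nat \<Rightarrow> nat list set" where
  "words k m = {w. length w = m \<and> set w \<subseteq> {..<d k}}"

definition Fw :: "nat \<Rightarrow> nat list \<Rightarrow> complex \<Rightarrow> complex" where
  "Fw k w = foldr (\<lambda>n f. F k n \<circ> f) w id"

definition K :: "nat \<Rightarrow> complex set" where
  "K k = (THE S. compact S \<and> S \<noteq> {} \<and> S = (\<Union>n<d k. F k n ` S))"

definition V :: "nat \<Rightarrow> nat \<Rightarrow> complex set" where
  "V k m = (\<Union>w\<in>words k m. Fw k w ` V0)"

definition adj :: "nat \<Rightarrow> nat \<Rightarrow> complex \<Rightarrow> complex \<Rightarrow> bool" where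
  "adj k m x y \<longleftrightarrow> x \<noteq> y \<and> (\<exists>w\<in>words k m. x \<in> Fw k w ` V0 \<and> y \<in> Fw k w ` V0)"

definition edges :: "nat \<Rightarrow> nat \<Rightarrow> (complex \<times> complex) set" where
  "edges k m = {(x, y). adj k m x y}"

text \<open>Graph energies; each (unordered) edge is counted once, hence the factor 1/2
  over ordered pairs.\<close>
definition GE :: "nat \<Rightarrow> nat \<Rightarrow> (complex \<Rightarrow> real) \<Rightarrow> real" where
  "GE k m u = (1/2) * (\<Sum>(x, y)\<in>edges k m. (u x - u y)^2)"

definition GB :: "nat \<Rightarrow> nat \<Rightarrow> (complex \<Rightarrow> real) \<Rightarrow> (complex \<Rightarrow> real) \<Rightarrow> real" where
  "GB k m u v = (1/2) * (\<Sum>(x, y)\<in>edges k m. (u x - u y) * (v x - v y))"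

definition rk :: "nat \<Rightarrow> real" where
  "rk k = (THE r. r > 0 \<and>
     (\<forall>u. (INF ut\<in>{ut. \<forall>x\<in>V0. ut x = u x}. GE k 1 ut / r) = GE k 0 u))"

definition Em :: "nat \<Rightarrow> nat \<Rightarrow> (complex \<Rightarrow> real) \<Rightarrow> real" where
  "Em k m u = GE k m u / rk k ^ m"

definition Ebm :: "nat \<Rightarrow> nat \<Rightarrow> (complex \<Rightarrow> real) \<Rightarrow> (complex \<Rightarrow> real) \<Rightarrow> real" where
  "Ebm k m u v = GB k m u v / rk k ^ m"

definition Energy :: "nat \<Rightarrow> (complex \<Rightarrow> real) \<Rightarrow> ereal" where
  "Energy k u = lim (\<lambda>m. ereal (Em k m u))"

definition domE :: "nat \<Rightarrow> (complex \<Rightarrow> real) set" where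
  "domE k = {u. continuous_on (K k) u \<and> Energy k u < \<infinity>}"

definition dom0 :: "nat \<Rightarrow> (complex \<Rightarrow> real) set" where
  "dom0 k = {u \<in> domE k. \<forall>x\<in>V0. u x = 0}"

definition Eform :: "nat \<Rightarrow> (complex \<Rightarrow> real) \<Rightarrow> (complex \<Rightarrow> real) \<Rightarrow> real" where
  "Eform k u v = lim (\<lambda>m. Ebm k m u v)"

definition harmonic :: "nat \<Rightarrow> (complex \<Rightarrow> real) \<Rightarrow> bool" where
  "harmonic k h \<longleftrightarrow> (\<forall>m. Em k m h = Em k 0 h)"

definition harm :: "nat \<Rightarrow> nat \<Rightarrow> complex \<Rightarrow> real" where
  "harm k i = (SOME h. h \<in> domE k \<and> harmonic k h \<and>
                  (\<forall>j<3. h (q j) = (if i = j then 1 else 0)))"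

definition energy_measure :: "nat \<Rightarrow> (complex \<Rightarrow> real) \<Rightarrow> complex measure" where
  "energy_measure k u = (SOME \<mu>. sets \<mu> = sets (restrict_space borel (K k)) \<and>
     (\<forall>w. set w \<subseteq> {..<d k} \<longrightarrow>
        emeasure \<mu> (Fw k w ` K k) =
          ennreal (real_of_ereal (Energy k (u \<circ> Fw k w)) / rk k ^ length w)))"

definition kusuoka :: "nat \<Rightarrow> complex measure" where
  "kusuoka k = (SOME \<mu>. sets \<mu> = sets (restrict_space borel (K k)) \<and>
     (\<forall>A\<in>sets \<mu>. emeasure \<mu> A = (\<Sum>i<3. emeasure (energy_measure k (harm k i)) A)))"

definition R :: "nat \<Rightarrow> nat \<Rightarrow> complex \<Rightarrow> real" where
  "R k i x = enn2real (RN_deriv (kusuoka k) (energy_measure k (harm k i)) x)"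

definition deg :: "nat \<Rightarrow> complex \<Rightarrow> nat" where
  "deg k x = card {y. adj k 1 x y}"

definition hit_paths :: "nat \<Rightarrow> nat \<Rightarrow> complex \<Rightarrow> nat \<Rightarrow> complex list set" where
  "hit_paths k j x L = {ps. length ps = Suc L \<and> ps ! 0 = x \<and> ps ! L = q j \<and>
      (\<forall>t<L. adj k 1 (ps ! t) (ps ! Suc t) \<and> ps ! t \<notin> V0)}"

definition hit_prob :: "nat \<Rightarrow> nat \<Rightarrow> complex \<Rightarrow> real" where
  "hit_prob k j x = (\<Sum>L. \<Sum>ps\<in>hit_paths k j x L. \<Prod>t<L. 1 / real (deg k (ps ! t)))"

definition p :: "nat \<Rightarrow> nat \<Rightarrow> nat \<Rightarrow> nat \<Rightarrow> real" where
  "p k j n i = hit_prob k j (F k n (q i))"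

text \<open>mu k n j i = mu^n_{ji}, the (j,i) entry of M_n.\<close>
definition mu :: "nat \<Rightarrow> nat \<Rightarrow> nat \<Rightarrow> nat \<Rightarrow> real" where
  "mu k n j i =
    (let p0 = p k j n 0; p1 = p k j n 1; p2 = p k j n 2 in
     (if i = 0 then (p0^2 - p0*p1 - p0*p2 + p1*p2)
      else if i = 1 then (p1^2 - p0*p1 + p0*p2 - p1*p2)
      else (p2^2 + p0*p1 - p0*p2 - p1*p2)) / rk k)"

definition S :: "nat \<Rightarrow> nat \<Rightarrow> nat \<Rightarrow> real" where
  "S k n i = (\<Sum>j<3. mu k n j i)"

definition Q :: "nat \<Rightarrow> nat \<Rightarrow> complex \<Rightarrow> real" where
  "Q k n x = (\<Sum>i<3. S k n i * R k i x)"

text \<open>lap_rel k u f: u is in dom Delta_nu and Delta_nu u = f.\<close>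
definition lap_rel :: "nat \<Rightarrow> (complex \<Rightarrow> real) \<Rightarrow> (complex \<Rightarrow> real) \<Rightarrow> bool" where
  "lap_rel k u f \<longleftrightarrow> u \<in> domE k \<and> continuous_on (K k) f \<and>
     (\<forall>v\<in>dom0 k. Eform k u v = - (\<integral>x. f x * v x \<partial>kusuoka k))"

end

theory Submission
  imports Defs
begin

text \<open>
  Fix a cell \<open>F_j\<close>. A test function \<open>v\<close> vanishing on \<open>V_0\<close> extended by zero from \<open>F_j K\<close>, say to
  \<open>v'\<close>, is again a test function, because distinct cells meet only in vertices; and self-similarity
  of the graph energies gives \<open>E (u, v') = E (u o F_j, v) / r\<close>. So the claim reduces to the change
  of variables \<open>d (nu o F_j) = Q_j d nu\<close>. Energy measures are determined by their values on cells
  because vertices are null sets, so it suffices to compare both sides on \<open>F_w K\<close>. There the quantity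
  \<open>nu_j (F_n F_w K)\<close> is a quadratic form in the boundary values \<open>p^j_(n0), p^j_(n1), p^j_(n2)\<close> of
  \<open>h_j o F_n\<close> that annihilates constants, and expanding it in \<open>h_0, h_1, h_2\<close> with
  \<open>h_0 + h_1 + h_2 = 1\<close> produces exactly the coefficients of \<open>M_n\<close>.
\<close>

section \<open>Geometry of the cells\<close>

text \<open>The objects of the statement are selected by \<open>THE\<close> or \<open>SOME\<close>,
  so most of the work is to show that they exist and to compute them: the attractor, r, the
  functions h_i, the energy measures and their sum. The analytic input behind the limits is r < 1.
  It makes harmonic extensions converge uniformly, and together with the identity
  \<open>corner_current\<close> it makes the energy of the cells around a vertex tend to zero. The
  second point is essential because neighbouring cells share vertices: an atom there would be
  counted in two cells, and cell values could not be additive. Energy measures are obtained as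
  images of Lebesgue measure: the cell weights cut an interval into nested pieces, and a number is
  sent to the point whose address is given by the pieces containing it. A last obstacle is that Q_j
  is a combination of densities with coefficients of which no sign is established; that it is a
  density at all follows afterwards, because its integrals are values of a measure.\<close>

definition cX :: "complex \<Rightarrow> real" where "cX z = Re z - Re omega * (Im z / Im omega)"
text \<open>Together with \<open>cX\<close> these are the coordinates for the oblique basis 1,
  \<open>omega\<close>. In them \<open>F k n\<close> adds an integer offset and divides by k, so the
  incidence of cells becomes arithmetic of natural numbers.\<close>

definition cY :: "complex \<Rightarrow> real" where "cY z = Im z / Im omega"

lemma Im_omega: "Im omega > 0"
proof -
  have "sin (pi/3) > 0" by (simp add: sin_60)
  then show ?thesis by (simp add: omega_def)
qed

lemma coord_eqI: "cX z = cX z' \<Longrightarrow> cY z = cY z' \<Longrightarrow> z = z'"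
  using Im_omega by (auto simp: cX_def cY_def complex_eq_iff)

lemma coord_simps [simp]:
  "cX 0 = 0" "cY 0 = 0" "cX 1 = 1" "cY 1 = 0" "cX omega = 0" "cY omega = 1"
  "cX (of_nat m) = m" "cY (of_nat m) = 0"
  using Im_omega by (simp_all add: cX_def cY_def)

lemma coord_add [simp]: "cX (z + z') = cX z + cX z'" "cY (z + z') = cY z + cY z'"
  using Im_omega by (simp_all add: cX_def cY_def field_simps)

lemma coord_mult [simp]: "cX (of_nat m * z) = m * cX z" "cY (of_nat m * z) = m * cY z"
  using Im_omega by (simp_all add: cX_def cY_def field_simps)

lemma coord_divide [simp]: "cX (z / of_nat m) = cX z / m" "cY (z / of_nat m) = cY z / m"
  by (simp_all add: cX_def cY_def diff_divide_distrib)

lemma q_simps [simp]: "q 0 = 0" "q (Suc 0) = 1" "q 2 = omega" "q (Suc (Suc 0)) = omega"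
  by (simp_all add: q_def)

lemma q_inj: "i < 3 \<Longrightarrow> j < 3 \<Longrightarrow> q i = q j \<longleftrightarrow> i = j"
proof -
  have "omega \<noteq> 0" "omega \<noteq> 1" using Im_omega by auto
  moreover assume "i < 3" "j < 3"
  ultimately show ?thesis by (auto simp: q_def)
qed

lemma V0_eq: "V0 = q ` {..<3}"
  by (auto simp: V0_def lessThan_nat_numeral lessThan_Suc numeral_3_eq_3)

lemma q_in_V0: "i < 3 \<Longrightarrow> q i \<in> V0"
  by (auto simp: V0_eq)

lemma V0E: assumes "x \<in> V0" obtains i where "i < 3" "x = q i"
  using assms by (auto simp: V0_eq)

text \<open>The filled triangle. It contains both the attractor and all vertices, and is all that
  the incidence arguments need to know about them.\<close>

definition Tri :: "complex set" where
  "Tri = {z. 0 \<le> cX z \<and> 0 \<le> cY z \<and> cX z + cY z \<le> 1}"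

lemma V0_Tri: "V0 \<subseteq> Tri"
  by (auto simp: V0_def Tri_def)

lemma isCont_cX: "continuous_on UNIV cX" and isCont_cY: "continuous_on UNIV cY"
  unfolding cX_def cY_def using Im_omega by (auto intro!: continuous_intros)

lemma closed_Tri: "closed Tri"
  unfolding Tri_def using isCont_cX isCont_cY
  by (intro closed_Collect_conj closed_Collect_le continuous_intros) auto

lemma z_coord: "z = of_real (cX z) + of_real (cY z) * omega"
  using Im_omega by (auto simp: complex_eq_iff cX_def cY_def)

lemma bounded_Tri: "bounded Tri"
proof (rule boundedI)
  fix z assume z: "z \<in> Tri"
  have "norm z = norm (of_real (cX z) + of_real (cY z) * omega)"
    using z_coord[of z] by simp
  also have "\<dots> \<le> \<bar>cX z\<bar> + \<bar>cY z\<bar> * norm omega"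
    by (metis norm_mult norm_of_real norm_triangle_ineq)
  also have "\<dots> \<le> 1 + 1"
    using z by (auto simp: Tri_def omega_def)
  finally show "norm z \<le> 2" by simp
qed

lemma set_cell_list: "set (cell_list k) = {(a, b). a + b < k}"
  by (auto simp: cell_list_def image_iff)

lemma distinct_cell_list: "distinct (cell_list k)"
proof -
  have "distinct (concat (map (\<lambda>a. map (\<lambda>b. (a, b)) [0..<k - a]) [0..<m]))" for m
    by (induction m) (auto simp: distinct_map inj_on_def)
  then show ?thesis by (simp add: cell_list_def)
qed

lemma length_cell_list: "length (cell_list k) = d k"
proof -
  define L where "L m = length (concat (map (\<lambda>a. map (\<lambda>b. (a, b)) [0..<k - a]) [0..<m]))" for m
  have L: "L 0 = 0" "\<And>m. L (Suc m) = L m + (k - m)" by (simp_all add: L_def)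
  \<comment> \<open>The first m rows hold m k - m (m - 1) / 2 cells; doubling and moving the
    negative term to the left avoids subtraction and division on \<open>nat\<close>.\<close>
  have "m \<le> k \<Longrightarrow> 2 * L m + m * m = 2 * m * k + m" for m
  proof (induction m)
    case (Suc m)
    obtain c where c: "k = Suc m + c" using le_Suc_ex[OF Suc.prems] by blast
    have "L (Suc m) = L m + Suc c" using c by (simp add: L)
    then have "2 * L (Suc m) + Suc m * Suc m = (2 * L m + m * m) + (2 * Suc c + 2 * m + 1)" by simp
    also have "2 * L m + m * m = 2 * m * k + m" using Suc.IH Suc.prems by linarith
    also have "2 * m * k + m + (2 * Suc c + 2 * m + 1) = 2 * Suc m * k + Suc m"
      by (simp add: c)
    finally show ?case .
  qed (simp add: L)
  from this[of k] have "2 * length (cell_list k) = k * (k + 1)"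
    by (simp add: cell_list_def L_def algebra_simps)
  then show ?thesis by (simp add: d_def)
qed

locale gasket =
  fixes k :: nat
  assumes k2: "k \<ge> 2"
begin

abbreviation ca :: "nat \<Rightarrow> nat" where "ca n \<equiv> fst (cell_list k ! n)"
abbreviation cb :: "nat \<Rightarrow> nat" where "cb n \<equiv> snd (cell_list k ! n)"

lemma k_pos [simp]: "k > 0" "k \<noteq> 0" using k2 by auto

lemma cell_bound: "n < d k \<Longrightarrow> ca n + cb n < k"
  using nth_mem[of n "cell_list k"] by (auto simp: length_cell_list set_cell_list)

lemma cell_inj: "n < d k \<Longrightarrow> n' < d k \<Longrightarrow> ca n = ca n' \<Longrightarrow> cb n = cb n' \<Longrightarrow> n = n'"
  using nth_eq_iff_index_eq[OF distinct_cell_list] by (auto simp: length_cell_list prod_eq_iff)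

lemma cell_ex: assumes "a + b < k" obtains n where "n < d k" "ca n = a" "cb n = b"
proof -
  have "(a, b) \<in> set (cell_list k)" using assms by (simp add: set_cell_list)
  then show ?thesis using that by (auto simp: in_set_conv_nth length_cell_list)
qed

lemma sum_cells: "(\<Sum>n<d k. g (ca n) (cb n)) = (\<Sum>(a,b)\<in>{(a,b). a + b < k}. g a b)"
proof -
  have "bij_betw (\<lambda>n. cell_list k ! n) {..<d k} {(a,b). a + b < k}"
    by (intro bij_betw_nth) (auto simp: distinct_cell_list length_cell_list set_cell_list)
  from sum.reindex_bij_betw[OF this, of "\<lambda>(a,b). g a b"] show ?thesis
    by (simp add: case_prod_unfold)
qed

lemma F_coord [simp]: "cX (F k n x) = (cX x + ca n) / k" "cY (F k n x) = (cY x + cb n) / k"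
  by (auto simp: F_def bvec_def case_prod_unfold add_divide_distrib)

lemma F_inj [simp]: "F k n x = F k n y \<longleftrightarrow> x = y"
  by (auto simp: F_def)

lemma dist_F: "dist (F k n x) (F k n y) = dist x y / k"
  by (simp add: F_def dist_norm norm_divide flip: diff_divide_distrib)

lemma F_continuous: "continuous_on A (F k n)"
  unfolding F_def by (intro continuous_intros) auto

lemma F_Tri: "n < d k \<Longrightarrow> x \<in> Tri \<Longrightarrow> F k n x \<in> Tri"
proof -
  assume n: "n < d k" and x: "x \<in> Tri"
  from cell_bound[OF n] have "real (ca n) + real (cb n) + 1 \<le> real k" by linarith
  with x show ?thesis by (auto simp: Tri_def divide_simps)
qed

lemma coord_V0:
  assumes "x \<in> Tri" "cX x \<in> {0, 1}" "cY x \<in> {0, 1}"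
  shows "x \<in> V0"
proof -
  have "x = 0 \<or> x = 1 \<or> x = omega"
    using assms coord_eqI[of x 0] coord_eqI[of x 1] coord_eqI[of x omega]
    by (auto simp: Tri_def)
  then show ?thesis by (auto simp: V0_def)
qed

text \<open>A common point has scaled coordinates at least the componentwise maximum of the two
  offsets, while their sum is at most one more than the smaller offset sum. For distinct offsets the
  sum of the maxima already reaches that bound, so every inequality is an equality: the common point
  is determined by the two offsets and is a vertex.\<close>

lemma overlap:
  assumes n: "n < d k" "n' < d k" "n \<noteq> n'" and xy: "x \<in> Tri" "y \<in> Tri" and eq: "F k n x = F k n' y"
  shows "cX (F k n x) = real (max (ca n) (ca n')) / k \<and> cY (F k n x) = real (max (cb n) (cb n')) / k"
    and "x \<in> V0"
proof -
  let ?a = "real (ca n)" let ?a' = "real (ca n')" let ?b = "real (cb n)" let ?b' = "real (cb n')"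
  have e1: "cX x + ?a = cX y + ?a'" "cY x + ?b = cY y + ?b'"
    using arg_cong[OF eq, of cX] arg_cong[OF eq, of cY] by auto
  have ne: "ca n \<noteq> ca n' \<or> cb n \<noteq> cb n'" using cell_inj n by blast
  then have "max (ca n) (ca n') + max (cb n) (cb n') \<ge> min (ca n + cb n) (ca n' + cb n') + 1"
    by linarith
  then have m: "real (max (ca n) (ca n')) + real (max (cb n) (cb n')) \<ge> min (?a + ?b) (?a' + ?b') + 1"
    by linarith
  have b: "0 \<le> cX x" "0 \<le> cY x" "cX x + cY x \<le> 1" "0 \<le> cX y" "0 \<le> cY y" "cX y + cY y \<le> 1"
    using xy by (auto simp: Tri_def)
  have X: "cX x + ?a = real (max (ca n) (ca n'))" "cY x + ?b = real (max (cb n) (cb n'))"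
    using m b e1 by linarith+
  then show "cX (F k n x) = real (max (ca n) (ca n')) / k \<and> cY (F k n x) = real (max (cb n) (cb n')) / k"
    by simp
  have "cX x = real (max (ca n) (ca n') - ca n)" "cY x = real (max (cb n) (cb n') - cb n)"
    using X by auto
  moreover have "cX x \<le> 1" "cY x \<le> 1" using b by linarith+
  ultimately have "cX x \<in> {0,1}" "cY x \<in> {0,1}"
    by (metis insertCI le_zero_eq less_one nat_less_le of_nat_0 of_nat_1 of_nat_le_1_iff)+
  then show "x \<in> V0" using coord_V0 xy(1) by blast
qed

text \<open>The infinite word repeating this letter is the address of \<open>q i\<close>.\<close>

definition corner :: "nat \<Rightarrow> nat" where
  "corner i = (SOME n. n < d k \<and> F k n (q i) = q i)"

lemma corner: assumes "i < 3" shows "corner i < d k" "F k (corner i) (q i) = q i"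
proof -
  have "\<exists>n. n < d k \<and> F k n (q i) = q i"
  proof -
    obtain n0 where n0: "n0 < d k" "ca n0 = 0" "cb n0 = 0" using cell_ex[of 0 0] by auto
    obtain n1 where n1: "n1 < d k" "ca n1 = k-1" "cb n1 = 0" using cell_ex[of "k-1" 0] by auto
    obtain n2 where n2: "n2 < d k" "ca n2 = 0" "cb n2 = k-1" using cell_ex[of 0 "k-1"] by auto
    have "F k n0 (q 0) = q 0" "F k n1 (q 1) = q 1" "F k n2 (q 2) = q 2"
      using n0 n1 n2 k2 by (auto intro!: coord_eqI simp: of_nat_diff)
    moreover have "i = 0 \<or> i = 1 \<or> i = 2" using assms by auto
    ultimately show ?thesis using n0(1) n1(1) n2(1) by blast
  qed
  from someI_ex[OF this] show "corner i < d k" "F k (corner i) (q i) = q i" by (auto simp: corner_def)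
qed

text \<open>With a second cell, \<open>overlap\<close> would place \<open>q i\<close> at the maximum
  of the two offsets. For \<open>q 1\<close> and \<open>q 2\<close> some offset would then have to
  be k, although offsets stay below k; for \<open>q 0\<close> both offsets vanish and the cells
  agree.\<close>

lemma corner_cell_unique:
  assumes "i < 3" "n < d k" "y \<in> Tri" "F k n y = q i"
  shows "n = corner i"
proof (rule ccontr)
  assume ne: "n \<noteq> corner i"
  have "q i \<in> Tri" using assms q_in_V0 V0_Tri by auto
  note * = overlap(1)[OF assms(2) corner(1)[OF assms(1)] ne assms(3) this, unfolded corner(2)[OF assms(1)], OF assms(4)]
  have c: "cX (F k (corner i) (q i)) = cX (q i)" "cY (F k (corner i) (q i)) = cY (q i)"
    using corner(2)[OF assms(1)] by auto
  have cc: "ca n + cb n + 1 \<le> k" "ca (corner i) + cb (corner i) + 1 \<le> k"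
    using cell_bound[OF assms(2)] cell_bound[OF corner(1)[OF assms(1)]] by auto
  have "i = 0 \<or> i = 1 \<or> i = 2" using assms(1) by auto
  then have "ca n = ca (corner i) \<and> cb n = cb (corner i)"
  proof (elim disjE)
    assume "i = 0" then show ?thesis using * assms(4) by auto
  next
    assume i: "i = 1"
    from i c have "real (ca (corner i)) = real k - 1" "cb (corner i) = 0" by (auto simp: field_simps)
    then have 1: "ca (corner i) = k - 1" "cb (corner i) = 0" using k2 by linarith+
    from * assms(4) i have "max (ca n) (ca (corner i)) = k" by (auto simp: field_simps)
    with 1 cc show ?thesis using k2 by auto
  next
    assume i: "i = 2"
    from i c have "real (cb (corner i)) = real k - 1" "ca (corner i) = 0" by (auto simp: field_simps)
    then have 1: "cb (corner i) = k - 1" "ca (corner i) = 0" using k2 by linarith+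
    from * assms(4) i have "max (cb n) (cb (corner i)) = k" by (auto simp: field_simps)
    with 1 cc show ?thesis using k2 by auto
  qed
  then show False using cell_inj[OF assms(2) corner(1)[OF assms(1)]] ne by simp
qed

section \<open>Words, vertices and iterated maps\<close>

lemma words_0 [simp]: "words k 0 = {[]}" by (auto simp: words_def)

lemma words_Suc: "words k (Suc m) = (\<lambda>(n, w). n # w) ` ({..<d k} \<times> words k m)"
  by (auto simp: words_def image_iff length_Suc_conv)

lemma finite_words [simp]: "finite (words k m)"
  by (induction m) (auto simp: words_Suc)

lemma Fw_simps [simp]: "Fw k [] = id" "Fw k (n # w) = F k n \<circ> Fw k w"
  by (auto simp: Fw_def)

lemma Fw_append: "Fw k (v @ w) = Fw k v \<circ> Fw k w"
  by (induction v) (auto simp: o_assoc)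

lemma V_0 [simp]: "V k 0 = V0" by (simp add: V_def)

lemma UN_words_Suc: "(\<Union>w\<in>words k (Suc m). f w) = (\<Union>n<d k. \<Union>w\<in>words k m. f (n # w))"
  unfolding words_Suc by auto

lemma V_Suc: "V k (Suc m) = (\<Union>n<d k. F k n ` V k m)"
  by (simp only: V_def UN_words_Suc Fw_simps image_comp[symmetric] image_UN)

lemma V_Tri: "V k m \<subseteq> Tri"
proof (induction m)
  case (Suc m)
  then show ?case unfolding V_Suc using F_Tri by blast
qed (simp add: V0_Tri)

lemma finite_V [simp]: "finite (V k m)"
  by (induction m) (auto simp: V_Suc V0_def)

lemma V_mono_Suc: "V k m \<subseteq> V k (Suc m)"
proof (induction m)
  case 0
  have "x \<in> (\<Union>n<d k. F k n ` V0)" if x: "x \<in> V0" for x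
  proof -
    from x obtain i where i: "i < 3" "x = q i" by (rule V0E)
    then have "x = F k (corner i) x" "corner i \<in> {..<d k}" using corner[OF i(1)] by auto
    then show ?thesis using x by blast
  qed
  then show ?case by (simp add: V_Suc subset_iff)
next
  case (Suc m)
  then have "(\<Union>n<d k. F k n ` V k m) \<subseteq> (\<Union>n<d k. F k n ` V k (Suc m))" by blast
  then show ?case unfolding V_Suc[symmetric] .
qed

section \<open>The attractor as the closure of the vertices\<close>

definition VV :: "complex set" where "VV = (\<Union>m. V k m)"

lemma VV_F: "VV = (\<Union>n<d k. F k n ` VV)"
proof -
  have 1: "VV = (\<Union>m. V k (Suc m))" unfolding VV_def using V_mono_Suc by blast
  have 2: "(\<Union>m. V k (Suc m)) = (\<Union>n<d k. \<Union>m. F k n ` V k m)" unfolding V_Suc by blast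
  have "(\<Union>n<d k. F k n ` VV) = (\<Union>n<d k. \<Union>m. F k n ` V k m)" by (simp only: VV_def image_UN)
  with 1 2 show ?thesis by simp
qed

lemma F_VV: "n < d k \<Longrightarrow> x \<in> VV \<Longrightarrow> F k n x \<in> VV"
  using VV_F by blast

lemma V0_VV: "V0 \<subseteq> VV" unfolding VV_def using V_0 by blast

lemma V_VV: "V k m \<subseteq> VV" unfolding VV_def by blast

lemma VV_Tri: "VV \<subseteq> Tri" using V_Tri by (auto simp: VV_def)

text \<open>A concrete candidate for the set described by \<open>K\<close>: compactness comes from
  boundedness of the vertices, and invariance passes from \<open>VV\<close> to its closure because
  the union over cells is finite.\<close>

definition KK :: "complex set" where "KK = closure VV"

lemma compact_KK: "compact KK"
  unfolding KK_def using bounded_Tri VV_Tri bounded_subset compact_closure by blast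

lemma closure_F: "closure (F k n ` A) = F k n ` closure A"
proof -
  have "F k n = (\<lambda>x. bvec k n + x) \<circ> (\<lambda>x. (1/real k) *\<^sub>R x)"
    by (auto simp: F_def scaleR_conv_of_real)
  then show ?thesis by (simp only: image_comp[symmetric] closure_translation closure_scaleR)
qed

lemma KK_F: "KK = (\<Union>n<d k. F k n ` KK)"
proof -
  have "closure (\<Union>n<m. F k n ` VV) = (\<Union>n<m. closure (F k n ` VV))" for m
    by (induction m) (auto simp: lessThan_Suc)
  then show ?thesis unfolding KK_def by (subst VV_F) (simp add: closure_F)
qed

text \<open>A point of A farthest from B is the image \<open>F k n y\<close> of another point y of
  A, so its distance from B is at most 1/k times the distance of y. The largest distance is thus at
  most 1/k of itself, hence zero.\<close>

lemma K_unique_subset: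
  assumes S: "compact A" "A \<noteq> {}" "A = (\<Union>n<d k. F k n ` A)"
    and S': "compact B" "B \<noteq> {}" "B = (\<Union>n<d k. F k n ` B)"
  shows "A \<subseteq> B"
proof -
  obtain x where x: "x \<in> A" "\<And>y. y \<in> A \<Longrightarrow> infdist y B \<le> infdist x B"
    using continuous_attains_sup[OF S(1,2), of "\<lambda>y. infdist y B"] continuous_on_infdist[OF continuous_on_id]
    by blast
  obtain n y where ny: "n < d k" "y \<in> A" "x = F k n y" using x(1) S(3) by blast
  obtain z where z: "z \<in> B" "infdist y B = dist y z"
    using infdist_attains_inf[of B y] S' compact_imp_closed by blast
  have "F k n z \<in> B" using z(1) ny(1) S'(3) by blast
  then have "infdist x B \<le> dist x (F k n z)" by (rule infdist_le)
  also have "\<dots> = infdist y B / k" using ny(3) z(2) by (simp add: dist_F)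
  also have "\<dots> \<le> infdist x B / k" using x(2)[OF ny(2)] by (simp add: divide_right_mono)
  finally have "infdist x B * (real k - 1) \<le> 0" by (simp add: field_simps)
  then have "infdist x B \<le> 0" using k2 by (simp add: mult_le_0_iff)
  then have "\<And>y. y \<in> A \<Longrightarrow> infdist y B = 0"
    using x(2) infdist_nonneg[of _ B] by (fastforce intro: order_antisym)
  then show ?thesis using in_closed_iff_infdist_zero[of B] S' compact_imp_closed by blast
qed

lemma KK_ne: "KK \<noteq> {}" unfolding KK_def using V0_VV by (auto simp: V0_def)

lemma K_eq: "K k = KK"
  unfolding K_def
proof (rule the_equality)
  show "compact KK \<and> KK \<noteq> {} \<and> KK = (\<Union>n<d k. F k n ` KK)"
    using compact_KK KK_ne KK_F by blast
  show "A = KK" if "compact A \<and> A \<noteq> {} \<and> A = (\<Union>n<d k. F k n ` A)" for A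
    using K_unique_subset[of A KK] K_unique_subset[of KK A] that compact_KK KK_ne KK_F by blast
qed

lemma VV_KK: "VV \<subseteq> KK" unfolding KK_def by (rule closure_subset)

lemma KK_Tri: "KK \<subseteq> Tri" unfolding KK_def by (simp add: closure_minimal VV_Tri closed_Tri)

lemma F_KK: "n < d k \<Longrightarrow> x \<in> KK \<Longrightarrow> F k n x \<in> KK" using KK_F by blast

lemma V0_KK: "V0 \<subseteq> KK" using V0_VV VV_KK by blast

lemma q_KK: "i < 3 \<Longrightarrow> q i \<in> KK" using V0_KK q_in_V0 by blast

lemma Fw_KK: "set w \<subseteq> {..<d k} \<Longrightarrow> x \<in> KK \<Longrightarrow> Fw k w x \<in> KK"
  by (induction w) (auto simp: F_KK)

lemma Fw_VV: "set w \<subseteq> {..<d k} \<Longrightarrow> x \<in> VV \<Longrightarrow> Fw k w x \<in> VV"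
  by (induction w) (auto simp: F_VV)

lemma Fw_continuous: "continuous_on A (Fw k w)"
proof (induction w)
  case (Cons n w)
  show ?case unfolding Fw_simps by (rule continuous_on_compose[OF Cons F_continuous])
qed (simp add: id_def)

lemma Fw_inj [simp]: "Fw k w x = Fw k w y \<longleftrightarrow> x = y"
  by (induction w) auto

lemma dist_Fw: "dist (Fw k w x) (Fw k w y) = dist x y / real k ^ length w"
proof (induction w)
  case (Cons n w)
  have "dist (Fw k (n # w) x) (Fw k (n # w) y) = dist x y / real k ^ length w / k"
    by (simp only: Fw_simps o_apply dist_F Cons)
  then show ?case by (simp add: mult.commute)
qed simp

lemma compact_cell: "compact (Fw k w ` KK)"
  by (rule compact_continuous_image[OF Fw_continuous compact_KK])

lemma KK_words: "(\<Union>w\<in>words k m. Fw k w ` KK) = KK"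
proof (induction m)
  case 0 show ?case by simp
next
  case (Suc m)
  have "(\<Union>w\<in>words k (Suc m). Fw k w ` KK) = (\<Union>n<d k. F k n ` (\<Union>w\<in>words k m. Fw k w ` KK))"
    by (simp only: UN_words_Suc Fw_simps image_comp[symmetric] image_UN)
  also have "\<dots> = (\<Union>n<d k. F k n ` KK)" by (simp only: Suc)
  also have "\<dots> = KK" by (rule KK_F[symmetric])
  finally show ?case .
qed

text \<open>Vertices of the large triangle have a single address: \<open>corner_cell_unique\<close>
  identifies the first letter, and since that map fixes \<open>q i\<close> it can be stripped by
  injectivity.\<close>

lemma corner_word:
  assumes "i < 3" "set w \<subseteq> {..<d k}" "x \<in> KK" "Fw k w x = q i"
  shows "w = replicate (length w) (corner i)" "x = q i"
proof -
  have "w = replicate (length w) (corner i) \<and> x = q i"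
    using assms(2,4)
  proof (induction w)
    case (Cons a w)
    have a: "a < d k" "Fw k w x \<in> KK" using Cons.prems assms(3) by (auto simp: Fw_KK)
    then have "a = corner i" using corner_cell_unique[of i a "Fw k w x"] assms(1) Cons.prems KK_Tri by auto
    moreover have "Fw k w x = q i" using Cons.prems corner(2)[OF assms(1)] calculation by (metis F_inj Fw_simps(2) comp_apply)
    ultimately show ?case using Cons by auto
  qed auto
  then show "w = replicate (length w) (corner i)" "x = q i" by auto
qed

text \<open>At the first letter where the words differ, \<open>overlap\<close> puts the remaining
  image of x into \<open>V0\<close>; \<open>corner_word\<close> then carries this back to x
  itself.\<close>

lemma cell_inter:
  assumes "length w = length w'" "w \<noteq> w'" "set w \<subseteq> {..<d k}" "set w' \<subseteq> {..<d k}"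
    and "x \<in> KK" "y \<in> KK" "Fw k w x = Fw k w' y"
  shows "x \<in> V0"
  using assms(1-4,7)
proof (induction w w' rule: list_induct2)
  case (Cons n w n' w')
  have s: "n < d k" "n' < d k" "set w \<subseteq> {..<d k}" "set w' \<subseteq> {..<d k}" using Cons.prems by simp_all
  have e: "F k n (Fw k w x) = F k n' (Fw k w' y)" using Cons.prems by simp
  show ?case
  proof (cases "n = n'")
    case True
    then have "w \<noteq> w'" "Fw k w x = Fw k w' y" using Cons.prems(1) e by simp_all
    then show ?thesis using Cons.IH s by blast
  next
    case False
    have "Fw k w x \<in> Tri" "Fw k w' y \<in> Tri" using Fw_KK s assms(5,6) KK_Tri by blast+
    then have "Fw k w x \<in> V0" using overlap(2)[OF s(1,2) False _ _ e] by blast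
    then obtain i where i: "i < 3" "Fw k w x = q i" by (elim V0E)
    then show ?thesis using corner_word(2)[OF i(1) s(3) assms(5)] q_in_V0 by auto
  qed
qed simp
end

section \<open>Graph energies\<close>

text \<open>The form E_0 in terms of triples of boundary values, so that cells in different
  positions can be compared.\<close>

definition tri_energy_form :: "(nat \<Rightarrow> real) \<Rightarrow> (nat \<Rightarrow> real) \<Rightarrow> real" where
  "tri_energy_form f g = (f 0 - f 1) * (g 0 - g 1) + (f 0 - f 2) * (g 0 - g 2) + (f 1 - f 2) * (g 1 - g 2)"

lemma tri_energy_form_nonneg: "tri_energy_form f f \<ge> 0"
  by (simp add: tri_energy_form_def)

lemma tri_energy_form_cong: "(\<And>j. j < 3 \<Longrightarrow> f j = f' j) \<Longrightarrow> (\<And>j. j < 3 \<Longrightarrow> g j = g' j) \<Longrightarrow> tri_energy_form f g = tri_energy_form f' g'"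
  by (simp add: tri_energy_form_def)

lemma sum3: "(\<Sum>i<(3::nat). f i) = f 0 + f 1 + (f 2 :: 'a::comm_monoid_add)"
  by (simp add: numeral_3_eq_3 numeral_2_eq_2)

lemma less3: "i < (3::nat) \<longleftrightarrow> i = 0 \<or> i = 1 \<or> i = 2" by auto

lemma GE_GB: "GE k m u = GB k m u u"
  by (simp add: GE_def GB_def power2_eq_square)

context gasket begin

lemma adj_0: "adj k 0 x y \<longleftrightarrow> x \<noteq> y \<and> x \<in> V0 \<and> y \<in> V0"
  by (auto simp: adj_def)

lemma adj_V: "adj k m x y \<Longrightarrow> x \<in> V k m \<and> y \<in> V k m"
  unfolding adj_def V_def by blast

lemma adj_sym: "adj k m x y \<longleftrightarrow> adj k m y x"
  unfolding adj_def by blast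

lemma adj_Suc: "adj k (Suc m) x y \<longleftrightarrow> (\<exists>n<d k. \<exists>x' y'. adj k m x' y' \<and> x = F k n x' \<and> y = F k n y')"
  (is "?L \<longleftrightarrow> ?R")
proof
  assume ?L
  then obtain w where w: "x \<noteq> y" "w \<in> words k (Suc m)" "x \<in> Fw k w ` V0" "y \<in> Fw k w ` V0"
    unfolding adj_def by blast
  from w(2) obtain n w' where n: "w = n # w'" "n < d k" "w' \<in> words k m"
    by (auto simp: words_Suc)
  from w(3,4) obtain a b where ab: "a \<in> V0" "b \<in> V0" "x = F k n (Fw k w' a)" "y = F k n (Fw k w' b)"
    by (auto simp: n(1))
  have "adj k m (Fw k w' a) (Fw k w' b)"
    unfolding adj_def using w(1) n(3) ab by auto
  then show ?R using n(2) ab(3,4) by blast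
next
  assume ?R
  then obtain n x' y' where n: "n < d k" "adj k m x' y'" "x = F k n x'" "y = F k n y'" by blast
  from n(2) obtain w a b where w: "x' \<noteq> y'" "w \<in> words k m" "a \<in> V0" "b \<in> V0" "x' = Fw k w a" "y' = Fw k w b"
    unfolding adj_def by blast
  have "x \<noteq> y" using w(1) n(3,4) by simp
  moreover have "n # w \<in> words k (Suc m)" using n(1) w(2) by (simp add: words_def)
  moreover have "x = Fw k (n # w) a" "y = Fw k (n # w) b" using n(3,4) w(5,6) by simp_all
  ultimately show ?L unfolding adj_def using w(3,4) by blast
qed

lemma edges_V: "edges k m \<subseteq> V k m \<times> V k m"
  using adj_V by (auto simp: edges_def)

lemma finite_edges [simp]: "finite (edges k m)"
  by (rule finite_subset[OF edges_V]) simp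

lemma edges_Suc: "edges k (Suc m) = (\<Union>n\<in>{..<d k}. map_prod (F k n) (F k n) ` edges k m)"
proof (rule set_eqI)
  fix e show "e \<in> edges k (Suc m) \<longleftrightarrow> e \<in> (\<Union>n\<in>{..<d k}. map_prod (F k n) (F k n) ` edges k m)"
    by (cases e) (auto simp: edges_def adj_Suc image_iff)
qed

text \<open>By \<open>overlap\<close> the offsets alone determine the common point of two cells, so
  the endpoints of a shared edge would coincide.\<close>

lemma edges_disjoint:
  assumes "n < d k" "n' < d k" "n \<noteq> n'"
  shows "map_prod (F k n) (F k n) ` edges k m \<inter> map_prod (F k n') (F k n') ` edges k m = {}"
proof (rule ccontr)
  assume "\<not> ?thesis"
  then obtain x y x' y' where e: "(x, y) \<in> edges k m" "(x', y') \<in> edges k m"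
      "F k n x = F k n' x'" "F k n y = F k n' y'" by auto
  have T: "x \<in> Tri" "y \<in> Tri" "x' \<in> Tri" "y' \<in> Tri" using e(1,2) edges_V V_Tri by blast+
  have "F k n x = F k n y"
    using overlap(1)[OF assms T(1,3) e(3)] overlap(1)[OF assms T(2,4) e(4)]
    by (intro coord_eqI) linarith+
  then show False using e(1) by (simp add: edges_def adj_def)
qed

lemma GB_Suc: "GB k (Suc m) u v = (\<Sum>n<d k. GB k m (u \<circ> F k n) (v \<circ> F k n))"
proof -
  have inj: "inj_on (map_prod (F k n) (F k n)) A" for n A by (auto simp: inj_on_def)
  have "(\<Sum>(x, y)\<in>edges k (Suc m). (u x - u y) * (v x - v y)) =
     (\<Sum>n<d k. \<Sum>(x, y)\<in>map_prod (F k n) (F k n) ` edges k m. (u x - u y) * (v x - v y))"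
    unfolding edges_Suc by (rule sum.UNION_disjoint) (use edges_disjoint in auto)
  also have "\<dots> = (\<Sum>n<d k. \<Sum>(x, y)\<in>edges k m. (u (F k n x) - u (F k n y)) * (v (F k n x) - v (F k n y)))"
    by (rule sum.cong[OF refl]) (simp add: sum.reindex[OF inj] case_prod_unfold)
  finally show ?thesis by (simp add: GB_def sum_distrib_left)
qed

lemma GB_0: "GB k 0 u v = tri_energy_form (u \<circ> q) (v \<circ> q)"
proof -
  have ne: "omega \<noteq> 0" "omega \<noteq> 1" using Im_omega by auto
  have "edges k 0 = {(0,1),(1,0),(0,omega),(omega,0),(1,omega),(omega,1)}"
    using ne by (auto simp: edges_def adj_0 V0_def)
  then show ?thesis using ne by (simp add: GB_def tri_energy_form_def algebra_simps)
qed

lemma GB_1: "GB k 1 u v = (\<Sum>n<d k. tri_energy_form (u \<circ> F k n \<circ> q) (v \<circ> F k n \<circ> q))"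
  using GB_Suc[of 0 u v] by (simp add: GB_0)

lemma GB_cong: "(\<And>x. x \<in> V k m \<Longrightarrow> u x = u' x) \<Longrightarrow> (\<And>x. x \<in> V k m \<Longrightarrow> v x = v' x) \<Longrightarrow> GB k m u v = GB k m u' v'"
  unfolding GB_def by (intro arg_cong[of _ _ "\<lambda>x. _ * x"] sum.cong) (auto simp: edges_def dest!: adj_V)

lemma GB_commute: "GB k m u v = GB k m v u"
  by (simp add: GB_def mult.commute case_prod_unfold)

lemma GB_add: "GB k m (\<lambda>x. u x + u' x) v = GB k m u v + GB k m u' v"
  by (simp add: GB_def case_prod_unfold algebra_simps sum.distrib sum_subtractf)

lemma GB_diff: "GB k m (\<lambda>x. u x - u' x) v = GB k m u v - GB k m u' v"
  by (simp add: GB_def case_prod_unfold algebra_simps sum.distrib sum_subtractf)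

lemma GB_scale: "GB k m (\<lambda>x. c * u x) v = c * GB k m u v"
  by (simp add: GB_def case_prod_unfold algebra_simps sum_distrib_left)

lemma GB_sum: "GB k m (\<lambda>x. \<Sum>i\<in>I. u i x) v = (\<Sum>i\<in>I. GB k m (u i) v)"
proof (induction I rule: infinite_finite_induct)
  case (insert i I)
  then show ?case by (simp add: GB_add)
qed (simp_all add: GB_def)

lemma GB_const: "GB k m (\<lambda>x. c) v = 0"
  by (simp add: GB_def case_prod_unfold)

lemma GB_nonneg: "GB k m u u \<ge> 0"
  unfolding GB_def by (auto intro!: sum_nonneg)

text \<open>Discrete integration by parts. Exchanging endpoints turns the part with
  \<open>v y\<close> into minus the part with \<open>v x\<close>, so both halves agree and absorb
  the factor 1/2.\<close>

lemma GB_swap: "GB k m u v = (\<Sum>(x, y)\<in>edges k m. (u x - u y) * v x)"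
proof -
  have bij: "bij_betw prod.swap (edges k m) (edges k m)"
    by (rule bij_betw_byWitness[of _ prod.swap]) (auto simp: edges_def adj_sym)
  have "(\<Sum>(x, y)\<in>edges k m. (u x - u y) * v y) = (\<Sum>(x, y)\<in>edges k m. (u y - u x) * v x)"
    using sum.reindex_bij_betw[OF bij, of "\<lambda>(x, y). (u x - u y) * v y"] by (simp add: case_prod_unfold)
  also have "\<dots> = - (\<Sum>(x, y)\<in>edges k m. (u x - u y) * v x)"
    by (simp add: sum_negf[symmetric] case_prod_unfold algebra_simps)
  finally show ?thesis by (simp add: GB_def case_prod_unfold right_diff_distrib sum_subtractf)
qed

section \<open>The random walk and discrete harmonic functions\<close>

definition nbr :: "complex \<Rightarrow> complex set" where "nbr x = {y. adj k 1 x y}"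

lemma finite_nbr [simp]: "finite (nbr x)"
  by (rule finite_subset[of _ "V k 1"]) (use adj_V in \<open>auto simp: nbr_def\<close>)

lemma deg_nbr: "deg k x = card (nbr x)" by (simp add: deg_def nbr_def)

lemma GB_1_nbr: "GB k 1 u v = (\<Sum>x\<in>V k 1. v x * (\<Sum>y\<in>nbr x. u x - u y))"
proof -
  have "edges k 1 = Sigma (V k 1) nbr" using adj_V by (auto simp: edges_def nbr_def)
  then show ?thesis
    unfolding GB_swap by (simp add: sum.Sigma[symmetric] sum_distrib_left mult.commute)
qed

text \<open>The mean value property outside \<open>V0\<close>, multiplied by the degree so that no
  division occurs.\<close>

definition is_harm1 :: "(complex \<Rightarrow> real) \<Rightarrow> bool" where
  "is_harm1 u \<longleftrightarrow> (\<forall>x\<in>V k 1 - V0. real (deg k x) * u x = (\<Sum>y\<in>nbr x. u y))"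

text \<open>In \<open>GB_1_nbr\<close> the terms on \<open>V0\<close> vanish through v and the
  others through harmonicity of u. This orthogonality is what makes harmonic extensions minimize
  energy.\<close>

lemma green:
  assumes "is_harm1 u" "\<And>x. x \<in> V0 \<Longrightarrow> v x = 0"
  shows "GB k 1 u v = 0"
proof -
  have "v x * (\<Sum>y\<in>nbr x. u x - u y) = 0" if "x \<in> V k 1" for x
    using assms that by (cases "x \<in> V0") (auto simp: is_harm1_def sum_subtractf deg_nbr)
  then show ?thesis unfolding GB_1_nbr by (intro sum.neutral) blast
qed

text \<open>Connectedness of the graph in disguise. Zero energy makes u constant on each cell, and
  the lower left vertex of a cell other than the first is also a vertex of a cell with smaller
  offset sum, which gives an induction on that sum.\<close>

lemma GB_1_zero_const:
  assumes "GB k 1 u u = 0" "x \<in> V k 1"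
  shows "u x = u (q 0)"
proof -
  have z: "tri_energy_form (u \<circ> F k n \<circ> q) (u \<circ> F k n \<circ> q) = 0" if "n < d k" for n
    using assms(1) that unfolding GB_1 by (subst (asm) sum_nonneg_eq_0_iff) (auto simp: tri_energy_form_nonneg)
  have c: "u (F k n (q i)) = u (F k n (q 0))" if "n < d k" "i < 3" for n i
  proof -
    have "(u (F k n (q 0)) - u (F k n (q 1)))^2 + (u (F k n (q 0)) - u (F k n (q 2)))^2
       + (u (F k n (q 1)) - u (F k n (q 2)))^2 = 0"
      using z[OF that(1)] by (simp add: tri_energy_form_def power2_eq_square)
    then have "u (F k n (q 0)) = u (F k n (q 1))" "u (F k n (q 0)) = u (F k n (q 2))"
      by (smt (verit) power2_less_eq_zero_iff zero_le_power2 eq_iff_diff_eq_0)+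
    then show ?thesis using that(2) by (auto simp: less3)
  qed
  have "n < d k \<Longrightarrow> ca n + cb n = s \<Longrightarrow> u (F k n (q 0)) = u (q 0)" for s n
  proof (induction s arbitrary: n)
    case 0
    then have "F k n (q 0) = q 0" by (auto intro!: coord_eqI)
    then show ?case by simp
  next
    case (Suc s)
    have "ca n + cb n < k" using cell_bound Suc.prems(1) by blast
    show ?case
    proof (cases "ca n = 0")
      case True
      then have "0 + (cb n - 1) < k" using Suc cell_bound by fastforce
      then obtain n' where n': "n' < d k" "ca n' = 0" "cb n' = cb n - 1" by (rule cell_ex)
      have "F k n (q 0) = F k n' (q 2)" using n' True Suc.prems(2)
        by (auto intro!: coord_eqI simp: of_nat_diff)
      moreover have "u (F k n' (q 0)) = u (q 0)" using Suc.IH[OF n'(1)] n' True Suc.prems by simp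
      ultimately show ?thesis using c[OF n'(1), of 2] by simp
    next
      case False
      then have "(ca n - 1) + cb n < k" using Suc cell_bound by fastforce
      then obtain n' where n': "n' < d k" "ca n' = ca n - 1" "cb n' = cb n" by (rule cell_ex)
      have "F k n (q 0) = F k n' (q 1)" using n' False Suc.prems(2)
        by (auto intro!: coord_eqI simp: of_nat_diff)
      moreover have "u (F k n' (q 0)) = u (q 0)" using Suc.IH[OF n'(1)] n' False Suc.prems by simp
      ultimately show ?thesis using c[OF n'(1), of 1] by simp
    qed
  qed
  note base = this
  obtain n where n: "n < d k" "x \<in> F k n ` V0" using assms(2) by (auto simp: V_Suc)
  obtain i where "i < 3" "x = F k n (q i)" using n(2) by (auto elim: V0E)
  then show ?thesis using c[OF n(1)] base[OF n(1) refl] by simp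
qed

section \<open>Hitting probabilities by first-step analysis\<close>

definition hitL :: "nat \<Rightarrow> complex \<Rightarrow> nat \<Rightarrow> real" where
  "hitL j x L = (\<Sum>ps\<in>hit_paths k j x L. \<Prod>t<L. 1 / real (deg k (ps ! t)))"

lemma hit_paths_0: "hit_paths k j x 0 = (if x = q j then {[x]} else {})"
  by (auto simp: hit_paths_def length_Suc_conv)

lemma hit_paths_Suc: "hit_paths k j x (Suc L) = (if x \<in> V0 then {} else (\<Union>y\<in>nbr x. (#) x ` hit_paths k j y L))"
proof -
  have step: "a # ps \<in> hit_paths k j x (Suc L) \<longleftrightarrow>
      a = x \<and> x \<notin> V0 \<and> ps ! 0 \<in> nbr x \<and> ps \<in> hit_paths k j (ps ! 0) L" for a ps
    unfolding hit_paths_def mem_Collect_eq All_less_Suc2 nth_Cons_0 nth_Cons_Suc list.size nbr_def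
    by (cases "a = x") (simp, blast, simp)
  have hd: "ps ! 0 = y" if "ps \<in> hit_paths k j y L" for ps y using that by (simp add: hit_paths_def)
  have nil: "[] \<notin> hit_paths k j x (Suc L)" by (simp add: hit_paths_def)
  show ?thesis
  proof (cases "x \<in> V0")
    case True
    have "ps \<notin> hit_paths k j x (Suc L)" for ps using step nil True by (cases ps) blast+
    with True show ?thesis by auto
  next
    case False
    have "ps \<in> hit_paths k j x (Suc L) \<longleftrightarrow> ps \<in> (\<Union>y\<in>nbr x. (#) x ` hit_paths k j y L)" for ps
    proof (cases ps)
      case (Cons a ps')
      show ?thesis unfolding Cons step using False hd by blast
    qed (use nil in blast)
    with False show ?thesis by auto
  qed
qed

lemma finite_hit_paths [simp]: "finite (hit_paths k j x L)"
  by (induction L arbitrary: x) (auto simp: hit_paths_0 hit_paths_Suc)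

lemma hitL_0: "hitL j x 0 = (if x = q j then 1 else 0)"
  by (simp add: hitL_def hit_paths_0)

text \<open>Conditioning on the first step. A walk that starts in \<open>V0\<close> is stopped at
  time 0, so it contributes nothing at later times.\<close>

lemma hitL_Suc: "hitL j x (Suc L) = (if x \<in> V0 then 0 else (\<Sum>y\<in>nbr x. hitL j y L) / deg k x)"
proof (cases "x \<in> V0")
  case False
  have "hitL j x (Suc L) = (\<Sum>y\<in>nbr x. \<Sum>ps\<in>(#) x ` hit_paths k j y L. \<Prod>t<Suc L. 1 / real (deg k (ps ! t)))"
    unfolding hitL_def hit_paths_Suc if_not_P[OF False]
    by (rule sum.UNION_disjoint) (auto, auto simp: hit_paths_def)
  also have "\<dots> = (\<Sum>y\<in>nbr x. \<Sum>ps\<in>hit_paths k j y L. (\<Prod>t<L. 1 / real (deg k (ps ! t))) / deg k x)"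
    by (rule sum.cong[OF refl], subst sum.reindex) (auto simp: prod.lessThan_Suc_shift simp del: prod.lessThan_Suc)
  finally show ?thesis using False by (simp add: hitL_def sum_divide_distrib)
qed (simp add: hitL_def hit_paths_Suc)

lemma hitL_nonneg: "hitL j x L \<ge> 0"
  by (simp add: hitL_def sum_nonneg prod_nonneg)

text \<open>The sum is the probability of hitting before time N, but no probability space is at
  hand, so the bound 1 is proved by first steps. It supplies the summability of the series in
  \<open>hit_prob\<close>.\<close>

lemma hitL_partial: "(\<Sum>L<N. hitL j x L) \<le> 1"
proof (induction N arbitrary: x)
  case (Suc N)
  show ?case
  proof (cases "x \<in> V0")
    case True
    then show ?thesis unfolding sum.lessThan_Suc_shift by (simp add: hitL_0 hitL_Suc)
  next
    case False
    show ?thesis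
    proof (cases "x = q j")
      case True
      have "q j \<in> V0" by (auto simp: q_def V0_def)
      with True False show ?thesis by simp
    next
      case ne: False
      have "(\<Sum>L<Suc N. hitL j x L) = (\<Sum>y\<in>nbr x. \<Sum>L<N. hitL j y L) / deg k x"
        unfolding sum.lessThan_Suc_shift using False ne
        by (simp add: hitL_0 hitL_Suc sum_divide_distrib[symmetric] sum.swap[of _ "nbr x"])
      also have "\<dots> \<le> (\<Sum>y\<in>nbr x. 1) / deg k x"
        by (intro divide_right_mono sum_mono Suc) auto
      \<comment> \<open>At a point without neighbours the quotient is 0/0, which is 0.\<close>
      also have "\<dots> \<le> 1" by (simp add: deg_nbr)
      finally show ?thesis .
    qed
  qed
qed simp

lemma summable_hitL: "summable (hitL j x)"
  by (rule summableI_nonneg_bounded[of _ 1]) (auto simp: hitL_nonneg hitL_partial)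

lemma hit_prob_hitL: "hit_prob k j x = suminf (hitL j x)"
  by (simp add: hit_prob_def hitL_def[abs_def])

lemma hit_prob_V0: assumes "i < 3" "j < 3" shows "hit_prob k j (q i) = (if i = j then 1 else 0)"
proof -
  have "hitL j (q i) L = 0" if "L \<notin> {0}" for L
    using that assms by (cases L) (simp_all add: hitL_Suc q_in_V0)
  then have "suminf (hitL j (q i)) = (\<Sum>L\<in>{0}. hitL j (q i) L)"
    by (intro suminf_finite) blast+
  then show ?thesis using assms by (simp add: hit_prob_hitL hitL_0 q_inj)
qed

lemma hit_prob_nonneg: "hit_prob k j x \<ge> 0"
  unfolding hit_prob_hitL using summable_hitL by (rule suminf_nonneg) (rule hitL_nonneg)

lemma hit_prob_harm1: assumes "j < 3" shows "is_harm1 (hit_prob k j)"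
  unfolding is_harm1_def
proof (rule ballI)
  fix x assume x: "x \<in> V k 1 - V0"
  have s: "summable (\<lambda>L. \<Sum>y\<in>nbr x. hitL j y L)"
    by (intro summable_sum summable_hitL)
  have "hit_prob k j x = hitL j x 0 + (\<Sum>L. hitL j x (Suc L))"
    unfolding hit_prob_hitL using suminf_split_head[OF summable_hitL[of j x]] by linarith
  moreover have "hitL j x 0 = 0" using x assms q_in_V0[of j] by (auto simp: hitL_0)
  moreover have "hitL j x (Suc L) = (\<Sum>y\<in>nbr x. hitL j y L) / deg k x" for L
    using x by (simp add: hitL_Suc)
  moreover have "(\<Sum>L. (\<Sum>y\<in>nbr x. hitL j y L) / deg k x) = (\<Sum>L. \<Sum>y\<in>nbr x. hitL j y L) / deg k x"
    using s by (rule suminf_divide)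
  moreover have "(\<Sum>L. \<Sum>y\<in>nbr x. hitL j y L) = (\<Sum>y\<in>nbr x. hit_prob k j y)"
    unfolding hit_prob_hitL by (intro suminf_sum summable_hitL)
  ultimately have e: "hit_prob k j x = (\<Sum>y\<in>nbr x. hit_prob k j y) / deg k x" by simp
  show "real (deg k x) * hit_prob k j x = (\<Sum>y\<in>nbr x. hit_prob k j y)"
  proof (cases "nbr x = {}")
    case True
    then show ?thesis by (simp add: deg_nbr)
  next
    case False
    then have "real (deg k x) \<noteq> 0" by (simp add: deg_nbr)
    with e show ?thesis by (metis nonzero_mult_div_cancel_left times_divide_eq_right)
  qed
qed

text \<open>The solution of the discrete Dirichlet problem with boundary values f; the hitting
  probabilities serve as its Poisson kernel.\<close>

definition dirichlet_ext :: "(nat \<Rightarrow> real) \<Rightarrow> complex \<Rightarrow> real" where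
  "dirichlet_ext f x = (\<Sum>j<3. f j * hit_prob k j x)"

lemma dirichlet_ext_q: "i < 3 \<Longrightarrow> dirichlet_ext f (q i) = f i"
  unfolding dirichlet_ext_def sum3 by (auto simp: less3 hit_prob_V0 simp del: q_simps)

lemma dirichlet_ext_harm1: "is_harm1 (dirichlet_ext f)"
  unfolding is_harm1_def
proof (rule ballI)
  fix x assume x: "x \<in> V k 1 - V0"
  have "real (deg k x) * dirichlet_ext f x = (\<Sum>j<3. f j * (real (deg k x) * hit_prob k j x))"
    by (simp add: dirichlet_ext_def sum_distrib_left mult_ac)
  also have "\<dots> = (\<Sum>j<3. f j * (\<Sum>y\<in>nbr x. hit_prob k j y))"
    using hit_prob_harm1 x by (intro sum.cong) (auto simp: is_harm1_def)
  also have "\<dots> = (\<Sum>y\<in>nbr x. dirichlet_ext f y)"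
    unfolding dirichlet_ext_def sum_distrib_left by (rule sum.swap)
  finally show "real (deg k x) * dirichlet_ext f x = (\<Sum>y\<in>nbr x. dirichlet_ext f y)" .
qed

text \<open>Pythagoras: the remainder vanishes on \<open>V0\<close>, so \<open>green\<close> makes
  it orthogonal to the harmonic part.\<close>

lemma GB_dirichlet_ext_decomp:
  "GB k 1 u u = GB k 1 (dirichlet_ext (u \<circ> q)) (dirichlet_ext (u \<circ> q)) + GB k 1 (\<lambda>x. u x - dirichlet_ext (u \<circ> q) x) (\<lambda>x. u x - dirichlet_ext (u \<circ> q) x)"
proof -
  let ?e = "dirichlet_ext (u \<circ> q)" let ?w = "\<lambda>x. u x - dirichlet_ext (u \<circ> q) x"
  have "GB k 1 ?e ?w = 0" by (rule green[OF dirichlet_ext_harm1]) (auto elim!: V0E simp: dirichlet_ext_q)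
  then have *: "GB k 1 ?w ?e = 0" "GB k 1 ?e ?w = 0" by (simp_all add: GB_commute)
  have "GB k 1 ?w u = GB k 1 u u - GB k 1 ?e u" by (rule GB_diff)
  moreover have "GB k 1 ?w ?w = GB k 1 u ?w - GB k 1 ?e ?w" by (rule GB_diff)
  moreover have "GB k 1 ?w ?e = GB k 1 u ?e - GB k 1 ?e ?e" by (rule GB_diff)
  moreover have "GB k 1 u ?w = GB k 1 ?w u" "GB k 1 u ?e = GB k 1 ?e u" by (rule GB_commute)+
  ultimately show ?thesis using * by linarith
qed

lemma GB_dirichlet_ext_le: "GB k 1 (dirichlet_ext (u \<circ> q)) (dirichlet_ext (u \<circ> q)) \<le> GB k 1 u u"
  using GB_dirichlet_ext_decomp[of u] GB_nonneg[of 1 "\<lambda>x. u x - dirichlet_ext (u \<circ> q) x"] by simp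

lemma GB_zero_bdry:
  assumes "GB k 1 u u = 0" "u (q 0) = 0" "x \<in> V k 1" shows "u x = 0"
  using GB_1_zero_const[OF assms(1,3)] assms(2) by simp

lemma V0_V1: "V0 \<subseteq> V k 1" using V_mono_Suc[of 0] by simp

text \<open>Almost sure absorption of the walk, derived from uniqueness: the defect 1 minus the sum
  is orthogonal to the harmonic part and to constants, so it has zero energy, and it vanishes at
  \<open>q 0\<close>.\<close>

lemma hit_sum: assumes "x \<in> V k 1" shows "(\<Sum>j<3. hit_prob k j x) = 1"
proof -
  let ?e = "dirichlet_ext (\<lambda>_. 1)" let ?w = "\<lambda>x. 1 - dirichlet_ext (\<lambda>_. 1) x"
  have "GB k 1 ?e ?w = 0" by (rule green[OF dirichlet_ext_harm1]) (auto elim!: V0E simp: dirichlet_ext_q)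
  moreover have "GB k 1 ?w ?w = GB k 1 (\<lambda>_. 1) ?w - GB k 1 ?e ?w" by (rule GB_diff)
  ultimately have "GB k 1 ?w ?w = 0" by (simp add: GB_const)
  moreover have "?w (q 0) = 0" using dirichlet_ext_q[of 0 "\<lambda>_. 1"] by simp
  ultimately have "?w x = 0" by (rule GB_zero_bdry) fact
  then show ?thesis by (simp add: dirichlet_ext_def)
qed

section \<open>The renormalization constant\<close>

abbreviation "Hform i j \<equiv> GB k 1 (hit_prob k i) (hit_prob k j)"

lemma GB_dirichlet_ext: "GB k 1 (dirichlet_ext f) (dirichlet_ext g) = (\<Sum>i<3. \<Sum>j<3. f i * g j * Hform i j)"
proof -
  have *: "GB k 1 (dirichlet_ext f) v = (\<Sum>i<3. f i * GB k 1 (hit_prob k i) v)" for f v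
    unfolding dirichlet_ext_def[abs_def] by (simp only: GB_sum GB_scale)
  have **: "GB k 1 v (dirichlet_ext g) = (\<Sum>j<3. g j * GB k 1 v (hit_prob k j))" for v g
    using *[of g v] by (simp only: GB_commute[of _ v])
  have "GB k 1 (dirichlet_ext f) (dirichlet_ext g) = (\<Sum>i<3. f i * (\<Sum>j<3. g j * Hform i j))"
    unfolding *[of f "dirichlet_ext g"] unfolding **[of _ g] ..
  then show ?thesis by (simp add: sum_distrib_left mult_ac)
qed

lemma Hform_row: "(\<Sum>j<3. Hform i j) = 0"
proof -
  have "(\<Sum>j<3. Hform j i) = GB k 1 (\<lambda>x. \<Sum>j<3. hit_prob k j x) (hit_prob k i)"
    by (simp add: GB_sum)
  also have "\<dots> = GB k 1 (\<lambda>x. 1) (hit_prob k i)"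
    by (rule GB_cong) (use hit_sum in auto)
  finally show ?thesis by (simp add: GB_const GB_commute[of _ "hit_prob k i"])
qed

section \<open>Lattice symmetries and the trace of the energy\<close>

definition Pt :: "nat \<Rightarrow> nat \<Rightarrow> complex" where
  "Pt a b = (of_nat a + of_nat b * omega) / of_nat k"

lemma Pt_coord [simp]: "cX (Pt a b) = a / k" "cY (Pt a b) = b / k"
  by (simp_all add: Pt_def)

lemma F_q_Pt:
  "F k n (q 0) = Pt (ca n) (cb n)" "F k n (q 1) = Pt (Suc (ca n)) (cb n)" "F k n (q 2) = Pt (ca n) (Suc (cb n))"
  by (auto intro!: coord_eqI simp: add.commute)

text \<open>The energy of the cell with offset (a, b). Naming cells by their offset lets a symmetry
  act as a reindexing of the sum.\<close>

definition tri_energy :: "(complex \<Rightarrow> real) \<Rightarrow> nat \<Rightarrow> nat \<Rightarrow> real" where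
  "tri_energy u a b = (u (Pt a b) - u (Pt (Suc a) b))^2 + (u (Pt a b) - u (Pt a (Suc b)))^2
     + (u (Pt (Suc a) b) - u (Pt a (Suc b)))^2"

lemma GB_tri_energy: "GB k 1 u u = (\<Sum>(a,b)\<in>{(a,b). a + b < k}. tri_energy u a b)"
proof -
  have "tri_energy_form (u \<circ> F k n \<circ> q) (u \<circ> F k n \<circ> q) = tri_energy u (ca n) (cb n)" for n
    unfolding tri_energy_form_def tri_energy_def o_apply F_q_Pt by (simp add: power2_eq_square)
  then show ?thesis unfolding GB_1 by (simp add: sum_cells)
qed

text \<open>In oblique coordinates this is the reflection exchanging \<open>q 1\<close> and
  \<open>q 2\<close>; \<open>reflect_map\<close> exchanges \<open>q 0\<close> and
  \<open>q 1\<close>. The two generate the symmetry group of the triangle.\<close>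

definition swap_map :: "complex \<Rightarrow> complex" where
  "swap_map z = of_real (cY z) + of_real (cX z) * omega"
definition reflect_map :: "complex \<Rightarrow> complex" where
  "reflect_map z = of_real (1 - cX z - cY z) + of_real (cY z) * omega"

lemma coord_of_real: "cX (of_real a + of_real b * omega) = a" "cY (of_real a + of_real b * omega) = b"
  using Im_omega by (simp_all add: cX_def cY_def)

lemma swap_map_coord [simp]: "cX (swap_map z) = cY z" "cY (swap_map z) = cX z"
  unfolding swap_map_def by (rule coord_of_real)+
lemma reflect_map_coord [simp]: "cX (reflect_map z) = 1 - cX z - cY z" "cY (reflect_map z) = cY z"
  unfolding reflect_map_def by (rule coord_of_real)+

lemma swap_map_Pt: "swap_map (Pt a b) = Pt b a"
  by (rule coord_eqI) simp_all

lemma reflect_map_Pt: "a + b \<le> k \<Longrightarrow> reflect_map (Pt a b) = Pt (k - a - b) b"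
  by (rule coord_eqI) (simp_all add: of_nat_diff diff_divide_distrib add_divide_distrib)

lemma GB_swap_map: "GB k 1 (u \<circ> swap_map) (u \<circ> swap_map) = GB k 1 u u"
proof -
  have "(\<Sum>(a,b)\<in>{(a,b). a + b < k}. tri_energy (u \<circ> swap_map) a b) = (\<Sum>(a,b)\<in>{(a,b). a + b < k}. tri_energy u a b)"
  proof (rule sum.reindex_bij_witness[of _ "\<lambda>(a,b). (b,a)" "\<lambda>(a,b). (b,a)"])
    fix x assume "x \<in> {(a::nat,b). a + b < k}"
    obtain a b where x: "x = (a, b)" by (cases x)
    show "(case (case x of (a, b) \<Rightarrow> (b, a)) of (a, b) \<Rightarrow> tri_energy u a b) = (case x of (a, b) \<Rightarrow> tri_energy (u \<circ> swap_map) a b)"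
      unfolding x prod.case tri_energy_def o_apply swap_map_Pt by (simp add: power2_commute)
  qed auto
  then show ?thesis unfolding GB_tri_energy .
qed

lemma GB_reflect_map: "GB k 1 (u \<circ> reflect_map) (u \<circ> reflect_map) = GB k 1 u u"
proof -
  have "(\<Sum>(a,b)\<in>{(a,b). a + b < k}. tri_energy (u \<circ> reflect_map) a b) = (\<Sum>(a,b)\<in>{(a,b). a + b < k}. tri_energy u a b)"
  proof (rule sum.reindex_bij_witness[of _ "\<lambda>(a,b). (k - 1 - a - b, b)" "\<lambda>(a,b). (k - 1 - a - b, b)"])
    fix x assume xk: "x \<in> {(a::nat,b). a + b < k}"
    obtain a b where x: "x = (a, b)" by (cases x)
    have ab: "a + b < k" using xk x by simp
    \<comment> \<open>Lattice points go to (k - a - b, b), but the cell with offset (a, b) goes to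
      the one with offset (k - 1 - a - b, b), since its right end becomes the left one.\<close>
    define c where "c = k - 1 - a - b"
    have c: "k - a - b = Suc c" "k - Suc a - b = c" "k - a - Suc b = c" using ab by (auto simp: c_def)
    have P: "reflect_map (Pt a b) = Pt (Suc c) b" "reflect_map (Pt (Suc a) b) = Pt c b" "reflect_map (Pt a (Suc b)) = Pt c (Suc b)"
      using ab by (simp_all only: reflect_map_Pt c add_Suc add_Suc_right Suc_leI less_imp_le)
    show "(case (case x of (a, b) \<Rightarrow> (k - 1 - a - b, b)) of (a, b) \<Rightarrow> tri_energy u a b) = (case x of (a, b) \<Rightarrow> tri_energy (u \<circ> reflect_map) a b)"
      unfolding x prod.case tri_energy_def o_apply P c_def[symmetric] by (simp add: power2_commute)
  qed auto
  then show ?thesis unfolding GB_tri_energy .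
qed

lemma swap_map_q: "swap_map (q 0) = q 0" "swap_map (q 1) = q 2" "swap_map (q 2) = q 1"
  by (auto intro!: coord_eqI)
lemma reflect_map_q: "reflect_map (q 0) = q 1" "reflect_map (q 1) = q 0" "reflect_map (q 2) = q 2"
  by (auto intro!: coord_eqI)

lemma dirichlet_ext_cong: "(\<And>j. j < 3 \<Longrightarrow> f j = g j) \<Longrightarrow> dirichlet_ext f = dirichlet_ext g"
  by (auto simp: dirichlet_ext_def fun_eq_iff intro!: sum.cong)

definition unit_bdry :: "nat \<Rightarrow> nat \<Rightarrow> real" where "unit_bdry i j = (if i = j then 1 else 0)"

lemma dirichlet_ext_unit_bdry: "i < 3 \<Longrightarrow> dirichlet_ext (unit_bdry i) = hit_prob k i"
  by (auto simp: dirichlet_ext_def unit_bdry_def fun_eq_iff sum.delta' if_distrib[of "\<lambda>x. x * _"] cong: if_cong)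

text \<open>The triangle symmetries force the trace of \<open>E_1\<close> on \<open>V_0\<close> to be a multiple of \<open>E_0\<close>.\<close>

lemma Hform_sym_le:
  assumes g: "\<And>u. GB k 1 (u \<circ> g) (u \<circ> g) = GB k 1 u u" and "i < 3" "j < 3"
    and b: "\<And>l. l < 3 \<Longrightarrow> hit_prob k i (g (q l)) = unit_bdry j l"
  shows "Hform j j \<le> Hform i i"
proof -
  have "dirichlet_ext ((hit_prob k i \<circ> g) \<circ> q) = hit_prob k j"
    using b by (subst dirichlet_ext_unit_bdry[symmetric, OF assms(3)]) (auto intro!: dirichlet_ext_cong)
  then show ?thesis using GB_dirichlet_ext_le[of "hit_prob k i \<circ> g"] g by simp
qed

text \<open>A diagonal entry of the trace of the unnormalized level-one energy, divided by the
  corresponding entry 2 of E_0.\<close>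

definition renorm :: real where "renorm = Hform 0 0 / 2"

lemma Hform_diag: "i < 3 \<Longrightarrow> Hform i i = 2 * renorm"
proof -
  have 1: "Hform 0 0 \<le> Hform 1 1"
    by (rule Hform_sym_le[OF GB_reflect_map]) (auto simp: less3 unit_bdry_def reflect_map_q hit_prob_V0 simp del: q_simps One_nat_def)
  have 2: "Hform 1 1 \<le> Hform 0 0"
    by (rule Hform_sym_le[OF GB_reflect_map]) (auto simp: less3 unit_bdry_def reflect_map_q hit_prob_V0 simp del: q_simps One_nat_def)
  have 3: "Hform 2 2 \<le> Hform 1 1"
    by (rule Hform_sym_le[OF GB_swap_map]) (auto simp: less3 unit_bdry_def swap_map_q hit_prob_V0 simp del: q_simps One_nat_def)
  have 4: "Hform 1 1 \<le> Hform 2 2"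
    by (rule Hform_sym_le[OF GB_swap_map]) (auto simp: less3 unit_bdry_def swap_map_q hit_prob_V0 simp del: q_simps One_nat_def)
  assume "i < 3" then show ?thesis using 1 2 3 4 by (auto simp: less3 renorm_def)
qed

text \<open>Zero row sums, symmetry and equal diagonal entries form a linear system for the three
  remaining entries with this single solution.\<close>

lemma Hform_off: "i < 3 \<Longrightarrow> j < 3 \<Longrightarrow> i \<noteq> j \<Longrightarrow> Hform i j = - renorm"
proof -
  have s: "Hform 1 0 = Hform 0 1" "Hform 2 0 = Hform 0 2" "Hform 2 1 = Hform 1 2"
    by (rule GB_commute)+
  have "Hform 0 0 + Hform 0 1 + Hform 0 2 = 0" "Hform 1 0 + Hform 1 1 + Hform 1 2 = 0"
    "Hform 2 0 + Hform 2 1 + Hform 2 2 = 0"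
    using Hform_row[of 0] Hform_row[of 1] Hform_row[of 2] unfolding sum3 by auto
  moreover have "Hform 0 0 = 2 * renorm" "Hform 1 1 = 2 * renorm" "Hform 2 2 = 2 * renorm"
    by (rule Hform_diag; simp)+
  ultimately have "Hform 0 1 = - renorm" "Hform 0 2 = - renorm" "Hform 1 2 = - renorm"
    using s by linarith+
  then show "i < 3 \<Longrightarrow> j < 3 \<Longrightarrow> i \<noteq> j \<Longrightarrow> Hform i j = - renorm" using s by (auto simp: less3)
qed

lemma GB_dirichlet_ext_renorm: "GB k 1 (dirichlet_ext f) (dirichlet_ext g) = renorm * tri_energy_form f g"
proof -
  have d: "Hform 0 0 = 2 * renorm" "Hform 1 1 = 2 * renorm" "Hform 2 2 = 2 * renorm"
    by (rule Hform_diag; simp)+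
  have o: "Hform 0 1 = - renorm" "Hform 0 2 = - renorm" "Hform 1 2 = - renorm" "Hform 1 0 = - renorm" "Hform 2 0 = - renorm" "Hform 2 1 = - renorm"
    by (rule Hform_off; simp)+
  show ?thesis unfolding GB_dirichlet_ext sum3 d o tri_energy_form_def by algebra
qed

lemma renorm_pos: "renorm > 0"
proof -
  have "Hform 0 0 \<noteq> 0"
  proof
    assume "Hform 0 0 = 0"
    from GB_1_zero_const[OF this, of "q 1"] have "hit_prob k 0 (q 1) = hit_prob k 0 (q 0)"
      using V0_V1 q_in_V0[of 1] by auto
    then show False by (simp add: hit_prob_V0 del: q_simps)
  qed
  then show ?thesis using GB_nonneg[of 1 "hit_prob k 0"] by (simp add: renorm_def)
qed

text \<open>The coordinate \<open>cX\<close> is an explicit competitor: each of the k(k+1)/2 cells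
  contributes 2/k^2, in total (k+1)/k, against the boundary energy 2. Hence \<open>renorm\<close> is
  at most (k+1)/(2k), which is below 1 for k at least 2.\<close>

lemma renorm_less1: "renorm < 1"
proof -
  let ?f = "\<lambda>i. cX (q i)"
  have "GB k 1 (dirichlet_ext (cX \<circ> q)) (dirichlet_ext (cX \<circ> q)) \<le> GB k 1 cX cX" by (rule GB_dirichlet_ext_le)
  moreover have "GB k 1 (dirichlet_ext (cX \<circ> q)) (dirichlet_ext (cX \<circ> q)) = renorm * 2"
    unfolding GB_dirichlet_ext_renorm by (simp add: tri_energy_form_def)
  moreover have "GB k 1 cX cX = real (d k) * (2 / (real k * real k))"
    unfolding GB_1 by (simp add: tri_energy_form_def diff_divide_distrib[symmetric])
  moreover have "2 * real (d k) = real k * (real k + 1)"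
  proof -
    have "2 * d k = k * (k + 1)" by (simp add: d_def)
    then have "real (2 * d k) = real (k * (k + 1))" by (rule arg_cong)
    then show ?thesis by (simp add: algebra_simps)
  qed
  ultimately have "renorm * 2 \<le> (real k * (real k + 1)) / (real k * real k)"
    by (metis mult.commute times_divide_eq_right)
  then have "renorm * 2 \<le> (real k + 1) / real k" by simp
  also have "\<dots> < 2" using k2 by (simp add: field_simps)
  finally show ?thesis by simp
qed

lemma rk_eq: "rk k = renorm"
  unfolding rk_def
proof (rule the_equality)
  have inf: "(INF ut\<in>{ut. \<forall>x\<in>V0. ut x = u x}. GE k 1 ut / r) = renorm * tri_energy_form (u \<circ> q) (u \<circ> q) / r"
    if "r > 0" for u and r :: real
  proof (rule cInf_eq_minimum)
    have "GE k 1 (dirichlet_ext (u \<circ> q)) / r = renorm * tri_energy_form (u \<circ> q) (u \<circ> q) / r"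
      unfolding GE_GB GB_dirichlet_ext_renorm ..
    then show "renorm * tri_energy_form (u \<circ> q) (u \<circ> q) / r \<in> (\<lambda>ut. GE k 1 ut / r) ` {ut. \<forall>x\<in>V0. ut x = u x}"
      by (intro image_eqI[of _ _ "dirichlet_ext (u \<circ> q)"]) (auto elim!: V0E simp: dirichlet_ext_q)
    fix y assume "y \<in> (\<lambda>ut. GE k 1 ut / r) ` {ut. \<forall>x\<in>V0. ut x = u x}"
    then obtain ut where ut: "y = GE k 1 ut / r" "\<And>x. x \<in> V0 \<Longrightarrow> ut x = u x" by auto
    have "dirichlet_ext (u \<circ> q) = dirichlet_ext (ut \<circ> q)" by (rule dirichlet_ext_cong) (simp add: ut(2) q_in_V0)
    then have "renorm * tri_energy_form (u \<circ> q) (u \<circ> q) \<le> GE k 1 ut"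
      using GB_dirichlet_ext_le[of ut] by (metis GB_dirichlet_ext_renorm GE_GB)
    then show "renorm * tri_energy_form (u \<circ> q) (u \<circ> q) / r \<le> y" using that ut(1) by (simp add: divide_right_mono)
  qed
  show "renorm > 0 \<and> (\<forall>u. (INF ut\<in>{ut. \<forall>x\<in>V0. ut x = u x}. GE k 1 ut / renorm) = GE k 0 u)"
    unfolding inf[OF renorm_pos] GE_GB[of k 0] GB_0 using renorm_pos by simp
  fix r :: real assume r: "r > 0 \<and> (\<forall>u. (INF ut\<in>{ut. \<forall>x\<in>V0. ut x = u x}. GE k 1 ut / r) = GE k 0 u)"
  \<comment> \<open>One boundary function of nonzero energy suffices for uniqueness of r.\<close>
  have "renorm * tri_energy_form (cX \<circ> q) (cX \<circ> q) / r = tri_energy_form (cX \<circ> q) (cX \<circ> q)"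
    using r inf[of r cX] by (simp add: GE_GB GB_0)
  moreover have "tri_energy_form (cX \<circ> q) (cX \<circ> q) = 2" by (simp add: tri_energy_form_def)
  ultimately have "renorm * 2 / r = 2" by metis
  then show "r = renorm" using r by (simp add: field_simps)
qed

text \<open>The harmonic extension matrix of cell n, acting on triples of boundary values.\<close>

definition cell_map :: "nat \<Rightarrow> (nat \<Rightarrow> real) \<Rightarrow> nat \<Rightarrow> real" where
  "cell_map n f i = dirichlet_ext f (F k n (q i))"

lemma F_q_V1: "n < d k \<Longrightarrow> i < 3 \<Longrightarrow> F k n (q i) \<in> V k 1"
  using q_in_V0 by (auto simp: V_Suc simp del: q_simps)

lemma cell_map_corner: "i < 3 \<Longrightarrow> cell_map (corner i) f i = f i"
  by (simp add: cell_map_def corner(2) dirichlet_ext_q)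

lemma cell_map_energy: "(\<Sum>n<d k. tri_energy_form (cell_map n f) (cell_map n f)) = renorm * tri_energy_form f f"
  using GB_dirichlet_ext_renorm[of f f] unfolding GB_1 by (simp add: cell_map_def[abs_def] comp_def)

lemma cell_map_const: "n < d k \<Longrightarrow> i < 3 \<Longrightarrow> cell_map n f i - c = (\<Sum>l<3. (f l - c) * hit_prob k l (F k n (q i)))"
proof -
  assume "n < d k" "i < 3"
  then have "(\<Sum>l<3. hit_prob k l (F k n (q i))) = 1" using hit_sum F_q_V1 by blast
  then show ?thesis unfolding cell_map_def dirichlet_ext_def
    by (simp add: left_diff_distrib sum_subtractf sum_distrib_left[symmetric])
qed

text \<open>The sum is the current of \<open>hit_prob k l\<close> through \<open>q i\<close>. By
  \<open>green\<close>, \<open>hit_prob k i\<close> may be replaced in \<open>Hform i l\<close> by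
  the indicator of \<open>q i\<close>, which meets only the corner cell. There the form is 3 g(i)
  minus the sum of g, and g(i) is 0 because l differs from i.\<close>

lemma corner_current:
  assumes "i < 3" "l < 3" "l \<noteq> i"
  shows "(\<Sum>j<3. hit_prob k l (F k (corner i) (q j))) = renorm"
proof -
  let ?i = "\<lambda>x. if x = q i then 1 else 0 :: real"
  have "GB k 1 (hit_prob k l) (\<lambda>x. hit_prob k i x - ?i x) = 0"
    by (rule green[OF hit_prob_harm1]) (use assms in \<open>auto elim!: V0E simp: hit_prob_V0 q_inj\<close>)
  moreover have "GB k 1 (\<lambda>x. hit_prob k i x - ?i x) (hit_prob k l) = Hform i l - GB k 1 ?i (hit_prob k l)"
    by (rule GB_diff)
  ultimately have "GB k 1 ?i (hit_prob k l) = - renorm"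
    using Hform_off[of i l] assms by (simp add: GB_commute)
  moreover have "GB k 1 ?i (hit_prob k l) = (\<Sum>n<d k. if n = corner i then tri_energy_form (unit_bdry i) (\<lambda>j. hit_prob k l (F k (corner i) (q j))) else 0)"
    unfolding GB_1
  proof (rule sum.cong[OF refl])
    fix n assume n: "n \<in> {..<d k}"
    show "tri_energy_form (?i \<circ> F k n \<circ> q) (hit_prob k l \<circ> F k n \<circ> q) =
      (if n = corner i then tri_energy_form (unit_bdry i) (\<lambda>j. hit_prob k l (F k (corner i) (q j))) else 0)"
    proof (cases "n = corner i")
      case True
      have "(?i \<circ> F k n \<circ> q) j = unit_bdry i j" if "j < 3" for j
      proof -
        have "F k n (q j) = q i \<longleftrightarrow> F k n (q j) = F k n (q i)" using corner(2)[OF assms(1)] True by simp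
        then show ?thesis using q_inj[OF that assms(1)] by (simp add: unit_bdry_def eq_commute)
      qed
      then have "tri_energy_form (?i \<circ> F k n \<circ> q) (hit_prob k l \<circ> F k n \<circ> q) = tri_energy_form (unit_bdry i) (\<lambda>j. hit_prob k l (F k (corner i) (q j)))"
        by (intro tri_energy_form_cong) (simp_all add: True)
      then show ?thesis using True by simp
    next
      case False
      have "F k n (q j) \<noteq> q i" if "j < 3" for j
        using corner_cell_unique[OF assms(1), of n "q j"] n False q_in_V0[OF that] V0_Tri by auto
      from this[of 0] this[of 1] this[of 2] show ?thesis using False by (simp add: tri_energy_form_def del: q_simps)
    qed
  qed
  moreover have "(\<Sum>n<d k. if n = corner i then tri_energy_form (unit_bdry i) (\<lambda>j. hit_prob k l (F k (corner i) (q j))) else 0)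
      = tri_energy_form (unit_bdry i) (\<lambda>j. hit_prob k l (F k (corner i) (q j)))"
    using corner(1)[OF assms(1)] by (simp add: sum.delta')
  moreover have "tri_energy_form (unit_bdry i) g = 3 * g i - (\<Sum>j<3. g j)" for g
    using assms(1) by (auto simp: less3 tri_energy_form_def unit_bdry_def sum3)
  moreover have "hit_prob k l (F k (corner i) (q i)) = 0"
    using corner(2)[OF assms(1)] assms by (simp add: hit_prob_V0)
  ultimately show ?thesis by simp
qed

text \<open>In the l^1 norm of the deviations from the fixed value \<open>f i\<close>,
  \<open>corner_current\<close> bounds the corner matrix by \<open>renorm\<close>: its entries are
  nonnegative with column sums \<open>renorm\<close>, except in column i, which multiplies a zero
  deviation.\<close>

lemma corner_contract:
  assumes "i < 3"
  shows "(\<Sum>j<3. \<bar>cell_map (corner i) f j - f i\<bar>) \<le> renorm * (\<Sum>j<3. \<bar>f j - f i\<bar>)"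
proof -
  note corner = corner[OF assms]
  have "(\<Sum>j<3. \<bar>cell_map (corner i) f j - f i\<bar>) \<le> (\<Sum>j<3. \<Sum>l<3. \<bar>f l - f i\<bar> * hit_prob k l (F k (corner i) (q j)))"
  proof (rule sum_mono)
    fix j assume "j \<in> {..<3::nat}"
    then have "\<bar>cell_map (corner i) f j - f i\<bar> \<le> (\<Sum>l<3. \<bar>(f l - f i) * hit_prob k l (F k (corner i) (q j))\<bar>)"
      using cell_map_const[OF corner(1), of j f "f i"] sum_abs by simp
    then show "\<bar>cell_map (corner i) f j - f i\<bar> \<le> (\<Sum>l<3. \<bar>f l - f i\<bar> * hit_prob k l (F k (corner i) (q j)))"
      by (simp add: abs_mult hit_prob_nonneg)
  qed
  also have "\<dots> = (\<Sum>l<3. \<bar>f l - f i\<bar> * (\<Sum>j<3. hit_prob k l (F k (corner i) (q j))))"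
    unfolding sum_distrib_left by (rule sum.swap)
  also have "\<dots> = (\<Sum>l<3. \<bar>f l - f i\<bar> * renorm)"
    by (rule sum.cong[OF refl]) (use corner_current[OF assms] in force)
  finally show ?thesis by (simp add: sum_distrib_left mult.commute)
qed

lemma tri_energy_form_bound: "tri_energy_form f f \<le> 3 * (\<Sum>j<3. \<bar>f j - c\<bar>)^2"
proof -
  let ?s = "\<Sum>j<3. \<bar>f j - c\<bar>"
  have "\<bar>f 0 - f 1\<bar> \<le> ?s" "\<bar>f 0 - f 2\<bar> \<le> ?s" "\<bar>f 1 - f 2\<bar> \<le> ?s" unfolding sum3 by linarith+
  then have "(f 0 - f 1)^2 \<le> ?s^2" "(f 0 - f 2)^2 \<le> ?s^2" "(f 1 - f 2)^2 \<le> ?s^2"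
    using abs_le_square_iff by fastforce+
  then show ?thesis by (simp add: tri_energy_form_def power2_eq_square)
qed

section \<open>Limit energy and harmonic functions\<close>

lemma Em_renorm: "Em k m u = GB k m u u / renorm ^ m"
  by (simp add: Em_def GE_GB rk_eq)

lemma Ebm_renorm: "Ebm k m u v = GB k m u v / renorm ^ m"
  by (simp add: Ebm_def rk_eq)

lemma Ebm_Suc: "Ebm k (Suc m) u v = (\<Sum>n<d k. Ebm k m (u \<circ> F k n) (v \<circ> F k n)) / renorm"
  by (simp add: Ebm_renorm GB_Suc sum_divide_distrib mult.commute)

lemma Em_Suc: "Em k (Suc m) u = (\<Sum>n<d k. Em k m (u \<circ> F k n)) / renorm"
  by (simp add: Em_renorm GB_Suc sum_divide_distrib mult.commute)

lemma Em_nonneg: "Em k m u \<ge> 0"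
  using renorm_pos by (simp add: Em_renorm GB_nonneg)

lemma Em_cong: "(\<And>x. x \<in> V k m \<Longrightarrow> u x = u' x) \<Longrightarrow> Em k m u = Em k m u'"
  unfolding Em_renorm using GB_cong[of m u u' u u'] by simp

text \<open>From level 0 to 1 this is minimality of the Dirichlet extension together with the choice
  of r; higher levels follow cell by cell.\<close>

lemma Em_mono_Suc: "Em k m u \<le> Em k (Suc m) u"
proof (induction m arbitrary: u)
  case 0
  have "renorm * tri_energy_form (u \<circ> q) (u \<circ> q) \<le> GB k 1 u u" using GB_dirichlet_ext_le[of u] by (simp only: GB_dirichlet_ext_renorm)
  then show ?case using renorm_pos by (simp add: Em_renorm GB_0 field_simps)
next
  case (Suc m)
  show ?case
    by (subst Em_Suc[of m u], subst Em_Suc[of "Suc m" u],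
        intro divide_right_mono sum_mono Suc less_imp_le[OF renorm_pos])
qed

lemma Em_incseq: "incseq (\<lambda>m. Em k m u)"
  using Em_mono_Suc by (rule incseq_SucI)

lemma Em_ge_0: "Em k 0 u \<le> Em k m u"
  using Em_incseq[of u] by (simp add: incseq_def)

definition finite_energy :: "(complex \<Rightarrow> real) \<Rightarrow> bool" where
  "finite_energy u \<longleftrightarrow> (\<exists>C. \<forall>m. Em k m u \<le> C)"

lemma Energy_SUP: "Energy k u = (SUP m. ereal (Em k m u))"
proof -
  have "incseq (\<lambda>m. ereal (Em k m u))" using Em_incseq[of u] by (simp add: incseq_def)
  from limI[OF LIMSEQ_SUP[OF this]] show ?thesis by (simp add: Energy_def)
qed

lemma Energy_finite_iff: "Energy k u < \<infinity> \<longleftrightarrow> finite_energy u"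
proof
  assume "Energy k u < \<infinity>"
  then obtain C where C: "Energy k u \<le> ereal C" by (cases "Energy k u") auto
  have "ereal (Em k m u) \<le> ereal C" for m
    using C unfolding Energy_SUP by (meson SUP_le_iff UNIV_I)
  then show "finite_energy u" by (auto simp: finite_energy_def)
next
  assume "finite_energy u"
  then obtain C where "\<And>m. Em k m u \<le> C" by (auto simp: finite_energy_def)
  then have "Energy k u \<le> ereal C" unfolding Energy_SUP by (intro SUP_least) simp
  then show "Energy k u < \<infinity>" by (auto simp: less_top[symmetric] dest: order_le_less_trans)
qed

lemma domE_iff: "u \<in> domE k \<longleftrightarrow> continuous_on KK u \<and> finite_energy u"
  by (simp only: domE_def K_eq Energy_finite_iff mem_Collect_eq)

lemma Energy_const: assumes "\<And>m. Em k m u = c" shows "Energy k u = ereal c"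
  by (simp add: Energy_SUP assms)

lemma Em_plus_minus:
  "Em k m (\<lambda>x. u x + v x) = Em k m u + 2 * Ebm k m u v + Em k m v"
  "Em k m (\<lambda>x. u x - v x) = Em k m u - 2 * Ebm k m u v + Em k m v"
proof -
  have a: "GB k m (\<lambda>x. u x + v x) w = GB k m u w + GB k m v w" "GB k m w (\<lambda>x. u x + v x) = GB k m w u + GB k m w v" for w
    using GB_add[of m u v w] by (simp_all add: GB_commute[of m w])
  have b: "GB k m (\<lambda>x. u x - v x) w = GB k m u w - GB k m v w" "GB k m w (\<lambda>x. u x - v x) = GB k m w u - GB k m w v" for w
    using GB_diff[of m u v w] by (simp_all add: GB_commute[of m w])
  show "Em k m (\<lambda>x. u x + v x) = Em k m u + 2 * Ebm k m u v + Em k m v"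
    unfolding Em_renorm Ebm_renorm a using GB_commute[of m u v] by (simp add: add_divide_distrib)
  show "Em k m (\<lambda>x. u x - v x) = Em k m u - 2 * Ebm k m u v + Em k m v"
    unfolding Em_renorm Ebm_renorm b using GB_commute[of m u v] by (simp add: add_divide_distrib diff_divide_distrib)
qed

lemma Em_convergent: assumes "finite_energy u" shows "convergent (\<lambda>m. Em k m u)"
proof -
  obtain C where "\<forall>m. Em k m u \<le> C" using assms by (auto simp: finite_energy_def)
  then obtain L where "(\<lambda>m. Em k m u) \<longlonglongrightarrow> L"
    using incseq_convergent[OF Em_incseq] by blast
  then show ?thesis by (rule convergentI)
qed

lemma finite_energy_plus_minus:
  assumes "finite_energy u" "finite_energy v"
  shows "finite_energy (\<lambda>x. u x + v x)" "finite_energy (\<lambda>x. u x - v x)"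
proof -
  obtain C D where C: "\<And>m. Em k m u \<le> C" "\<And>m. Em k m v \<le> D" using assms by (auto simp: finite_energy_def)
  have "Em k m (\<lambda>x. u x + v x) \<le> 2 * C + 2 * D" "Em k m (\<lambda>x. u x - v x) \<le> 2 * C + 2 * D" for m
    using C(1)[of m] C(2)[of m] Em_plus_minus(1)[of m u v] Em_plus_minus(2)[of m u v]
      Em_nonneg[of m "\<lambda>x. u x + v x"] Em_nonneg[of m "\<lambda>x. u x - v x"] by linarith+
  then show "finite_energy (\<lambda>x. u x + v x)" "finite_energy (\<lambda>x. u x - v x)" by (auto simp: finite_energy_def)
qed

text \<open>\<open>Eform\<close> is a bare \<open>lim\<close>, so convergence has to be known before
  it means anything; polarization reduces it to monotone bounded energies.\<close>

lemma Ebm_convergent: assumes "finite_energy u" "finite_energy v" shows "convergent (\<lambda>m. Ebm k m u v)"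
proof -
  have "(\<lambda>m. Ebm k m u v) = (\<lambda>m. (Em k m (\<lambda>x. u x + v x) - Em k m (\<lambda>x. u x - v x)) * (1/4))"
    unfolding Em_plus_minus by simp
  moreover have "convergent (\<lambda>m. (Em k m (\<lambda>x. u x + v x) - Em k m (\<lambda>x. u x - v x)) * (1/4))"
    by (intro convergent_mult convergent_diff Em_convergent finite_energy_plus_minus assms convergent_const)
  ultimately show ?thesis by (simp only:)
qed

lemma Ebm_tendsto: assumes "finite_energy u" "finite_energy v" shows "(\<lambda>m. Ebm k m u v) \<longlonglongrightarrow> Eform k u v"
  using Ebm_convergent[OF assms] by (simp add: convergent_LIMSEQ_iff Eform_def)

lemma finite_energy_F: assumes "finite_energy u" "n < d k" shows "finite_energy (u \<circ> F k n)"
proof -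
  obtain C where C: "\<And>m. Em k m u \<le> C" using assms by (auto simp: finite_energy_def)
  have "Em k m (u \<circ> F k n) \<le> renorm * C" for m
  proof -
    have "Em k m (u \<circ> F k n) \<le> (\<Sum>n<d k. Em k m (u \<circ> F k n))"
      using assms(2) Em_nonneg by (intro member_le_sum) auto
    also have "\<dots> = renorm * Em k (Suc m) u" using renorm_pos by (simp add: Em_Suc)
    also have "\<dots> \<le> renorm * C" using C renorm_pos by simp
    finally show ?thesis .
  qed
  then show ?thesis by (auto simp: finite_energy_def)
qed

section \<open>Harmonic functions as uniform limits\<close>

definition F_inv :: "nat \<Rightarrow> complex \<Rightarrow> complex" where
  "F_inv n x = of_nat k * (x - bvec k n)"

lemma F_inv_F_cancel [simp]: "F_inv n (F k n x) = x" and F_F_inv_cancel [simp]: "F k n (F_inv n x) = x"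
  by (simp_all add: F_inv_def F_def)

lemma F_inv_continuous: "continuous_on A (F_inv n)"
  unfolding F_inv_def by (intro continuous_intros)

text \<open>A point may lie in two cells; \<open>harm_approx_F\<close> shows that the choice of the cell is immaterial.\<close>

primrec harm_approx :: "nat \<Rightarrow> (nat \<Rightarrow> real) \<Rightarrow> complex \<Rightarrow> real" where
  "harm_approx 0 f x = f 0 + (f 1 - f 0) * cX x + (f 2 - f 0) * cY x"
| "harm_approx (Suc m) f x = (let n = (SOME n. n < d k \<and> x \<in> F k n ` KK) in harm_approx m (cell_map n f) (F_inv n x))"

lemma harm_approx_Suc_ex: assumes "x \<in> KK"
  obtains n y where "n < d k" "y \<in> KK" "x = F k n y" "\<And>f. harm_approx (Suc m) f x = harm_approx m (cell_map n f) y"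
proof -
  let ?n = "SOME n. n < d k \<and> x \<in> F k n ` KK"
  have "\<exists>n. n < d k \<and> x \<in> F k n ` KK" using assms KK_F by blast
  from someI_ex[OF this] obtain y where y: "?n < d k" "y \<in> KK" "x = F k ?n y" by blast
  then have "F_inv ?n x = y" by (metis F_inv_F_cancel)
  then show ?thesis using that[of ?n y] y by (simp add: Let_def)
qed

lemma harm_approx_q: "i < 3 \<Longrightarrow> harm_approx m f (q i) = f i"
proof (induction m arbitrary: f)
  case 0 then show ?case by (auto simp: less3)
next
  case (Suc m)
  obtain n y where n: "n < d k" "y \<in> KK" "q i = F k n y" "\<And>f. harm_approx (Suc m) f (q i) = harm_approx m (cell_map n f) y"
    by (rule harm_approx_Suc_ex[OF q_KK[OF Suc.prems], where m = m]) blast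
  have c: "n = corner i" using corner_cell_unique[OF Suc.prems n(1), of y] n(2,3) KK_Tri by auto
  have "F k n y = F k n (q i)" using n(3) corner(2)[OF Suc.prems] c by simp
  then have y: "y = q i" by simp
  have "harm_approx (Suc m) f (q i) = harm_approx m (cell_map (corner i) f) (q i)" unfolding n(4) c y ..
  then show ?case by (simp only: Suc.IH[OF Suc.prems] cell_map_corner[OF Suc.prems])
qed

text \<open>If another cell contains the point, \<open>overlap\<close> makes it a vertex of both,
  and at vertices both candidate values are the value of \<open>dirichlet_ext f\<close> at the
  common point.\<close>

lemma harm_approx_F: assumes n: "n < d k" and x: "x \<in> KK"
  shows "harm_approx (Suc m) f (F k n x) = harm_approx m (cell_map n f) x"
proof -
  obtain n' y where y: "n' < d k" "y \<in> KK" "F k n x = F k n' y" "\<And>f. harm_approx (Suc m) f (F k n x) = harm_approx m (cell_map n' f) y"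
    by (rule harm_approx_Suc_ex[OF F_KK[OF n x], where m = m]) blast
  show ?thesis
  proof (cases "n = n'")
    case True
    then have xy: "y = x" using y(3) by simp
    have "harm_approx (Suc m) f (F k n x) = harm_approx m (cell_map n' f) y" by (rule y(4))
    then show ?thesis by (simp only: True[symmetric] xy)
  next
    case False
    have T: "x \<in> Tri" "y \<in> Tri" using x y(2) KK_Tri by auto
    obtain i where i: "i < 3" "x = q i" using overlap(2)[OF n y(1) False T y(3)] by (rule V0E)
    obtain j where j: "j < 3" "y = q j"
      using overlap(2)[OF y(1) n False[symmetric] T(2,1) y(3)[symmetric]] by (rule V0E)
    have "harm_approx m (cell_map n f) x = dirichlet_ext f (F k n x)" using i harm_approx_q by (simp add: cell_map_def)
    moreover have "harm_approx m (cell_map n' f) y = dirichlet_ext f (F k n' y)" using j harm_approx_q by (simp add: cell_map_def)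
    ultimately show ?thesis unfolding y(4) by (simp only: y(3))
  qed
qed

lemma cell_map_near: assumes "n < d k" "\<And>i. i < 3 \<Longrightarrow> \<bar>f i - c\<bar> \<le> s" "i < 3" shows "\<bar>cell_map n f i - c\<bar> \<le> s"
proof -
  have "\<bar>cell_map n f i - c\<bar> \<le> (\<Sum>l<3. \<bar>(f l - c) * hit_prob k l (F k n (q i))\<bar>)"
    unfolding cell_map_const[OF assms(1,3)] by (rule sum_abs)
  also have "\<dots> \<le> (\<Sum>l<3. s * hit_prob k l (F k n (q i)))"
    by (intro sum_mono) (auto simp: abs_mult hit_prob_nonneg intro!: mult_right_mono assms)
  also have "\<dots> = s" using hit_sum[OF F_q_V1[OF assms(1,3)]] by (simp add: sum_distrib_left[symmetric])
  finally show ?thesis .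
qed

text \<open>Maximum principle: level 0 interpolates with barycentric weights, and each
  \<open>cell_map\<close> averages with hitting probabilities.\<close>

lemma harm_approx_near: assumes "\<And>i. i < 3 \<Longrightarrow> \<bar>f i - c\<bar> \<le> s" "x \<in> KK" shows "\<bar>harm_approx m f x - c\<bar> \<le> s"
  using assms
proof (induction m arbitrary: f x)
  case 0
  have x: "0 \<le> cX x" "0 \<le> cY x" "0 \<le> 1 - cX x - cY x" using 0(2) KK_Tri by (auto simp: Tri_def)
  have "harm_approx 0 f x - c = (f 0 - c) * (1 - cX x - cY x) + (f 1 - c) * cX x + (f 2 - c) * cY x"
    by (simp add: algebra_simps)
  also have "\<bar>\<dots>\<bar> \<le> \<bar>f 0 - c\<bar> * (1 - cX x - cY x) + \<bar>f 1 - c\<bar> * cX x + \<bar>f 2 - c\<bar> * cY x"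
    using x by (intro order_trans[OF abs_triangle_ineq] add_mono) (auto simp: abs_mult)
  also have "\<dots> \<le> s * (1 - cX x - cY x) + s * cX x + s * cY x"
    using x 0(1)[of 0] 0(1)[of 1] 0(1)[of 2] by (intro add_mono mult_right_mono) auto
  also have "\<dots> = s" by (simp add: algebra_simps)
  finally show ?case .
next
  case (Suc m)
  obtain n y where n: "n < d k" "y \<in> KK" "x = F k n y" using Suc.prems(2) KK_F by blast
  have "\<bar>harm_approx m (cell_map n f) y - c\<bar> \<le> s"
    by (rule Suc.IH) (use cell_map_near[OF n(1) Suc.prems(1)] n(2) in auto)
  then show ?case unfolding n(3) harm_approx_F[OF n(1,2)] .
qed

lemma tri_energy_form_cell_map: "n < d k \<Longrightarrow> tri_energy_form (cell_map n f) (cell_map n f) \<le> renorm * tri_energy_form f f"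
  unfolding cell_map_energy[symmetric] using tri_energy_form_nonneg by (intro member_le_sum) auto

text \<open>The deviation from \<open>f 0\<close> is at most the square root of the energy, and the
  energy on a cell loses at least the factor \<open>renorm\<close> with every letter. The factor 2
  comes from comparing both approximants with \<open>f 0\<close>.\<close>

lemma harm_approx_diff: "x \<in> KK \<Longrightarrow> \<bar>harm_approx (Suc m) f x - harm_approx m f x\<bar> \<le> 2 * sqrt (tri_energy_form f f) * sqrt renorm ^ m"
proof (induction m arbitrary: f x)
  case 0
  have "\<bar>f i - f 0\<bar> \<le> sqrt (tri_energy_form f f)" if "i < 3" for i
  proof -
    have "tri_energy_form f f = (f 1 - f 0)^2 + (f 2 - f 0)^2 + (f 1 - f 2)^2"
      by (simp add: tri_energy_form_def power2_eq_square algebra_simps)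
    then have "(f i - f 0)^2 \<le> tri_energy_form f f" using that by (auto simp: less3)
    then show ?thesis by (intro real_le_rsqrt) (simp add: power2_abs)
  qed
  then have "\<bar>harm_approx (Suc 0) f x - f 0\<bar> \<le> sqrt (tri_energy_form f f)" "\<bar>harm_approx 0 f x - f 0\<bar> \<le> sqrt (tri_energy_form f f)"
    using 0 by (auto intro!: harm_approx_near simp del: harm_approx.simps)
  then have "\<bar>harm_approx (Suc 0) f x - harm_approx 0 f x\<bar> \<le> 2 * sqrt (tri_energy_form f f)" by linarith
  then show ?case by (simp only: power_0 mult_1_right)
next
  case (Suc m)
  obtain n y where n: "n < d k" "y \<in> KK" "x = F k n y" using Suc.prems KK_F by blast
  have "\<bar>harm_approx (Suc (Suc m)) f x - harm_approx (Suc m) f x\<bar> = \<bar>harm_approx (Suc m) (cell_map n f) y - harm_approx m (cell_map n f) y\<bar>"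
    unfolding n(3) harm_approx_F[OF n(1,2)] ..
  also have "\<dots> \<le> 2 * sqrt (tri_energy_form (cell_map n f) (cell_map n f)) * sqrt renorm ^ m" by (rule Suc.IH[OF n(2)])
  also have "\<dots> \<le> 2 * sqrt (renorm * tri_energy_form f f) * sqrt renorm ^ m"
    using tri_energy_form_cell_map[OF n(1), of f] renorm_pos by (intro mult_right_mono mult_left_mono) auto
  finally show ?case by (simp add: real_sqrt_mult mult_ac)
qed

text \<open>The limit of \<open>harm_approx\<close>, written as a telescoping series to suit the
  Weierstrass M-test.\<close>

definition harm_fun :: "(nat \<Rightarrow> real) \<Rightarrow> complex \<Rightarrow> real" where
  "harm_fun f x = harm_approx 0 f x + (\<Sum>i. harm_approx (Suc i) f x - harm_approx i f x)"

lemma harm_approx_uniform: "uniform_limit KK (\<lambda>m. harm_approx m f) (harm_fun f) sequentially"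
proof -
  have "uniform_limit KK (\<lambda>n x. \<Sum>i<n. harm_approx (Suc i) f x - harm_approx i f x) (\<lambda>x. suminf (\<lambda>i. harm_approx (Suc i) f x - harm_approx i f x)) sequentially"
  proof (rule Weierstrass_m_test)
    show "norm (harm_approx (Suc n) f x - harm_approx n f x) \<le> 2 * sqrt (tri_energy_form f f) * sqrt renorm ^ n" if "x \<in> KK" for n x
      using harm_approx_diff[OF that] by (simp only: real_norm_def)
    show "summable (\<lambda>n. 2 * sqrt (tri_energy_form f f) * sqrt renorm ^ n)"
      using renorm_pos renorm_less1 by (intro summable_mult summable_geometric) simp
  qed
  then have "uniform_limit KK (\<lambda>n x. harm_approx 0 f x + (\<Sum>i<n. harm_approx (Suc i) f x - harm_approx i f x))
      (\<lambda>x. harm_approx 0 f x + (\<Sum>i. harm_approx (Suc i) f x - harm_approx i f x)) sequentially"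
    by (intro uniform_limit_add uniform_limit_const)
  moreover have "harm_approx 0 f x + (\<Sum>i<n. harm_approx (Suc i) f x - harm_approx i f x) = harm_approx n f x" for n x
    using sum_lessThan_telescope[of "\<lambda>i. harm_approx i f x" n] by (simp del: harm_approx.simps)
  ultimately show ?thesis by (simp only: harm_fun_def[abs_def])
qed

lemma harm_approx_tendsto: "x \<in> KK \<Longrightarrow> (\<lambda>m. harm_approx m f x) \<longlonglongrightarrow> harm_fun f x"
  using tendsto_uniform_limitI[OF harm_approx_uniform] .

lemma harm_approx_continuous: "continuous_on KK (harm_approx m f)"
proof (induction m arbitrary: f)
  case 0
  have "continuous_on KK cX" "continuous_on KK cY"
    using isCont_cX isCont_cY continuous_on_subset by blast+
  then show ?case by (auto intro!: continuous_intros)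
next
  case (Suc m)
  have "continuous_on (\<Union>n\<in>{..<d k}. F k n ` KK) (harm_approx (Suc m) f)"
  proof (rule continuous_on_closed_Union)
    fix n assume n: "n \<in> {..<d k}"
    show "closed (F k n ` KK)"
      by (rule compact_imp_closed[OF compact_continuous_image[OF F_continuous compact_KK]])
    have "continuous_on (F k n ` KK) (harm_approx m (cell_map n f) \<circ> F_inv n)"
      by (rule continuous_on_compose[OF F_inv_continuous]) (simp add: image_image Suc)
    then show "continuous_on (F k n ` KK) (harm_approx (Suc m) f)"
      by (rule continuous_on_eq) (use n harm_approx_F in \<open>auto simp del: harm_approx.simps\<close>)
  qed simp
  then show ?case using KK_F by simp
qed

lemma harm_fun_continuous: "continuous_on KK (harm_fun f)"
  by (rule uniform_limit_theorem[OF always_eventually harm_approx_uniform]) (auto simp: harm_approx_continuous)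

lemma harm_fun_q: "i < 3 \<Longrightarrow> harm_fun f (q i) = f i"
  using LIMSEQ_unique[OF harm_approx_tendsto[OF q_KK, of i f] ] by (simp add: harm_approx_q)

lemma harm_fun_F: assumes "n < d k" "x \<in> KK" shows "harm_fun f (F k n x) = harm_fun (cell_map n f) x"
proof (rule LIMSEQ_unique)
  show "(\<lambda>m. harm_approx m (cell_map n f) x) \<longlonglongrightarrow> harm_fun (cell_map n f) x" by (rule harm_approx_tendsto[OF assms(2)])
  show "(\<lambda>m. harm_approx m (cell_map n f) x) \<longlonglongrightarrow> harm_fun f (F k n x)"
    using LIMSEQ_Suc[OF harm_approx_tendsto[OF F_KK[OF assms], of f]] by (simp only: harm_approx_F[OF assms])
qed

lemma cell_map_cong: "(\<And>j. j < 3 \<Longrightarrow> f j = g j) \<Longrightarrow> cell_map n f = cell_map n g"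
  using dirichlet_ext_cong[of f g] by (simp add: cell_map_def[abs_def])

lemma harm_fun_cong: assumes "\<And>j. j < 3 \<Longrightarrow> f j = g j" shows "harm_fun f = harm_fun g"
proof -
  have cell_map: "cell_map n f = cell_map n g" for n using assms by (rule cell_map_cong)
  have "f 0 = g 0" "f 1 = g 1" "f 2 = g 2" using assms by auto
  then have "harm_approx m f = harm_approx m g" for m
    by (cases m) (auto simp only: harm_approx.simps cell_map fun_eq_iff)
  then show ?thesis by (simp only: harm_fun_def[abs_def])
qed

lemma V_KK: "V k m \<subseteq> KK" using V_VV VV_KK by blast

lemma Em_harm_fun: "Em k m (harm_fun f) = tri_energy_form f f"
proof -
  have "GB k m (harm_fun f) (harm_fun f) = renorm ^ m * tri_energy_form f f"
  proof (induction m arbitrary: f)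
    case 0 then show ?case unfolding GB_0 by (simp, intro tri_energy_form_cong) (simp_all add: harm_fun_q)
  next
    case (Suc m)
    have "GB k (Suc m) (harm_fun f) (harm_fun f) = (\<Sum>n<d k. GB k m (harm_fun (cell_map n f)) (harm_fun (cell_map n f)))"
      unfolding GB_Suc by (intro sum.cong[OF refl] GB_cong) (simp_all add: harm_fun_F subsetD[OF V_KK])
    also have "\<dots> = renorm ^ m * (\<Sum>n<d k. tri_energy_form (cell_map n f) (cell_map n f))" by (simp add: Suc sum_distrib_left)
    finally show ?case by (simp add: cell_map_energy mult_ac)
  qed
  then show ?thesis using renorm_pos by (simp add: Em_renorm)
qed

text \<open>Here \<open>harmonic\<close> only says that total energies are constant in the level. At
  level 1 this kills the remainder in the orthogonal decomposition. At higher levels the energy of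
  each cell can only grow, so constancy of their sum makes each restriction harmonic again and the
  induction continues.\<close>

lemma harmonic_unique: "harmonic k u \<Longrightarrow> x \<in> V k m \<Longrightarrow> u x = harm_fun (u \<circ> q) x"
proof (induction m arbitrary: u x)
  case 0 then show ?case by (auto elim!: V0E simp: harm_fun_q)
next
  case (Suc m)
  obtain n y where n: "n < d k" "y \<in> V k m" "x = F k n y" using Suc.prems(2) by (auto simp: V_Suc)
  have h: "Em k m u = Em k 0 u" for m using Suc.prems(1) by (simp add: harmonic_def)
  have "GB k 1 u u = renorm * tri_energy_form (u \<circ> q) (u \<circ> q)"
    using h[of 1] renorm_pos by (simp add: Em_renorm GB_0 field_simps)
  then have "GB k 1 (\<lambda>x. u x - dirichlet_ext (u \<circ> q) x) (\<lambda>x. u x - dirichlet_ext (u \<circ> q) x) = 0"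
    using GB_dirichlet_ext_decomp[of u] by (simp only: GB_dirichlet_ext_renorm)
  moreover have "u (q 0) - dirichlet_ext (u \<circ> q) (q 0) = 0" by (subst dirichlet_ext_q) auto
  ultimately have e: "u z = dirichlet_ext (u \<circ> q) z" if "z \<in> V k 1" for z
    using GB_zero_bdry[OF _ _ that, of "\<lambda>x. u x - dirichlet_ext (u \<circ> q) x"] by auto
  have hF: "harmonic k (u \<circ> F k n)"
    unfolding harmonic_def
  proof
    fix l
    have "(\<Sum>n<d k. Em k l (u \<circ> F k n)) / renorm = (\<Sum>n<d k. Em k 0 (u \<circ> F k n)) / renorm"
      using h[of "Suc l"] h[of "Suc 0"] unfolding Em_Suc by (rule trans[OF _ sym])
    then have "(\<Sum>n<d k. Em k l (u \<circ> F k n)) = (\<Sum>n<d k. Em k 0 (u \<circ> F k n))"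
      using renorm_pos by simp
    then have "(\<Sum>n<d k. Em k l (u \<circ> F k n) - Em k 0 (u \<circ> F k n)) = 0" by (simp add: sum_subtractf)
    then show "Em k l (u \<circ> F k n) = Em k 0 (u \<circ> F k n)"
      using n(1) by (subst (asm) sum_nonneg_eq_0_iff) (auto simp: Em_ge_0)
  qed
  have yK: "y \<in> KK" using n(2) V_KK by blast
  have "u x = harm_fun ((u \<circ> F k n) \<circ> q) y" unfolding Suc.IH[OF hF n(2), symmetric] n(3) by simp
  also have "harm_fun ((u \<circ> F k n) \<circ> q) = harm_fun (cell_map n (u \<circ> q))"
    by (rule harm_fun_cong) (use e F_q_V1[OF n(1)] in \<open>simp add: cell_map_def\<close>)
  also have "harm_fun (cell_map n (u \<circ> q)) y = harm_fun (u \<circ> q) x" unfolding n(3) harm_fun_F[OF n(1) yK] ..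
  finally show ?case .
qed

text \<open>\<open>harm\<close> is chosen by \<open>SOME\<close>; this fixes its values on the
  vertices, and graph energies see nothing else.\<close>

lemma harm_VV: assumes "i < 3" "x \<in> VV" shows "harm k i x = harm_fun (unit_bdry i) x"
proof -
  have "harm_fun (unit_bdry i) \<in> domE k \<and> harmonic k (harm_fun (unit_bdry i)) \<and> (\<forall>j<3. harm_fun (unit_bdry i) (q j) = (if i = j then 1 else 0))"
    by (auto simp: domE_iff harm_fun_continuous finite_energy_def Em_harm_fun harmonic_def harm_fun_q unit_bdry_def simp del: q_simps)
  then have "\<exists>h. h \<in> domE k \<and> harmonic k h \<and> (\<forall>j<3. h (q j) = (if i = j then 1 else 0))" by blast
  from someI_ex[OF this] have h: "harmonic k (harm k i)" "\<And>j. j < 3 \<Longrightarrow> harm k i (q j) = (if i = j then 1 else 0)"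
    by (auto simp: harm_def)
  obtain m where "x \<in> V k m" using assms(2) by (auto simp: VV_def)
  from harmonic_unique[OF h(1) this] harm_fun_cong[of "harm k i \<circ> q" "unit_bdry i"] h(2) show ?thesis
    by (simp add: unit_bdry_def del: q_simps)
qed

section \<open>Energies of harmonic functions on cells\<close>

primrec word_map :: "nat list \<Rightarrow> (nat \<Rightarrow> real) \<Rightarrow> nat \<Rightarrow> real" where
  "word_map [] f = f"
| "word_map (n # w) f = word_map w (cell_map n f)"

lemma word_map_append: "word_map (v @ w) f = word_map w (word_map v f)"
  by (induction v arbitrary: f) auto

lemma harm_fun_Fw: "set w \<subseteq> {..<d k} \<Longrightarrow> x \<in> KK \<Longrightarrow> harm_fun f (Fw k w x) = harm_fun (word_map w f) x"
  by (induction w arbitrary: f) (auto simp: harm_fun_F Fw_KK)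

lemma Energy_harm_Fw:
  assumes "i < 3" "set w \<subseteq> {..<d k}"
  shows "Energy k (harm k i \<circ> Fw k w) = ereal (tri_energy_form (word_map w (unit_bdry i)) (word_map w (unit_bdry i)))"
proof (rule Energy_const)
  fix m
  have "Em k m (harm k i \<circ> Fw k w) = Em k m (harm_fun (word_map w (unit_bdry i)))"
  proof (rule Em_cong)
    fix x assume "x \<in> V k m"
    then have "x \<in> VV" "x \<in> KK" using V_VV V_KK by auto
    then show "(harm k i \<circ> Fw k w) x = harm_fun (word_map w (unit_bdry i)) x"
      using harm_VV[OF assms(1)] Fw_VV[OF assms(2)] harm_fun_Fw[OF assms(2)] by simp
  qed
  then show "Em k m (harm k i \<circ> Fw k w) = tri_energy_form (word_map w (unit_bdry i)) (word_map w (unit_bdry i))" by (simp add: Em_harm_fun)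
qed

text \<open>The value that the energy measure of the harmonic function with boundary values f must
  take on the cell of w.\<close>

definition cell_energy :: "(nat \<Rightarrow> real) \<Rightarrow> nat list \<Rightarrow> real" where
  "cell_energy f w = tri_energy_form (word_map w f) (word_map w f) / renorm ^ length w"

lemma cell_energy_nonneg: "cell_energy f w \<ge> 0"
  using renorm_pos by (simp add: cell_energy_def tri_energy_form_nonneg)

lemma cell_energy_Cons: "cell_energy f (n # w) = cell_energy (cell_map n f) w / renorm"
  by (simp add: cell_energy_def mult.commute)

lemma cell_energy_snoc: "(\<Sum>n<d k. cell_energy f (w @ [n])) = cell_energy f w"
  using renorm_pos by (simp add: cell_energy_def word_map_append sum_divide_distrib[symmetric] cell_map_energy)

lemma corner_iter:
  assumes "i < 3"
  shows "word_map (replicate l (corner i)) f i = f i \<and>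
    (\<Sum>j<3. \<bar>word_map (replicate l (corner i)) f j - f i\<bar>) \<le> renorm ^ l * (\<Sum>j<3. \<bar>f j - f i\<bar>)"
proof (induction l arbitrary: f)
  case (Suc l)
  let ?g = "cell_map (corner i) f"
  have g: "?g i = f i" by (rule cell_map_corner[OF assms])
  have "(\<Sum>j<3. \<bar>word_map (replicate l (corner i)) ?g j - ?g i\<bar>) \<le> renorm ^ l * (\<Sum>j<3. \<bar>?g j - ?g i\<bar>)"
    by (rule conjunct2[OF Suc])
  also have "\<dots> \<le> renorm ^ l * (renorm * (\<Sum>j<3. \<bar>f j - f i\<bar>))"
    unfolding g by (rule mult_left_mono[OF corner_contract[OF assms]]) (simp add: less_imp_le[OF renorm_pos])
  finally have "(\<Sum>j<3. \<bar>word_map (replicate l (corner i)) ?g j - f i\<bar>) \<le> renorm ^ Suc l * (\<Sum>j<3. \<bar>f j - f i\<bar>)"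
    by (simp only: g power_Suc mult_ac)
  moreover have "word_map (replicate l (corner i)) ?g i = f i"
  proof -
    have "word_map (replicate l (corner i)) h i = h i" for h using Suc[of h] by (rule conjunct1)
    then show ?thesis by (simp only: g)
  qed
  ultimately show ?case by (simp only: replicate_Suc word_map.simps simp_thms)
qed simp

text \<open>Around a corner the unnormalized energy decays like \<open>r^(2l)\<close>, against a
  normalization of only \<open>r^(-l)\<close>. This is what makes vertices null sets of energy measures.\<close>

lemma cell_energy_corner:
  assumes "i < 3"
  shows "(\<lambda>l. cell_energy f (w @ replicate l (corner i))) \<longlonglongrightarrow> 0"
proof -
  define g where "g = word_map w f"
  define s where "s = (\<Sum>j<3. \<bar>g j - g i\<bar>)"
  have "norm (cell_energy f (w @ replicate l (corner i))) \<le> (3 * s^2 / renorm ^ length w) * renorm ^ l" for l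
  proof -
    define h where "h = word_map (replicate l (corner i)) g"
    have "(\<Sum>j<3. \<bar>h j - g i\<bar>) \<le> renorm ^ l * s"
      unfolding h_def s_def by (rule conjunct2[OF corner_iter[OF assms]])
    then have "(\<Sum>j<3. \<bar>h j - g i\<bar>)^2 \<le> (renorm ^ l * s)^2"
      by (rule power_mono) (simp add: sum_nonneg)
    then have B: "tri_energy_form h h \<le> 3 * (renorm ^ l * s)^2" using tri_energy_form_bound[of h "g i"] by linarith
    have "renorm ^ (length w + l) > 0" using renorm_pos by (rule zero_less_power)
    with B have "tri_energy_form h h / renorm ^ (length w + l) \<le> 3 * (renorm ^ l * s)^2 / renorm ^ (length w + l)"
      by (simp only: divide_right_mono less_imp_le)
    also have "\<dots> = (3 * s^2 / renorm ^ length w) * renorm ^ l"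
    proof -
      have alg: "3 * (a * s)^2 / (b * a) = (3 * s^2 / b) * a" if "a \<noteq> 0" "b \<noteq> 0" for a b :: real
        using that by (simp add: field_simps power2_eq_square)
      show ?thesis unfolding power_add using renorm_pos by (intro alg) auto
    qed
    finally have "cell_energy f (w @ replicate l (corner i)) \<le> (3 * s^2 / renorm ^ length w) * renorm ^ l"
      by (simp only: cell_energy_def word_map_append g_def[symmetric] h_def[symmetric] length_append length_replicate)
    then show ?thesis using cell_energy_nonneg[of f "w @ replicate l (corner i)"] by (simp only: real_norm_def abs_of_nonneg)
  qed
  then have ev: "\<forall>\<^sub>F l in sequentially. norm (cell_energy f (w @ replicate l (corner i))) \<le> (3 * s^2 / renorm ^ length w) * renorm ^ l"
    by (intro always_eventually allI)
  have lim: "(\<lambda>l. (3 * s^2 / renorm ^ length w) * renorm ^ l) \<longlonglongrightarrow> 0"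
    using renorm_pos renorm_less1 by (intro tendsto_mult_right_zero LIMSEQ_power_zero) simp
  show ?thesis by (rule Lim_null_comparison[OF ev lim])
qed

section \<open>Borel measures determined by cells\<close>

abbreviation BK :: "complex measure" where "BK \<equiv> restrict_space borel KK"

abbreviation valid :: "nat list \<Rightarrow> bool" where "valid w \<equiv> set w \<subseteq> {..<d k}"

lemma closed_KK: "closed KK" using compact_KK by (rule compact_imp_closed)

lemma space_BK [simp]: "space BK = KK" by (simp add: space_restrict_space)

lemma sets_BK: "A \<in> sets BK \<longleftrightarrow> A \<subseteq> KK \<and> A \<in> sets borel"
  using closed_KK by (subst sets_restrict_space_iff) auto

lemma cell_sub: "valid w \<Longrightarrow> Fw k w ` KK \<subseteq> KK"
  using Fw_KK by blast

lemma cell_BK: "valid w \<Longrightarrow> Fw k w ` KK \<in> sets BK"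
  unfolding sets_BK using cell_sub borel_closed[OF compact_imp_closed[OF compact_cell]] by simp

lemma cell_diam: "x \<in> Fw k w ` KK \<Longrightarrow> y \<in> Fw k w ` KK \<Longrightarrow> dist x y \<le> diameter KK / real k ^ length w"
  using diameter_bounded_bound[OF compact_imp_bounded[OF compact_KK]] k_pos
  by (auto simp: dist_Fw divide_right_mono)

lemma diam_tendsto: "(\<lambda>m. diameter KK / real k ^ m) \<longlonglongrightarrow> 0"
proof -
  have "(\<lambda>m. diameter KK * (1 / real k) ^ m) \<longlonglongrightarrow> 0"
    by (rule tendsto_mult_right_zero, rule LIMSEQ_power_zero) (use k2 in simp)
  then show ?thesis by (simp add: power_divide)
qed

lemma words_valid: "w \<in> words k m \<Longrightarrow> valid w \<and> length w = m"
  by (simp add: words_def)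

text \<open>Vertex singletons and the empty set are included because they occur as intersections of
  cells; with them the family is intersection stable and the pi-lambda argument applies.\<close>

definition cells :: "complex set set" where
  "cells = {Fw k w ` KK | w. valid w} \<union> {{x} | x. x \<in> VV} \<union> {{}}"

lemma cells_F: "n < d k \<Longrightarrow> A \<in> cells \<Longrightarrow> F k n ` A \<in> cells"
proof -
  assume n: "n < d k" and "A \<in> cells"
  then consider (1) w where "valid w" "A = Fw k w ` KK" | (2) x where "x \<in> VV" "A = {x}" | (3) "A = {}"
    unfolding cells_def by blast
  then show ?thesis
  proof cases
    case 1
    have "F k n ` A = Fw k (n # w) ` KK" unfolding 1 by (simp add: image_comp)
    moreover have "valid (n # w)" using 1 n by simp
    ultimately show ?thesis unfolding cells_def by blast
  next
    case 2
    then have "F k n ` A = {F k n x}" "F k n x \<in> VV" using F_VV n by auto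
    then show ?thesis unfolding cells_def by blast
  qed (simp add: cells_def)
qed

text \<open>A common prefix is stripped by injectivity. Once the first letters differ,
  \<open>overlap\<close> leaves at most one common point, and that is a vertex.\<close>

lemma cells_inter: "valid w \<Longrightarrow> valid w' \<Longrightarrow> Fw k w ` KK \<inter> Fw k w' ` KK \<in> cells"
proof (induction w arbitrary: w')
  case Nil
  then have "Fw k [] ` KK \<inter> Fw k w' ` KK = Fw k w' ` KK" using cell_sub by auto
  then show ?case using Nil unfolding cells_def by blast
next
  case (Cons a u)
  show ?case
  proof (cases w')
    case Nil
    then have "Fw k (a # u) ` KK \<inter> Fw k w' ` KK = Fw k (a # u) ` KK" using cell_sub[OF Cons.prems(1)] by auto
    then show ?thesis using Cons.prems unfolding cells_def by blast
  next
    case w': (Cons b u')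
    have ab: "a < d k" "b < d k" "valid u" "valid u'" using Cons.prems w' by auto
    show ?thesis
    proof (cases "a = b")
      case True
      have "Fw k (a # u) ` KK \<inter> Fw k w' ` KK = F k a ` (Fw k u ` KK \<inter> Fw k u' ` KK)"
        unfolding w' True by (auto simp: image_iff)
      then show ?thesis using cells_F[OF ab(1) Cons.IH[OF ab(3,4)]] by simp
    next
      case False
      show ?thesis
      proof (cases "Fw k (a # u) ` KK \<inter> Fw k w' ` KK = {}")
        case True
        then show ?thesis by (simp add: cells_def)
      next
        case ne: False
        have pt: "\<exists>y z. y \<in> Tri \<and> z \<in> Tri \<and> x = F k a y \<and> F k a y = F k b z"
          if xi: "x \<in> Fw k (a # u) ` KK \<inter> Fw k w' ` KK" for x
        proof -
          from xi obtain y z where "y \<in> KK" "x = F k a (Fw k u y)" "z \<in> KK" "x = F k b (Fw k u' z)"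
            unfolding w' by auto
          moreover have "Fw k u y \<in> Tri" "Fw k u' z \<in> Tri"
            using Fw_KK ab(3,4) calculation(1,3) KK_Tri by blast+
          ultimately show ?thesis by metis
        qed
        from ne obtain x where x: "x \<in> Fw k (a # u) ` KK \<inter> Fw k w' ` KK" by blast
        obtain y z where y: "y \<in> Tri" "z \<in> Tri" "x = F k a y" "F k a y = F k b z" using pt[OF x] by blast
        have "y \<in> V0" using overlap(2)[OF ab(1,2) False y(1,2,4)] .
        then have "x \<in> VV" using y(3) F_VV ab(1) V0_VV by blast
        moreover have "x' = x" if xi: "x' \<in> Fw k (a # u) ` KK \<inter> Fw k w' ` KK" for x'
        proof -
          obtain y' z' where y': "y' \<in> Tri" "z' \<in> Tri" "x' = F k a y'" "F k a y' = F k b z'" using pt[OF xi] by blast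
          show ?thesis unfolding y(3) y'(3)
            using overlap(1)[OF ab(1,2) False y(1,2,4)] overlap(1)[OF ab(1,2) False y'(1,2,4)]
            by (intro coord_eqI) linarith+
        qed
        ultimately have "Fw k (a # u) ` KK \<inter> Fw k w' ` KK = {x}" using x by blast
        then show ?thesis using \<open>x \<in> VV\<close> unfolding cells_def by blast
      qed
    qed
  qed
qed

lemma Int_stable_cells: "Int_stable cells"
proof (rule Int_stableI)
  fix A B assume A: "A \<in> cells" and B: "B \<in> cells"
  show "A \<inter> B \<in> cells"
  proof (cases "\<exists>w w'. valid w \<and> valid w' \<and> A = Fw k w ` KK \<and> B = Fw k w' ` KK")
    case True then show ?thesis using cells_inter by blast
  next
    case False
    then have "A = {} \<or> B = {} \<or> (\<exists>x\<in>VV. A = {x}) \<or> (\<exists>x\<in>VV. B = {x})" using A B unfolding cells_def by blast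
    then have "A \<inter> B = {} \<or> A \<inter> B = A \<or> A \<inter> B = B" by blast
    moreover have "{} \<in> cells" by (simp add: cells_def)
    ultimately show ?thesis using A B by auto
  qed
qed

lemma cells_Pow: "cells \<subseteq> Pow KK"
  unfolding cells_def using cell_sub VV_KK by blast

text \<open>Cell diameters tend to zero, so the trace on the attractor of an open set is the union
  of the cells inside it, and there are only countably many words.\<close>

lemma sets_BK_cells: "sets BK = sigma_sets KK cells"
proof
  have "cells \<subseteq> sets BK"
    using cell_BK VV_KK by (auto simp: cells_def sets_BK)
  then show "sigma_sets KK cells \<subseteq> sets BK" using sets.sigma_sets_subset[of cells BK] by simp
  have "(\<lambda>x. x) \<in> borel_measurable (sigma KK cells)"
  proof (rule borel_measurableI)
    fix B :: "complex set" assume B: "open B"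
    have "(\<lambda>x. x) -` B \<inter> space (sigma KK cells) = (\<Union>w\<in>{w. valid w \<and> Fw k w ` KK \<subseteq> B}. Fw k w ` KK)"
    proof
      show "(\<lambda>x. x) -` B \<inter> space (sigma KK cells) \<subseteq> (\<Union>w\<in>{w. valid w \<and> Fw k w ` KK \<subseteq> B}. Fw k w ` KK)"
      proof
        fix x assume "x \<in> (\<lambda>x. x) -` B \<inter> space (sigma KK cells)"
        then have x: "x \<in> B" "x \<in> KK" using cells_Pow by auto
        obtain e where e: "e > 0" "ball x e \<subseteq> B" using B x(1) open_contains_ball by blast
        obtain m where m: "diameter KK / real k ^ m < e"
          using order_tendstoD(2)[OF diam_tendsto e(1)] by (auto simp: eventually_sequentially)
        obtain w where w: "w \<in> words k m" "x \<in> Fw k w ` KK" using x(2) KK_words[of m] by blast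
        have "Fw k w ` KK \<subseteq> B"
        proof
          fix y assume "y \<in> Fw k w ` KK"
          then have "dist x y < e" using cell_diam[OF w(2)] m words_valid[OF w(1)] by fastforce
          then show "y \<in> B" using e(2) by auto
        qed
        then show "x \<in> (\<Union>w\<in>{w. valid w \<and> Fw k w ` KK \<subseteq> B}. Fw k w ` KK)"
          using w words_valid by blast
      qed
      show "(\<Union>w\<in>{w. valid w \<and> Fw k w ` KK \<subseteq> B}. Fw k w ` KK) \<subseteq> (\<lambda>x. x) -` B \<inter> space (sigma KK cells)"
        using cell_sub cells_Pow by fastforce
    qed
    moreover have "(\<Union>w\<in>{w. valid w \<and> Fw k w ` KK \<subseteq> B}. Fw k w ` KK) \<in> sets (sigma KK cells)"
    proof (rule sets.countable_UN'')
      fix w assume "w \<in> {w. valid w \<and> Fw k w ` KK \<subseteq> B}"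
      then have "Fw k w ` KK \<in> cells" unfolding cells_def by blast
      then show "Fw k w ` KK \<in> sets (sigma KK cells)" using cells_Pow by (simp add: sets_measure_of)
    qed (rule countable_subset[OF subset_UNIV], simp)
    ultimately show "(\<lambda>x. x) -` B \<inter> space (sigma KK cells) \<in> sets (sigma KK cells)" by simp
  qed
  note id = this
  show "sets BK \<subseteq> sigma_sets KK cells"
  proof
    fix A assume "A \<in> sets BK"
    then have A: "A \<subseteq> KK" "A \<in> sets borel" by (auto simp: sets_BK)
    from measurable_sets[OF id A(2)] show "A \<in> sigma_sets KK cells"
      using A(1) cells_Pow by (simp add: sets_measure_of space_measure_of inf.absorb1)
  qed
qed

text \<open>Signed coefficients are needed because the entries of \<open>M_n\<close> may be negative.\<close>

lemma signed_unique:
  fixes M :: "'i \<Rightarrow> complex measure" and c :: "'i \<Rightarrow> real"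
  assumes I: "finite I" and M: "\<And>i. i \<in> I \<Longrightarrow> finite_measure (M i)" "\<And>i. i \<in> I \<Longrightarrow> sets (M i) = sets BK"
    and cell: "\<And>w. valid w \<Longrightarrow> (\<Sum>i\<in>I. c i * measure (M i) (Fw k w ` KK)) = 0"
    and vert: "\<And>x. x \<in> VV \<Longrightarrow> (\<Sum>i\<in>I. c i * measure (M i) {x}) = 0"
    and A: "A \<in> sets BK"
  shows "(\<Sum>i\<in>I. c i * measure (M i) A) = 0"
proof -
  have sp: "space (M i) = KK" if "i \<in> I" for i using sets_eq_imp_space_eq[OF M(2)[OF that]] by simp
  have "A \<in> sigma_sets KK cells" using A sets_BK_cells by simp
  with Int_stable_cells cells_Pow show ?thesis
  proof (induction rule: sigma_sets_induct_disjoint)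
    case (basic A)
    then consider w where "valid w" "A = Fw k w ` KK" | x where "x \<in> VV" "A = {x}" | "A = {}"
      unfolding cells_def by blast
    then show ?case using cell vert by cases auto
  next
    case empty then show ?case by simp
  next
    case (compl A)
    have "measure (M i) (KK - A) = measure (M i) KK - measure (M i) A" if "i \<in> I" for i
      using finite_measure.finite_measure_compl[OF M(1)[OF that], of A] sp[OF that] M(2)[OF that] compl(1) sets_BK_cells
      by simp
    then have "(\<Sum>i\<in>I. c i * measure (M i) (KK - A)) = (\<Sum>i\<in>I. c i * measure (M i) KK) - (\<Sum>i\<in>I. c i * measure (M i) A)"
      by (simp add: right_diff_distrib sum_subtractf)
    then show ?case using cell[of "[]"] compl(2) by simp
  next
    case (union A)
    have "(\<lambda>n. \<Sum>i\<in>I. c i * measure (M i) (A n)) sums (\<Sum>i\<in>I. c i * measure (M i) (\<Union>n. A n))"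
    proof (intro sums_sum sums_mult)
      fix i assume i: "i \<in> I"
      show "(\<lambda>n. measure (M i) (A n)) sums measure (M i) (\<Union>n. A n)"
        by (rule finite_measure.finite_measure_UNION[OF M(1)[OF i]])
          (use union M(2)[OF i] sets_BK_cells in auto)
    qed
    moreover have "(\<lambda>n. \<Sum>i\<in>I. c i * measure (M i) (A n)) = (\<lambda>n. 0)" using union(3) by (simp add: fun_eq_iff)
    ultimately show ?case using sums_unique2[OF _ sums_zero] by metis
  qed
qed

end

section \<open>Construction of measures from cell weights\<close>

lemma step_interval:
  fixes s :: "nat \<Rightarrow> real"
  assumes "s 0 \<le> t" "t < s N"
  shows "\<exists>n<N. s n \<le> t \<and> t < s (Suc n)"
  using assms
proof (induction N)
  case (Suc N)
  show ?case
  proof (cases "t < s N")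
    case True
    then obtain n where "n < N" "s n \<le> t \<and> t < s (Suc n)" using Suc by blast
    then show ?thesis using less_SucI by blast
  next
    case False
    then show ?thesis using Suc.prems(2) by (intro exI[of _ N]) simp
  qed
qed simp

lemma step_interval_unique:
  fixes s :: "nat \<Rightarrow> real"
  assumes "incseq s" "s n \<le> t" "t < s (Suc n)" "s n' \<le> t" "t < s (Suc n')"
  shows "n = n'"
proof (rule ccontr)
  assume "n \<noteq> n'"
  then consider "Suc n \<le> n'" | "Suc n' \<le> n" by linarith
  then show False
  proof cases
    case 1 then have "s (Suc n) \<le> s n'" using assms(1) by (simp add: incseq_def)
    then show ?thesis using assms by simp
  next
    case 2 then have "s (Suc n') \<le> s n" using assms(1) by (simp add: incseq_def)
    then show ?thesis using assms by simp
  qed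
qed

text \<open>The data needed to build a measure from its cell values. The limit condition excludes
  atoms at vertices, which belong to several cells.\<close>

locale cell_weight = gasket +
  fixes m :: "nat list \<Rightarrow> real"
  assumes m_nonneg: "m w \<ge> 0"
    and m_sum: "(\<Sum>n<d k. m (w @ [n])) = m w"
    and m_corner: "i < 3 \<Longrightarrow> (\<lambda>l. m (w @ replicate l (corner i))) \<longlonglongrightarrow> 0"
begin

text \<open>Words are stored in reverse here, so that refining a cell is a cons.\<close>

primrec left_end :: "nat list \<Rightarrow> real" where
  "left_end [] = 0"
| "left_end (n # u) = left_end u + (\<Sum>i<n. m (rev (i # u)))"

text \<open>Nested pieces of \<open>word_interval []\<close> ordered like the words, each as long as
  the weight of its cell. They are half-open so that pieces of one level are disjoint.\<close>

definition word_interval :: "nat list \<Rightarrow> real set" where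
  "word_interval u = {left_end u ..< left_end u + m (rev u)}"

lemma word_interval_child: "n < d k \<Longrightarrow> word_interval (n # u) \<subseteq> word_interval u"
proof -
  assume n: "n < d k"
  have "(\<Sum>i<Suc n. m (rev (i # u))) \<le> (\<Sum>i<d k. m (rev (i # u)))"
    using n by (intro sum_mono2) (auto simp: m_nonneg)
  then have "(\<Sum>i<n. m (rev (i # u))) + m (rev (n # u)) \<le> m (rev u)" by (simp add: m_sum)
  moreover have "0 \<le> (\<Sum>i<n. m (rev (i # u)))" by (simp add: m_nonneg sum_nonneg)
  ultimately show ?thesis unfolding word_interval_def by auto
qed

lemma word_interval_ex: assumes "t \<in> word_interval u" shows "\<exists>n<d k. t \<in> word_interval (n # u)"
proof -
  let ?s = "\<lambda>n. left_end u + (\<Sum>i<n. m (rev (i # u)))"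
  have "?s 0 \<le> t" "t < ?s (d k)" using assms by (auto simp: word_interval_def m_sum)
  from step_interval[OF this] show ?thesis by (simp add: word_interval_def add.assoc)
qed

lemma word_interval_unique: assumes "t \<in> word_interval (n # u)" "t \<in> word_interval (n' # u)" shows "n = n'"
proof (rule step_interval_unique)
  let ?s = "\<lambda>n. left_end u + (\<Sum>i<n. m (rev (i # u)))"
  show "incseq ?s" by (rule incseq_SucI) (simp add: m_nonneg)
  show "?s n \<le> t" "t < ?s (Suc n)" "?s n' \<le> t" "t < ?s (Suc n')"
    using assms by (auto simp: word_interval_def add.assoc)
qed

text \<open>The reversed address of t, one letter per level; on \<open>word_interval []\<close> the
  letter exists and is unique.\<close>

primrec code :: "real \<Rightarrow> nat \<Rightarrow> nat list" where
  "code t 0 = []"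
| "code t (Suc l) = (SOME n. n < d k \<and> t \<in> word_interval (n # code t l)) # code t l"

lemma code_word_interval: assumes "t \<in> word_interval []" shows "t \<in> word_interval (code t l) \<and> valid (code t l) \<and> length (code t l) = l"
proof (induction l)
  case (Suc l)
  have "\<exists>n. n < d k \<and> t \<in> word_interval (n # code t l)" using word_interval_ex Suc by blast
  from someI_ex[OF this] Suc show ?case by simp
qed (use assms in simp)

lemma code_unique: "valid u \<Longrightarrow> t \<in> word_interval u \<Longrightarrow> code t (length u) = u"
proof (induction u)
  case (Cons n u)
  have n: "n < d k" "valid u" using Cons.prems by auto
  have "t \<in> word_interval u" using word_interval_child[OF n(1)] Cons.prems(2) by blast
  then have c: "code t (length u) = u" using Cons.IH n(2) by blast
  have "(SOME n. n < d k \<and> t \<in> word_interval (n # u)) = n"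
    using n(1) Cons.prems(2) word_interval_unique by (intro some_equality) auto
  then show ?case by (simp add: c)
qed simp

lemma word_interval_root: "valid u \<Longrightarrow> word_interval u \<subseteq> word_interval []"
proof (induction u)
  case (Cons n u)
  then show ?case using word_interval_child[of n u] by auto
qed simp

lemma code_add: "\<exists>v. code t (l + l') = v @ code t l \<and> length v = l'"
proof (induction l')
  case (Suc l')
  then obtain v where "code t (l + l') = v @ code t l" "length v = l'" by blast
  then show ?case by (intro exI[of _ "(SOME n. n < d k \<and> t \<in> word_interval (n # code t (l + l'))) # v"]) simp
qed simp

abbreviation cell_at :: "real \<Rightarrow> nat \<Rightarrow> complex set" where
  "cell_at t l \<equiv> Fw k (rev (code t l)) ` KK"

lemma cell_at_antimono: assumes "t \<in> word_interval []" "l \<le> l'" shows "cell_at t l' \<subseteq> cell_at t l"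
proof -
  obtain e where e: "l' = l + e" using assms(2) le_Suc_ex by blast
  obtain v where v: "code t l' = v @ code t l" using code_add e by blast
  have "valid v" using code_word_interval[OF assms(1), of l'] v by auto
  then have "Fw k (rev v) ` KK \<subseteq> KK" by (intro cell_sub) simp
  then have "Fw k (rev (code t l)) ` Fw k (rev v) ` KK \<subseteq> cell_at t l" by (rule image_mono)
  then show ?thesis unfolding v rev_append Fw_append image_comp by simp
qed

text \<open>The coding map: nested compact cells along the address of t have a common point. The
  measure sought is the image of Lebesgue measure under this map.\<close>

definition point :: "real \<Rightarrow> complex" where
  "point t = (SOME x. \<forall>l. x \<in> cell_at t l)"

lemma point: assumes "t \<in> word_interval []" shows "point t \<in> cell_at t l"
proof -
  have "\<Inter> (range (cell_at t)) \<noteq> {}"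
    using compact_cell KK_ne cell_at_antimono[OF assms] by (intro compact_nest) auto
  then have "\<exists>x. \<forall>l. x \<in> cell_at t l" by blast
  from someI_ex[OF this] show ?thesis by (simp add: point_def)
qed

lemma point_KK: "t \<in> word_interval [] \<Longrightarrow> point t \<in> KK"
  using point[of t 0] by simp

abbreviation LJ :: "real measure" where "LJ \<equiv> restrict_space lborel (word_interval [])"

lemma word_interval_borel [measurable]: "word_interval u \<in> sets borel" by (simp add: word_interval_def)

lemma emeasure_word_interval: "emeasure lborel (word_interval u) = ennreal (m (rev u))"
  by (simp add: word_interval_def m_nonneg)

text \<open>At level l the point is approximated by the image of 0 in the cell at t, a finite sum of
  indicators of intervals. The error is at most the diameter of that cell.\<close>

lemma point_measurable: "point \<in> measurable LJ BK"
proof -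
  have "point \<in> borel_measurable LJ"
  proof (rule borel_measurable_LIMSEQ_metric)
    fix l
    have "(\<lambda>t. \<Sum>w\<in>words k l. indicat_real (word_interval (rev w)) t *\<^sub>R Fw k w 0) \<in> borel_measurable LJ"
      by (rule measurable_restrict_space1) measurable
    moreover have "(\<Sum>w\<in>words k l. indicat_real (word_interval (rev w)) t *\<^sub>R Fw k w 0) = Fw k (rev (code t l)) 0"
      if "t \<in> word_interval []" for t
    proof -
      let ?w = "rev (code t l)"
      note c = code_word_interval[OF that, of l]
      have w: "?w \<in> words k l" using c by (simp add: words_def)
      have "(\<Sum>w\<in>words k l. indicat_real (word_interval (rev w)) t *\<^sub>R Fw k w 0)
          = (\<Sum>w\<in>{?w}. indicat_real (word_interval (rev w)) t *\<^sub>R Fw k w 0)"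
      proof (rule sum.mono_neutral_right)
        show "\<forall>w\<in>words k l - {?w}. indicat_real (word_interval (rev w)) t *\<^sub>R Fw k w 0 = 0"
        proof
          fix w assume "w \<in> words k l - {?w}"
          then have w: "valid (rev w)" "length (rev w) = l" "w \<noteq> ?w" by (auto simp: words_def)
          have "t \<notin> word_interval (rev w)" using code_unique[OF w(1)] w(2,3) by (metis rev_rev_ident)
          then show "indicat_real (word_interval (rev w)) t *\<^sub>R Fw k w 0 = 0" by simp
        qed
      qed (use w in auto)
      then show ?thesis using c by simp
    qed
    ultimately show "(\<lambda>t. Fw k (rev (code t l)) 0) \<in> borel_measurable LJ"
      by (subst measurable_cong[where g = "\<lambda>t. \<Sum>w\<in>words k l. indicat_real (word_interval (rev w)) t *\<^sub>R Fw k w 0"])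
        (auto simp: space_restrict_space)
  next
    fix t assume "t \<in> space LJ"
    then have t: "t \<in> word_interval []" by (simp add: space_restrict_space)
    have "0 \<in> KK" using q_KK[of 0] by simp
    then have "dist (Fw k (rev (code t l)) 0) (point t) \<le> diameter KK / real k ^ l" for l
      using cell_diam[OF imageI point[OF t]] code_word_interval[OF t, of l] by (metis length_rev)
    then have "\<forall>\<^sub>F l in sequentially. norm (dist (Fw k (rev (code t l)) 0) (point t)) \<le> diameter KK / real k ^ l"
      by (intro always_eventually allI) simp
    from Lim_null_comparison[OF this diam_tendsto]
    show "(\<lambda>l. Fw k (rev (code t l)) 0) \<longlonglongrightarrow> point t" by (simp add: tendsto_dist_iff[symmetric])
  qed
  then show ?thesis
    by (intro measurable_restrict_space2) (auto simp: space_restrict_space point_KK)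
qed

text \<open>By \<open>corner_word\<close>, a parameter in the interval of w that codes the vertex
  \<open>Fw k w (q i)\<close> continues with the corner letter forever, so it lies in intervals
  whose lengths tend to zero.\<close>

lemma corner_null:
  assumes "valid w" "i < 3"
  shows "AE t in lborel. t \<in> word_interval (rev w) \<longrightarrow> point t \<noteq> Fw k w (q i)"
proof -
  let ?Z = "\<Inter>l. word_interval (rev (w @ replicate l (corner i)))"
  have "emeasure lborel ?Z \<le> ennreal (m (w @ replicate l (corner i)))" for l
  proof -
    have "emeasure lborel ?Z \<le> emeasure lborel (word_interval (rev (w @ replicate l (corner i))))"
      by (intro emeasure_mono) auto
    then show ?thesis by (simp add: emeasure_word_interval)
  qed
  moreover have "(\<lambda>l. ennreal (m (w @ replicate l (corner i)))) \<longlonglongrightarrow> ennreal 0"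
    by (intro tendsto_ennrealI m_corner assms)
  ultimately have "emeasure lborel ?Z \<le> ennreal 0"
    by (intro LIMSEQ_le_const[of _ "ennreal 0"]) auto
  then have "emeasure lborel ?Z = 0" by simp
  then have "?Z \<in> null_sets lborel" by (intro null_setsI) auto
  then have "AE t in lborel. t \<notin> ?Z" by (rule AE_not_in)
  then show ?thesis
  proof (rule AE_mp, intro AE_I2 impI)
    fix t assume tZ: "t \<notin> ?Z" and tJ: "t \<in> word_interval (rev w)"
    show "point t \<noteq> Fw k w (q i)"
    proof
      assume eq: "point t = Fw k w (q i)"
      have root: "t \<in> word_interval []" using word_interval_root[of "rev w"] assms(1) tJ by auto
      have c: "code t (length w) = rev w" using code_unique[of "rev w" t] assms(1) tJ by simp
      have "t \<in> word_interval (rev (w @ replicate l (corner i)))" for l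
      proof -
        obtain v where v: "code t (length w + l) = v @ rev w" "length v = l" using code_add[of t "length w" l] c by auto
        have cv: "t \<in> word_interval (v @ rev w)" "valid v" using code_word_interval[OF root, of "length w + l"] v by auto
        have "point t \<in> cell_at t (length w + l)" by (rule point[OF root])
        then obtain x where x: "x \<in> KK" "point t = Fw k (w @ rev v) x" unfolding v by auto
        then have "Fw k (rev v) x = q i" using eq by (simp add: Fw_append)
        then have "rev v = replicate l (corner i)"
          using corner_word(1)[OF assms(2), of "rev v" x] cv(2) x(1) v(2) by simp
        then show ?thesis using cv(1) by (metis rev_append rev_rev_ident)
      qed
      then show False using tZ by blast
    qed
  qed
qed

text \<open>The preimage of a cell contains its interval. Any further parameter codes a point shared
  with another cell of the same level, hence a vertex of the cell of its own address, and
  \<open>corner_null\<close> discards these.\<close>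

lemma emeasure_point_cell:
  assumes "valid w"
  shows "emeasure (distr LJ BK point) (Fw k w ` KK) = ennreal (m w)"
proof -
  let ?A = "point -` (Fw k w ` KK) \<inter> word_interval []"
  have sp: "space LJ = word_interval []" by (simp add: space_restrict_space)
  have A: "?A \<in> sets LJ" using measurable_sets[OF point_measurable cell_BK[OF assms]] unfolding sp .
  then have Ab: "?A \<in> sets borel" by (subst (asm) sets_restrict_space_iff) auto
  have "emeasure (distr LJ BK point) (Fw k w ` KK) = emeasure LJ ?A"
    using emeasure_distr[OF point_measurable cell_BK[OF assms]] unfolding sp .
  also have "\<dots> = emeasure lborel ?A" by (rule emeasure_restrict_space) auto
  also have "\<dots> = emeasure lborel (word_interval (rev w))"
  proof (rule emeasure_eq_AE)
    have "AE t in lborel. \<forall>w'\<in>words k (length w). \<forall>i\<in>{..<3}. t \<in> word_interval (rev w') \<longrightarrow> point t \<noteq> Fw k w' (q i)"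
      by (intro AE_finite_allI finite_words corner_null) (auto simp: words_def)
    then show "AE t in lborel. t \<in> ?A \<longleftrightarrow> t \<in> word_interval (rev w)"
    proof (rule AE_mp, intro AE_I2 impI)
      fix t assume nz: "\<forall>w'\<in>words k (length w). \<forall>i\<in>{..<3}. t \<in> word_interval (rev w') \<longrightarrow> point t \<noteq> Fw k w' (q i)"
      show "t \<in> ?A \<longleftrightarrow> t \<in> word_interval (rev w)"
      proof
        assume "t \<in> word_interval (rev w)"
        moreover from this have "t \<in> word_interval []" using word_interval_root[of "rev w"] assms by auto
        moreover have "code t (length w) = rev w" using code_unique[of "rev w" t] assms calculation by simp
        ultimately show "t \<in> ?A" using point[of t "length w"] by simp
      next
        assume t: "t \<in> ?A"
        define w' where "w' = rev (code t (length w))"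
        have w': "valid w'" "length w' = length w" "t \<in> word_interval (rev w')" using t code_word_interval[of t "length w"] by (auto simp: w'_def)
        obtain x where x: "x \<in> KK" "point t = Fw k w' x" using point[of t "length w"] t by (auto simp: w'_def)
        obtain y where y: "y \<in> KK" "point t = Fw k w y" using t by auto
        have "w' = w"
        proof (rule ccontr)
          assume "w' \<noteq> w"
          then have "x \<in> V0" using cell_inter[OF w'(2) _ w'(1) assms x(1) y(1)] x y by simp
          then obtain i where "i < 3" "x = q i" by (rule V0E)
          moreover have "w' \<in> words k (length w)" using w' by (simp add: words_def)
          ultimately show False using nz x(2) w'(3) by auto
        qed
        then show "t \<in> word_interval (rev w)" using w'(3) by simp
      qed
    qed
  qed (use Ab in auto)
  finally show ?thesis by (simp add: emeasure_word_interval)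
qed

lemma measure_ex: "\<exists>\<mu>. sets \<mu> = sets BK \<and> (\<forall>w. valid w \<longrightarrow> emeasure \<mu> (Fw k w ` KK) = ennreal (m w))"
  by (intro exI[of _ "distr LJ BK point"] conjI allI impI emeasure_point_cell) simp

end

context gasket begin

section \<open>Energy measures and the Kusuoka measure\<close>

abbreviation nu :: "nat \<Rightarrow> complex measure" where "nu i \<equiv> energy_measure k (harm k i)"
abbreviation kus :: "complex measure" where "kus \<equiv> kusuoka k"

lemma nu_spec:
  assumes "i < 3"
  shows "sets (nu i) = sets BK" "\<And>w. valid w \<Longrightarrow> emeasure (nu i) (Fw k w ` KK) = ennreal (cell_energy (unit_bdry i) w)"
proof -
  interpret cell_weight k "cell_energy (unit_bdry i)"
    by unfold_locales (rule cell_energy_nonneg cell_energy_snoc cell_energy_corner, assumption?)+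
  have eq: "ennreal (real_of_ereal (Energy k (harm k i \<circ> Fw k w)) / rk k ^ length w) = ennreal (cell_energy (unit_bdry i) w)"
    if "valid w" for w
    using Energy_harm_Fw[OF assms that] by (simp add: cell_energy_def rk_eq)
  have "\<exists>\<mu>. sets \<mu> = sets (restrict_space borel (K k)) \<and>
     (\<forall>w. valid w \<longrightarrow> emeasure \<mu> (Fw k w ` K k) =
          ennreal (real_of_ereal (Energy k (harm k i \<circ> Fw k w)) / rk k ^ length w))"
    using measure_ex by (simp add: K_eq eq cong: imp_cong)
  from someI_ex[OF this]
  have *: "sets (nu i) = sets BK \<and> (\<forall>w. valid w \<longrightarrow> emeasure (nu i) (Fw k w ` KK) =
     ennreal (real_of_ereal (Energy k (harm k i \<circ> Fw k w)) / rk k ^ length w))"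
    unfolding energy_measure_def K_eq .
  then show "sets (nu i) = sets BK" "\<And>w. valid w \<Longrightarrow> emeasure (nu i) (Fw k w ` KK) = ennreal (cell_energy (unit_bdry i) w)"
    by (auto simp: eq)
qed

lemma weight_finite_measure:
  assumes "sets M = sets BK" "emeasure M KK = ennreal c"
  shows "finite_measure M"
  using assms sets_eq_imp_space_eq[OF assms(1)] by (intro finite_measureI) simp

text \<open>A vertex lies in all the cells that continue its word with the corner letter, and their
  measures tend to zero.\<close>

lemma vertex_null:
  assumes M: "sets M = sets BK" "\<And>w. valid w \<Longrightarrow> emeasure M (Fw k w ` KK) = ennreal (g w)"
    and g: "\<And>i w. i < 3 \<Longrightarrow> (\<lambda>l. g (w @ replicate l (corner i))) \<longlonglongrightarrow> 0"
    and x: "x \<in> VV"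
  shows "emeasure M {x} = 0"
proof -
  obtain m where "x \<in> V k m" using x by (auto simp: VV_def)
  then obtain w i where w: "valid w" "i < 3" "x = Fw k w (q i)"
    by (auto simp: V_def words_def elim!: V0E)
  have "Fw k (replicate l (corner i)) (q i) = q i" for l
    by (induction l) (simp_all add: corner(2)[OF w(2)])
  then have "x \<in> Fw k (w @ replicate l (corner i)) ` KK" for l
    using w(3) q_KK[OF w(2)] by (intro image_eqI[of _ _ "q i"]) (simp_all add: Fw_append)
  moreover have v: "valid (w @ replicate l (corner i))" for l using w(1) corner(1)[OF w(2)] by auto
  ultimately have "emeasure M {x} \<le> ennreal (g (w @ replicate l (corner i)))" for l
    unfolding M(2)[OF v, symmetric] using M(1) cell_BK[OF v] by (intro emeasure_mono) auto
  moreover have "(\<lambda>l. ennreal (g (w @ replicate l (corner i)))) \<longlonglongrightarrow> ennreal 0"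
    by (intro tendsto_ennrealI g w)
  ultimately have "emeasure M {x} \<le> ennreal 0"
    by (intro LIMSEQ_le_const[of _ "ennreal 0"]) auto
  then show ?thesis by simp
qed

lemma nu_finite: "i < 3 \<Longrightarrow> finite_measure (nu i)"
  using nu_spec(2)[of i "[]"] by (intro weight_finite_measure[OF nu_spec(1)]) auto

lemma nu_cell: "i < 3 \<Longrightarrow> valid w \<Longrightarrow> measure (nu i) (Fw k w ` KK) = cell_energy (unit_bdry i) w"
  by (simp add: measure_def nu_spec cell_energy_nonneg)

lemma nu_vertex: "i < 3 \<Longrightarrow> x \<in> VV \<Longrightarrow> emeasure (nu i) {x} = 0"
  using nu_spec cell_energy_corner by (intro vertex_null[of _ "cell_energy (unit_bdry i)"]) auto

lemma nu_vertex_measure: "i < 3 \<Longrightarrow> x \<in> VV \<Longrightarrow> measure (nu i) {x} = 0"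
  by (simp add: measure_def nu_vertex)

text \<open>A witness for the choice in \<open>kusuoka\<close>: the construction is run with the
  summed weights, and \<open>signed_unique\<close> identifies the result with the sum of the three
  measures.\<close>

lemma sum_measure_ex:
  "\<exists>\<mu>. sets \<mu> = sets BK \<and> (\<forall>A\<in>sets \<mu>. emeasure \<mu> A = (\<Sum>i<3. emeasure (nu i) A))"
proof -
  let ?g = "\<lambda>w. \<Sum>i<3. cell_energy (unit_bdry i) w"
  interpret cell_weight k ?g
  proof unfold_locales
    show "0 \<le> ?g w" for w by (intro sum_nonneg cell_energy_nonneg)
    show "(\<Sum>n<d k. ?g (w @ [n])) = ?g w" for w
      by (subst sum.swap) (simp only: cell_energy_snoc)
    show "(\<lambda>l. ?g (w @ replicate l (corner i))) \<longlonglongrightarrow> 0" if "i < 3" for i w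
      by (intro tendsto_null_sum cell_energy_corner that)
  qed
  obtain \<mu> where \<mu>: "sets \<mu> = sets BK" "\<And>w. valid w \<Longrightarrow> emeasure \<mu> (Fw k w ` KK) = ennreal (?g w)"
    using measure_ex by blast
  have fin: "finite_measure \<mu>" using \<mu>(2)[of "[]"] by (intro weight_finite_measure[OF \<mu>(1)]) auto
  have vert: "emeasure \<mu> {x} = 0" if "x \<in> VV" for x
    using \<mu> m_corner that by (intro vertex_null[of _ ?g]) auto
  \<comment> \<open>Index 3 carries the new measure with coefficient -1, so a vanishing signed sum
    is the desired equality.\<close>
  let ?M = "\<lambda>i::nat. if i < 3 then nu i else \<mu>" let ?c = "\<lambda>i::nat. if i < 3 then 1 else - 1 :: real"
  have split: "(\<Sum>i<4. ?c i * measure (?M i) A) = (\<Sum>i<3. measure (nu i) A) - measure \<mu> A" for A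
    by (simp add: numeral_eq_Suc)
  have "measure \<mu> A = (\<Sum>i<3. measure (nu i) A)" if "A \<in> sets BK" for A
  proof -
    have "(\<Sum>i<4. ?c i * measure (?M i) A) = 0"
    proof (rule signed_unique[OF _ _ _ _ _ that])
      show "finite_measure (?M i)" "sets (?M i) = sets BK" for i
        using fin \<mu>(1) nu_finite nu_spec(1) by auto
      fix w :: "nat list" assume "valid w"
      then show "(\<Sum>i<4. ?c i * measure (?M i) (Fw k w ` KK)) = 0"
        unfolding split using m_nonneg[of w] by (simp add: nu_cell measure_def[of \<mu>] \<mu>(2))
    next
      fix x assume "x \<in> VV"
      then show "(\<Sum>i<4. ?c i * measure (?M i) {x}) = 0"
        unfolding split by (simp add: nu_vertex_measure measure_def[of \<mu>] vert)
    qed simp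
    then show ?thesis unfolding split by simp
  qed
  then have "emeasure \<mu> A = (\<Sum>i<3. emeasure (nu i) A)" if "A \<in> sets \<mu>" for A
    using that \<mu>(1) finite_measure.emeasure_eq_measure[OF fin] finite_measure.emeasure_eq_measure[OF nu_finite]
    by simp
  then show ?thesis using \<mu>(1) by blast
qed

lemma kus_spec: "sets kus = sets BK" "\<And>A. A \<in> sets BK \<Longrightarrow> emeasure kus A = (\<Sum>i<3. emeasure (nu i) A)"
proof -
  have "\<exists>\<mu>. sets \<mu> = sets (restrict_space borel (K k)) \<and> (\<forall>A\<in>sets \<mu>. emeasure \<mu> A = (\<Sum>i<3. emeasure (nu i) A))"
    using sum_measure_ex unfolding K_eq .
  from someI_ex[OF this] have "sets kus = sets BK \<and> (\<forall>A\<in>sets kus. emeasure kus A = (\<Sum>i<3. emeasure (nu i) A))"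
    unfolding kusuoka_def K_eq .
  then show "sets kus = sets BK" "\<And>A. A \<in> sets BK \<Longrightarrow> emeasure kus A = (\<Sum>i<3. emeasure (nu i) A)"
    by auto
qed

lemma space_kus [simp]: "space kus = KK"
  using sets_eq_imp_space_eq[OF kus_spec(1)] by simp

lemma kus_measurable: "measurable kus N = measurable BK N"
  by (rule measurable_cong_sets[OF kus_spec(1) refl])

lemma kus_finite: "finite_measure kus"
proof (rule finite_measureI)
  have "KK \<in> sets BK" using cell_BK[of "[]"] by simp
  then show "emeasure kus (space kus) \<noteq> \<infinity>"
    using finite_measure.emeasure_eq_measure[OF nu_finite] by (simp add: kus_spec(2))
qed

lemma measure_kus: assumes "A \<in> sets BK" shows "measure kus A = (\<Sum>i<3. measure (nu i) A)"
proof -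
  have "ennreal (measure kus A) = ennreal (\<Sum>i<3. measure (nu i) A)"
    using kus_spec(2)[OF assms] finite_measure.emeasure_eq_measure[OF kus_finite]
      finite_measure.emeasure_eq_measure[OF nu_finite] by simp
  then show ?thesis by (simp add: sum_nonneg)
qed

text \<open>Being a summand of the Kusuoka measure makes \<open>nu i\<close> absolutely continuous.
  Its finiteness makes the derivative finite almost everywhere, so \<open>enn2real\<close> in
  \<open>R\<close> changes it only on a null set.\<close>

lemma nu_density: assumes "i < 3" shows "density kus (\<lambda>x. ennreal (R k i x)) = nu i"
proof -
  interpret K: finite_measure kus by (rule kus_finite)
  interpret N: finite_measure "nu i" by (rule nu_finite[OF assms])
  have ac: "absolutely_continuous kus (nu i)"
    unfolding absolutely_continuous_def
  proof
    fix A assume "A \<in> null_sets kus"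
    then have A: "A \<in> sets BK" "emeasure kus A = 0" using kus_spec(1) by (auto simp: null_sets_def)
    then have "emeasure (nu i) A = 0" using kus_spec(2)[OF A(1)] assms by auto
    then show "A \<in> null_sets (nu i)" using A(1) nu_spec(1)[OF assms] by (auto simp: null_sets_def)
  qed
  have s: "sets (nu i) = sets kus" using nu_spec(1)[OF assms] kus_spec(1) by simp
  have "AE x in kus. RN_deriv kus (nu i) x \<noteq> \<infinity>"
    by (rule K.RN_deriv_finite[OF _ ac s]) unfold_locales
  then have "AE x in kus. ennreal (R k i x) = RN_deriv kus (nu i) x"
    by (rule AE_mp) (auto intro!: AE_I2 simp: R_def less_top)
  then have "density kus (\<lambda>x. ennreal (R k i x)) = density kus (RN_deriv kus (nu i))"
    by (intro density_cong) (auto simp: R_def)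
  then show ?thesis using K.density_RN_deriv[OF ac s] by simp
qed

lemma R_borel [measurable]: "R k i \<in> borel_measurable kus"
  unfolding R_def[abs_def] by measurable

lemma R_nonneg: "R k i x \<ge> 0" by (simp add: R_def)

lemma R_integral:
  assumes "i < 3" "A \<in> sets BK"
  shows "integrable kus (\<lambda>x. R k i x * indicat_real A x)" "measure (nu i) A = (\<integral>x. R k i x * indicat_real A x \<partial>kus)"
proof -
  have A: "A \<in> sets kus" using assms(2) kus_spec(1) by simp
  have unit_bdry: "indicat_real A \<in> borel_measurable kus" using A by simp
  interpret N: finite_measure "nu i" by (rule nu_finite[OF assms(1)])
  have "integrable (nu i) (indicat_real A)"
    using assms(2) nu_spec(1)[OF assms(1)] by (intro integrable_real_indicator) (auto simp: N.emeasure_eq_measure)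
  then have "integrable (density kus (\<lambda>x. ennreal (R k i x))) (indicat_real A)" by (simp only: nu_density[OF assms(1)])
  then show "integrable kus (\<lambda>x. R k i x * indicat_real A x)"
    using integrable_density[OF unit_bdry R_borel] R_nonneg by simp
  have "measure (nu i) A = (\<integral>x. indicat_real A x \<partial>nu i)"
    using assms nu_spec(1) sets_eq_imp_space_eq[OF nu_spec(1)[OF assms(1)]] by (auto simp: sets_BK Int_absorb2)
  also have "\<dots> = (\<integral>x. R k i x * indicat_real A x \<partial>kus)"
    using integral_density[OF unit_bdry R_borel] R_nonneg by (subst nu_density[OF assms(1), symmetric]) simp
  finally show "measure (nu i) A = (\<integral>x. R k i x * indicat_real A x \<partial>kus)" .
qed

section \<open>Cell weights and the matrices M_n\<close>

lemma word_map_linear: "j < 3 \<Longrightarrow> word_map w f j = (\<Sum>l<3. f l * word_map w (unit_bdry l) j)"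
proof (induction w arbitrary: f)
  case Nil then show ?case by (auto simp: sum3 less3 unit_bdry_def)
next
  case (Cons n w)
  have M: "cell_map n f l = (\<Sum>i<3. f i * cell_map n (unit_bdry i) l)" for l
    by (simp add: cell_map_def sum3 dirichlet_ext_unit_bdry) (simp add: dirichlet_ext_def sum3)
  have "word_map (n # w) f j = (\<Sum>l<3. cell_map n f l * word_map w (unit_bdry l) j)"
    using Cons.IH[OF Cons.prems, of "cell_map n f"] by (simp only: word_map.simps)
  also have "\<dots> = (\<Sum>l<3. (\<Sum>i<3. f i * cell_map n (unit_bdry i) l) * word_map w (unit_bdry l) j)"
    by (rule sum.cong[OF refl]) (subst M, rule refl)
  also have "\<dots> = (\<Sum>i<3. f i * (\<Sum>l<3. cell_map n (unit_bdry i) l * word_map w (unit_bdry l) j))"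
    by (simp add: sum3 algebra_simps)
  also have "\<dots> = (\<Sum>i<3. f i * word_map (n # w) (unit_bdry i) j)"
    using Cons.IH[OF Cons.prems, of "cell_map n (unit_bdry _)"] by (simp only: word_map.simps)
  finally show ?case .
qed

lemma word_map_const: "valid w \<Longrightarrow> (\<And>i. i < 3 \<Longrightarrow> f i = c) \<Longrightarrow> j < 3 \<Longrightarrow> word_map w f j = c"
proof (induction w arbitrary: f)
  case (Cons n w)
  have n: "n < d k" using Cons.prems by simp
  have "cell_map n f i - c = 0" if "i < 3" for i
    unfolding cell_map_const[OF n that] using Cons.prems(2) by (intro sum.neutral) simp
  then show ?case using Cons by simp
qed simp

text \<open>Writing E(a) for the energy and B for its bilinear form: constants have no energy, so 2
  B(a_i, a_j) = E(a_l) - E(a_i) - E(a_j) whenever i, j, l are the three indices. Removing the cross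
  terms in this way produces the numerators of the entries of M_n.\<close>

lemma tri_energy_form_expand:
  fixes f :: "nat \<Rightarrow> real" and a :: "nat \<Rightarrow> nat \<Rightarrow> real"
  assumes "\<And>j. j < 3 \<Longrightarrow> a 0 j + a 1 j + a 2 j = 1"
  shows "tri_energy_form (\<lambda>j. f 0 * a 0 j + f 1 * a 1 j + f 2 * a 2 j) (\<lambda>j. f 0 * a 0 j + f 1 * a 1 j + f 2 * a 2 j) =
     ((f 0)^2 - f 0 * f 1 - f 0 * f 2 + f 1 * f 2) * tri_energy_form (a 0) (a 0) +
     ((f 1)^2 - f 0 * f 1 + f 0 * f 2 - f 1 * f 2) * tri_energy_form (a 1) (a 1) +
     ((f 2)^2 + f 0 * f 1 - f 0 * f 2 - f 1 * f 2) * tri_energy_form (a 2) (a 2)"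
proof -
  have "a 2 0 = 1 - a 0 0 - a 1 0" "a 2 1 = 1 - a 0 1 - a 1 1" "a 2 2 = 1 - a 0 2 - a 1 2"
    using assms[of 0] assms[of 1] assms[of 2] by simp_all
  then show ?thesis unfolding tri_energy_form_def by algebra
qed

lemma cell_energy_self_similar:
  assumes "n < d k" "valid w"
  shows "(\<Sum>j<3. cell_energy (unit_bdry j) (n # w)) = (\<Sum>i<3. S k n i * cell_energy (unit_bdry i) w)"
proof -
  let ?a = "\<lambda>i. word_map w (unit_bdry i)"
  \<comment> \<open>The word maps are linear and fix constants, so the triple of ones stays the sum
    of the three unit triples.\<close>
  have one: "?a 0 j + ?a 1 j + ?a 2 j = 1" if "j < 3" for j
    using word_map_linear[OF that, of w "\<lambda>_. 1"] word_map_const[OF assms(2) _ that, of "\<lambda>_. 1" 1] by (simp add: sum3)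
  have *: "cell_energy (unit_bdry j) (n # w) = (\<Sum>i<3. mu k n j i * cell_energy (unit_bdry i) w)" if "j < 3" for j
  proof -
    let ?f = "cell_map n (unit_bdry j)"
    have f: "?f i = p k j n i" for i using that by (simp add: cell_map_def dirichlet_ext_unit_bdry p_def)
    have "tri_energy_form (word_map w ?f) (word_map w ?f) = tri_energy_form (\<lambda>j. ?f 0 * ?a 0 j + ?f 1 * ?a 1 j + ?f 2 * ?a 2 j) (\<lambda>j. ?f 0 * ?a 0 j + ?f 1 * ?a 1 j + ?f 2 * ?a 2 j)"
      by (intro tri_energy_form_cong) (simp_all only: word_map_linear[of _ w ?f] sum3)
    also have "\<dots> = ((?f 0)^2 - ?f 0 * ?f 1 - ?f 0 * ?f 2 + ?f 1 * ?f 2) * tri_energy_form (?a 0) (?a 0) +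
     ((?f 1)^2 - ?f 0 * ?f 1 + ?f 0 * ?f 2 - ?f 1 * ?f 2) * tri_energy_form (?a 1) (?a 1) +
     ((?f 2)^2 + ?f 0 * ?f 1 - ?f 0 * ?f 2 - ?f 1 * ?f 2) * tri_energy_form (?a 2) (?a 2)"
      by (rule tri_energy_form_expand[OF one])
    finally have B: "tri_energy_form (word_map w ?f) (word_map w ?f) = renorm * (\<Sum>i<3. mu k n j i * tri_energy_form (?a i) (?a i))"
      using renorm_pos unfolding f by (simp add: sum3 mu_def Let_def rk_eq distrib_left)
    \<comment> \<open>The additional letter n contributes a factor 1/\<open>renorm\<close>, which is
      the 1/r in the entries of M_n.\<close>
    have "cell_energy (unit_bdry j) (n # w) = tri_energy_form (word_map w ?f) (word_map w ?f) / renorm ^ length w / renorm"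
      unfolding cell_energy_Cons unfolding cell_energy_def ..
    then show ?thesis
      unfolding B cell_energy_def using renorm_pos by (simp add: sum_divide_distrib)
  qed
  have "(\<Sum>j<3. cell_energy (unit_bdry j) (n # w)) = (\<Sum>j<3. \<Sum>i<3. mu k n j i * cell_energy (unit_bdry i) w)"
    by (rule sum.cong[OF refl]) (simp add: *)
  also have "\<dots> = (\<Sum>i<3. S k n i * cell_energy (unit_bdry i) w)"
    unfolding S_def sum_distrib_right by (rule sum.swap)
  finally show ?thesis .
qed

section \<open>Self-similarity of the Kusuoka measure\<close>

lemma F_inv_measurable:
  assumes "n < d k"
  shows "F_inv n \<in> measurable (restrict_space kus (F k n ` KK)) BK"
proof (rule measurable_restrict_space2)
  have c: "F k n ` KK \<in> sets BK" using cell_BK[of "[n]"] assms by simp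
  show "F_inv n \<in> space (restrict_space kus (F k n ` KK)) \<rightarrow> KK"
    by (auto simp: space_restrict_space)
  have "F_inv n \<in> borel_measurable borel"
    by (rule borel_measurable_continuous_onI[OF F_inv_continuous])
  then have "F_inv n \<in> borel_measurable BK" by (rule measurable_restrict_space1)
  then have "F_inv n \<in> borel_measurable kus" by (simp add: kus_measurable)
  then show "F_inv n \<in> borel_measurable (restrict_space kus (F k n ` KK))" by (rule measurable_restrict_space1)
qed

text \<open>Pushing the restriction to cell n forward by \<open>F_inv n\<close> realizes the
  composition of the Kusuoka measure with \<open>F k n\<close> as a genuine measure.\<close>

lemma F_image_BK:
  assumes "n < d k" "A \<in> sets BK"
  shows "F k n ` A \<in> sets BK" "emeasure (distr (restrict_space kus (F k n ` KK)) BK (F_inv n)) A = emeasure kus (F k n ` A)"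
proof -
  have c: "F k n ` KK \<in> sets kus" using cell_BK[of "[n]"] assms(1) kus_spec(1) by simp
  have AK: "A \<subseteq> KK" using assms(2) by (simp add: sets_BK)
  have CK: "F k n ` KK \<inter> space kus = F k n ` KK" using sets.sets_into_space[OF c] by blast
  have sp: "space (restrict_space kus (F k n ` KK)) = F k n ` KK"
    using CK by (simp only: space_restrict_space)
  have eq: "F_inv n -` A \<inter> F k n ` KK = F k n ` A"
  proof (intro equalityI subsetI)
    fix x assume "x \<in> F_inv n -` A \<inter> F k n ` KK"
    then have "F_inv n x \<in> A" by blast
    from imageI[OF this, of "F k n"] show "x \<in> F k n ` A" by (simp only: F_F_inv_cancel)
  next
    fix x assume "x \<in> F k n ` A"
    then obtain y where "y \<in> A" "x = F k n y" by blast
    then show "x \<in> F_inv n -` A \<inter> F k n ` KK" using AK by (simp only: vimage_eq F_inv_F_cancel Int_iff) blast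
  qed
  have m: "F k n ` A \<in> sets (restrict_space kus (F k n ` KK))"
    using measurable_sets[OF F_inv_measurable[OF assms(1)] assms(2)] unfolding sp eq .
  then show "F k n ` A \<in> sets BK"
    using sets_restrict_space_iff[of "F k n ` KK" kus "F k n ` A"] c CK kus_spec(1)
    by (simp only: Int_commute) blast
  have "emeasure (distr (restrict_space kus (F k n ` KK)) BK (F_inv n)) A
      = emeasure (restrict_space kus (F k n ` KK)) (F k n ` A)"
    using emeasure_distr[OF F_inv_measurable[OF assms(1)] assms(2)] unfolding sp eq .
  also have "\<dots> = emeasure kus (F k n ` A)"
  proof (rule emeasure_restrict_space)
    show "F k n ` KK \<inter> space kus \<in> sets kus" unfolding CK by (rule c)
  qed (use AK in blast)
  finally show "emeasure (distr (restrict_space kus (F k n ` KK)) BK (F_inv n)) A = emeasure kus (F k n ` A)" .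
qed

lemma kus_self_similar:
  assumes n: "n < d k" and A: "A \<in> sets BK"
  shows "measure kus (F k n ` A) = (\<Sum>i<3. S k n i * measure (nu i) A)"
proof -
  let ?N = "distr (restrict_space kus (F k n ` KK)) BK (F_inv n)"
  have N: "measure ?N B = measure kus (F k n ` B)" if "B \<in> sets BK" for B
    unfolding measure_def F_image_BK(2)[OF n that] ..
  interpret K: finite_measure kus by (rule kus_finite)
  have fin: "finite_measure ?N"
  proof (rule finite_measureI)
    have "KK \<in> sets BK" using cell_BK[of "[]"] by simp
    then have "emeasure ?N KK = emeasure kus (F k n ` KK)" by (rule F_image_BK(2)[OF n])
    moreover have "space ?N = KK" by simp
    ultimately show "emeasure ?N (space ?N) \<noteq> \<infinity>" by (simp only: K.emeasure_eq_measure) simp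
  qed
  let ?M = "\<lambda>i::nat. if i < 3 then nu i else ?N" let ?c = "\<lambda>i::nat. if i < 3 then S k n i else - 1"
  have split: "(\<Sum>i<4. ?c i * measure (?M i) B) = (\<Sum>i<3. S k n i * measure (nu i) B) - measure ?N B" for B
    by (simp add: numeral_eq_Suc)
  have "(\<Sum>i<4. ?c i * measure (?M i) A) = 0"
  proof (rule signed_unique[OF _ _ _ _ _ A])
    show "finite_measure (?M i)" "sets (?M i) = sets BK" for i
      using fin nu_finite nu_spec(1) by auto
    fix w :: "nat list" assume w: "valid w"
    have "measure ?N (Fw k w ` KK) = measure kus (Fw k (n # w) ` KK)"
      by (simp add: N[OF cell_BK[OF w]] image_comp)
    also have "\<dots> = (\<Sum>i<3. cell_energy (unit_bdry i) (n # w))"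
      using w n by (subst measure_kus) (auto intro!: cell_BK sum.cong simp: nu_cell simp del: Fw_simps)
    finally show "(\<Sum>i<4. ?c i * measure (?M i) (Fw k w ` KK)) = 0"
      unfolding split using w by (simp add: nu_cell cell_energy_self_similar[OF n w])
  next
    fix x assume x: "x \<in> VV"
    have xB: "{y} \<in> sets BK" if "y \<in> VV" for y using that VV_KK by (auto simp: sets_BK)
    have "measure ?N {x} = 0"
      using N[OF xB[OF x]] measure_kus[OF xB[OF F_VV[OF n x]]] nu_vertex_measure F_VV[OF n x] by simp
    then show "(\<Sum>i<4. ?c i * measure (?M i) {x}) = 0"
      unfolding split using x by (simp add: nu_vertex_measure)
  qed simp
  then show ?thesis unfolding split N[OF A] by simp
qed

lemma Q_borel [measurable]: "Q k n \<in> borel_measurable kus"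
  unfolding Q_def[abs_def] by measurable

lemma Q_integral:
  assumes n: "n < d k" and A: "A \<in> sets BK"
  shows "integrable kus (\<lambda>x. Q k n x * indicat_real A x)"
    "measure kus (F k n ` A) = (\<integral>x. Q k n x * indicat_real A x \<partial>kus)"
proof -
  have eq: "Q k n x * indicat_real A x = (\<Sum>i<3. S k n i * (R k i x * indicat_real A x))" for x
    by (simp add: Q_def sum_distrib_right mult.assoc)
  have int: "integrable kus (\<lambda>x. S k n i * (R k i x * indicat_real A x))" if "i < 3" for i
    by (intro integrable_mult_right R_integral(1)[OF that A])
  show "integrable kus (\<lambda>x. Q k n x * indicat_real A x)"
    unfolding eq using int by (intro Bochner_Integration.integrable_sum) auto
  have "(\<integral>x. Q k n x * indicat_real A x \<partial>kus) = (\<Sum>i<3. \<integral>x. S k n i * (R k i x * indicat_real A x) \<partial>kus)"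
    unfolding eq using int by (intro Bochner_Integration.integral_sum) auto
  also have "\<dots> = (\<Sum>i<3. S k n i * measure (nu i) A)"
    by (rule sum.cong[OF refl]) (simp add: R_integral(2)[OF _ A])
  finally show "measure kus (F k n ` A) = (\<integral>x. Q k n x * indicat_real A x \<partial>kus)"
    using kus_self_similar[OF n A] by simp
qed

text \<open>On the set where Q is negative its integral equals a value of the Kusuoka measure, which
  is nonnegative; so the set is null. Only then may Q serve as a density.\<close>

lemma Q_nonneg: assumes "n < d k" shows "AE x in kus. 0 \<le> Q k n x"
proof -
  let ?A = "{x \<in> space kus. Q k n x < 0}"
  have A: "?A \<in> sets BK" unfolding kus_spec(1)[symmetric] by measurable
  let ?g = "\<lambda>x. - (Q k n x * indicat_real ?A x)"
  have int: "integrable kus ?g" using Q_integral(1)[OF assms A] by (rule Bochner_Integration.integrable_minus)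
  have nn: "0 \<le> ?g x" for x by (auto simp: indicator_def)
  have "(\<integral>x. ?g x \<partial>kus) \<ge> 0" by (rule Bochner_Integration.integral_nonneg) (rule nn)
  moreover have "(\<integral>x. ?g x \<partial>kus) = - measure kus (F k n ` ?A)"
    unfolding Q_integral(2)[OF assms A] by (rule integral_minus)
  ultimately have "(\<integral>x. ?g x \<partial>kus) = 0" using measure_nonneg[of kus "F k n ` ?A"] by linarith
  then have "AE x in kus. ?g x = 0"
    using integral_nonneg_eq_0_iff_AE[OF int] nn by simp
  then show ?thesis
    by (rule AE_mp) (auto intro!: AE_I2 simp: indicator_def split: if_splits)
qed

lemma kus_pullback:
  assumes n: "n < d k"
  shows "distr (restrict_space kus (F k n ` KK)) BK (F_inv n) = density kus (\<lambda>x. ennreal (Q k n x))"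
    (is "?N = ?D")
proof (rule measure_eqI)
  show "sets ?N = sets ?D" by (simp add: kus_spec(1))
  fix A assume "A \<in> sets ?N"
  then have A: "A \<in> sets BK" by simp
  interpret K: finite_measure kus by (rule kus_finite)
  have "emeasure ?N A = ennreal (measure kus (F k n ` A))"
    using F_image_BK[OF n A] by (simp add: K.emeasure_eq_measure)
  also have "\<dots> = ennreal (\<integral>x. Q k n x * indicat_real A x \<partial>kus)" unfolding Q_integral(2)[OF n A] ..
  also have "\<dots> = (\<integral>\<^sup>+x. ennreal (Q k n x * indicat_real A x) \<partial>kus)"
    using Q_nonneg[OF n] by (intro nn_integral_eq_integral[symmetric] Q_integral(1)[OF n A]) (auto elim!: AE_mp)
  also have "\<dots> = (\<integral>\<^sup>+x. ennreal (Q k n x) * indicator A x \<partial>kus)"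
    by (intro nn_integral_cong) (auto simp: indicator_def)
  also have "\<dots> = emeasure ?D A"
    using A kus_spec(1) by (intro emeasure_density[symmetric]) auto
  finally show "emeasure ?N A = emeasure ?D A" .
qed

lemma continuous_measurable: "continuous_on KK g \<Longrightarrow> g \<in> borel_measurable BK"
  for g :: "complex \<Rightarrow> real"
  by (rule borel_measurable_continuous_on_restrict)

section \<open>Transplanting test functions\<close>

definition transplant :: "nat \<Rightarrow> (complex \<Rightarrow> real) \<Rightarrow> complex \<Rightarrow> real" where
  "transplant n v x = (if x \<in> F k n ` KK then v (F_inv n x) else 0)"

lemma transplant_same: "x \<in> KK \<Longrightarrow> transplant n v (F k n x) = v x"
  by (simp add: transplant_def)

text \<open>A point common to cells l and n comes from \<open>V0\<close> by \<open>overlap\<close>,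
  where v is zero. This is how the Dirichlet condition on test functions enters.\<close>

lemma transplant_other:
  assumes "n < d k" "l < d k" "l \<noteq> n" "x \<in> KK" "\<And>x. x \<in> V0 \<Longrightarrow> v x = 0"
  shows "transplant n v (F k l x) = 0"
proof (cases "F k l x \<in> F k n ` KK")
  case True
  then obtain y where y: "y \<in> KK" "F k l x = F k n y" by blast
  have "y \<in> V0" using overlap(2)[OF assms(1,2) assms(3)[symmetric] _ _ y(2)[symmetric]] y(1) assms(4) KK_Tri by blast
  then show ?thesis using assms(5) y transplant_same by simp
qed (simp add: transplant_def)

lemma integral_transplant:
  assumes n: "n < d k" and f: "continuous_on KK f" and v: "continuous_on KK v"
  shows "(\<integral>x. f x * transplant n v x \<partial>kus) = (\<integral>x. Q k n x * (f (F k n x) * v x) \<partial>kus)"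
proof -
  let ?C = "F k n ` KK" let ?h = "\<lambda>y. f (F k n y) * v y"
  have c: "?C \<inter> space kus \<in> sets kus" using F_image_BK(1)[OF n, of KK] cell_BK[of "[]"] kus_spec(1) by auto
  have "continuous_on KK (\<lambda>y. f (F k n y))"
    by (rule continuous_on_compose2[OF f F_continuous]) (use F_KK[OF n] in auto)
  then have h: "?h \<in> borel_measurable BK"
    by (intro continuous_measurable continuous_intros v)
  have "(\<integral>x. f x * transplant n v x \<partial>kus) = (\<integral>x. indicat_real ?C x *\<^sub>R ?h (F_inv n x) \<partial>kus)"
    by (intro Bochner_Integration.integral_cong refl) (auto simp: transplant_def indicator_def)
  also have "\<dots> = (\<integral>x. ?h (F_inv n x) \<partial>restrict_space kus ?C)"
    by (rule integral_restrict_space[OF c, symmetric])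
  also have "\<dots> = (\<integral>y. ?h y \<partial>distr (restrict_space kus ?C) BK (F_inv n))"
    by (rule integral_distr[OF F_inv_measurable[OF n] h, symmetric])
  also have "\<dots> = (\<integral>y. Q k n y *\<^sub>R ?h y \<partial>kus)"
    unfolding kus_pullback[OF n]
    by (rule integral_density[OF _ Q_borel Q_nonneg[OF n]]) (simp only: kus_measurable h)
  finally show ?thesis by simp
qed

lemma Ebm_cong: "(\<And>x. x \<in> V k m \<Longrightarrow> u x = u' x) \<Longrightarrow> (\<And>x. x \<in> V k m \<Longrightarrow> v x = v' x) \<Longrightarrow> Ebm k m u v = Ebm k m u' v'"
  using GB_cong[of m u u' v v'] by (simp add: Ebm_renorm)

lemma Em_Ebm: "Em k m u = Ebm k m u u"
  by (simp add: Em_renorm Ebm_renorm)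

lemma Ebm_transplant:
  assumes n: "n < d k" and v: "\<And>x. x \<in> V0 \<Longrightarrow> v x = 0"
  shows "Ebm k (Suc m) u (transplant n v) = Ebm k m (u \<circ> F k n) v / renorm"
proof -
  have zero: "Ebm k m u (\<lambda>_. 0) = 0" for u by (simp add: Ebm_renorm GB_commute[of m u] GB_const)
  have "(\<Sum>l<d k. Ebm k m (u \<circ> F k l) (transplant n v \<circ> F k l)) = (\<Sum>l<d k. if l = n then Ebm k m (u \<circ> F k n) v else 0)"
  proof (rule sum.cong[OF refl])
    fix l assume l: "l \<in> {..<d k}"
    show "Ebm k m (u \<circ> F k l) (transplant n v \<circ> F k l) = (if l = n then Ebm k m (u \<circ> F k n) v else 0)"
    proof (cases "l = n")
      case True
      have "Ebm k m (u \<circ> F k n) (transplant n v \<circ> F k n) = Ebm k m (u \<circ> F k n) v"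
        by (rule Ebm_cong) (simp_all add: transplant_same subsetD[OF V_KK])
      then show ?thesis using True by simp
    next
      case False
      have "Ebm k m (u \<circ> F k l) (transplant n v \<circ> F k l) = Ebm k m (u \<circ> F k l) (\<lambda>_. 0)"
        using l transplant_other[where v = v, OF n _ False _ v]
        by (intro Ebm_cong) (simp_all add: subsetD[OF V_KK])
      then show ?thesis using False zero by simp
    qed
  qed
  then show ?thesis using n by (simp add: Ebm_Suc sum.delta')
qed

lemma transplant_dom0:
  assumes n: "n < d k" and v: "v \<in> dom0 k"
  shows "transplant n v \<in> dom0 k"
proof -
  have v0: "\<And>x. x \<in> V0 \<Longrightarrow> v x = 0" and vc: "continuous_on KK v" and ve: "finite_energy v"
    using v by (auto simp: dom0_def domE_iff)
  have "continuous_on (\<Union>l\<in>{..<d k}. F k l ` KK) (transplant n v)"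
  proof (rule continuous_on_closed_Union)
    fix l assume l: "l \<in> {..<d k}"
    show "closed (F k l ` KK)"
      by (rule compact_imp_closed[OF compact_continuous_image[OF F_continuous compact_KK]])
    show "continuous_on (F k l ` KK) (transplant n v)"
    proof (cases "l = n")
      case True
      have "continuous_on (F k n ` KK) (v \<circ> F_inv n)"
        by (rule continuous_on_compose[OF F_inv_continuous]) (simp add: image_image vc)
      then show ?thesis unfolding True by (rule continuous_on_eq) (auto simp: transplant_same)
    next
      case False
      have "continuous_on (F k l ` KK) (\<lambda>_. 0 :: real)" by simp
      then show ?thesis by (rule continuous_on_eq) (use l transplant_other[OF n _ False _ v0] in auto)
    qed
  qed simp
  then have cont: "continuous_on KK (transplant n v)" by (simp only: KK_F[symmetric])
  have zero: "transplant n v x = 0" if "x \<in> V0" for x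
  proof -
    obtain i where i: "i < 3" "x = q i" using \<open>x \<in> V0\<close> by (rule V0E)
    have x: "x = F k (corner i) (q i)" using corner(2)[OF i(1)] i(2) by simp
    show ?thesis
    proof (cases "corner i = n")
      case True
      then show ?thesis using x transplant_same[OF q_KK[OF i(1)], of n v] v0[OF q_in_V0[OF i(1)]] by simp
    next
      case False
      then show ?thesis using x transplant_other[OF n corner(1)[OF i(1)] False q_KK[OF i(1)] v0] by simp
    qed
  qed
  obtain C where C: "\<And>m. Em k m v \<le> C" using ve by (auto simp: finite_energy_def)
  have "Em k m (transplant n v) \<le> C / renorm" for m
  proof -
    \<comment> \<open>\<open>Ebm_transplant\<close> evaluates positive levels only, hence the
      passage to the next level.\<close>
    have "Em k m (transplant n v) \<le> Em k (Suc m) (transplant n v)" by (rule Em_mono_Suc)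
    also have "\<dots> = Ebm k m (transplant n v \<circ> F k n) v / renorm" unfolding Em_Ebm by (rule Ebm_transplant[OF n v0])
    also have "Ebm k m (transplant n v \<circ> F k n) v = Em k m v"
      unfolding Em_Ebm by (rule Ebm_cong) (simp_all add: transplant_same subsetD[OF V_KK])
    finally show ?thesis using C[of m] renorm_pos by (meson divide_right_mono less_imp_le order_trans)
  qed
  then show ?thesis using cont zero by (auto simp: dom0_def domE_iff finite_energy_def)
qed

lemma Eform_transplant:
  assumes n: "n < d k" and u: "finite_energy u" and v: "v \<in> dom0 k"
  shows "Eform k (u \<circ> F k n) v = renorm * Eform k u (transplant n v)"
proof -
  have v0: "\<And>x. x \<in> V0 \<Longrightarrow> v x = 0" and ve: "finite_energy v"
    using v by (auto simp: dom0_def domE_iff)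
  have t: "finite_energy (transplant n v)" using transplant_dom0[OF n v] by (simp add: dom0_def domE_iff)
  have "(\<lambda>m. Ebm k m (u \<circ> F k n) v / renorm) \<longlonglongrightarrow> Eform k (u \<circ> F k n) v / renorm"
    by (intro tendsto_divide Ebm_tendsto finite_energy_F u n ve tendsto_const) (use renorm_pos in simp)
  \<comment> \<open>Level m inside the cell is level m + 1 outside; the shift leaves the limit
    unchanged.\<close>
  moreover have "(\<lambda>m. Ebm k m (u \<circ> F k n) v / renorm) \<longlonglongrightarrow> Eform k u (transplant n v)"
    using LIMSEQ_Suc[OF Ebm_tendsto[OF u t]] by (simp only: Ebm_transplant[OF n v0])
  ultimately have "Eform k (u \<circ> F k n) v / renorm = Eform k u (transplant n v)" by (rule LIMSEQ_unique)
  moreover have "renorm \<noteq> 0" using renorm_pos by simp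
  ultimately show ?thesis by (metis nonzero_mult_div_cancel_left times_divide_eq_right)
qed

end

theorem theorem2p11:
  fixes k j :: nat and u f :: "complex \<Rightarrow> real"
  assumes "k \<ge> 2" and "j < d k" and "lap_rel k u f"
  shows "u \<circ> F k j \<in> domE k \<and>
    (\<forall>v\<in>dom0 k. Eform k (u \<circ> F k j) v =
        - (\<integral>x. rk k * Q k j x * f (F k j x) * v x \<partial>kusuoka k))"
proof -
  interpret gasket k by unfold_locales (rule assms(1))
  have u: "continuous_on KK u" "finite_energy u" and f: "continuous_on KK f"
    and lap: "\<And>v. v \<in> dom0 k \<Longrightarrow> Eform k u v = - (\<integral>x. f x * v x \<partial>kusuoka k)"
    using assms(3) by (auto simp: lap_rel_def domE_iff K_eq)
  have "continuous_on KK (u \<circ> F k j)"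
    using u(1) F_KK[OF assms(2)] continuous_on_subset
    by (intro continuous_on_compose F_continuous) blast
  then have "u \<circ> F k j \<in> domE k"
    using finite_energy_F[OF u(2) assms(2)] by (simp add: domE_iff)
  moreover have "Eform k (u \<circ> F k j) v = - (\<integral>x. rk k * Q k j x * f (F k j x) * v x \<partial>kusuoka k)"
    if v: "v \<in> dom0 k" for v
  proof -
    have "continuous_on KK v" using v by (simp add: dom0_def domE_iff)
    have "Eform k (u \<circ> F k j) v = renorm * Eform k u (transplant j v)"
      by (rule Eform_transplant[OF assms(2) u(2) v])
    also have "\<dots> = - (renorm * (\<integral>x. Q k j x * (f (F k j x) * v x) \<partial>kusuoka k))"
      unfolding lap[OF transplant_dom0[OF assms(2) v]]
      by (simp add: integral_transplant[OF assms(2) f \<open>continuous_on KK v\<close>])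
    also have "\<dots> = - (\<integral>x. rk k * Q k j x * f (F k j x) * v x \<partial>kusuoka k)"
      by (simp add: rk_eq mult.assoc)
    finally show ?thesis .
  qed
  ultimately show ?thesis by blast
qed

end
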